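(* There exist orientation-preserving $C^{\infty}$ diffeomorphisms of a closed interval (say $[0,1]$) that are distorted in the group $\mathrm{Diff}^1_+([0,1])$ yet undistorted in the group $\mathrm{Diff}^2_+([0,1])$.
   Context: For an integer $r\ge 1$, $\mathrm{Diff}^r_+([0,1])$ is the group (under composition) of orientation-preserving $C^r$ diffeomorphisms of the closed interval $[0,1]$ (smooth up to the endpoints, with inverse of class $C^r$). An element $f$ of a group $G$ is said to be distorted in $G$ if there exists a finitely generated subgroup $\Gamma\subset G$ containing $f$ such that $\lim_{n\to\infty}\|f^n\|_{\Gamma}/n=0$, where $\|\cdot\|_{\Gamma}$ is the word-length with respect to some (equivalently, any) finite generating system of $\Gamma$. The limit always exists by subadditivity. The element $f$ is undistorted in $G$ if it is not distorted in $G$. *)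

theory Defs
  imports
    "HOL-Algebra.Bij"
    "HOL-Algebra.Generated_Groups"
    "HOL-Analysis.Analysis"
    "HOL-Library.Extended_Nat"
begin

section \<open>Regularity up to the boundary\<close>

text \<open>Derivatives are taken within \<^term>\<open>S\<close>, so at the endpoints of a compact interval they are
  one-sided; there the witness \<^term>\<open>f'\<close> is determined on \<^term>\<open>S\<close> by \<^term>\<open>f\<close>.\<close>

fun Ck_on :: "nat \<Rightarrow> (real \<Rightarrow> real) \<Rightarrow> real set \<Rightarrow> bool" where
  "Ck_on 0 f S \<longleftrightarrow> continuous_on S f"
| "Ck_on (Suc k) f S \<longleftrightarrow>
     (\<exists>f'. (\<forall>x\<in>S. (f has_real_derivative f' x) (at x within S)) \<and> Ck_on k f' S)"

section \<open>The diffeomorphism groups of the unit interval\<close>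

text \<open>For \<^term>\<open>r = (\<infinity> :: enat)\<close> this is the set of smooth diffeomorphisms.  As in
  \<^const>\<open>Bij\<close>, maps are extensional: they are \<^const>\<open>undefined\<close> off the interval, so that equality
  of elements is equality of maps on the interval.\<close>

definition Diff_plus_carrier :: "enat \<Rightarrow> (real \<Rightarrow> real) set" where
  "Diff_plus_carrier r =
     {f \<in> Bij {0..1}. strict_mono_on {0..1} f \<and>
        (\<forall>k. enat k \<le> r \<longrightarrow> Ck_on k f {0..1} \<and> Ck_on k (inv_into {0..1} f) {0..1})}"

definition Diff_plus :: "enat \<Rightarrow> (real \<Rightarrow> real) monoid" where
  "Diff_plus r = BijGroup {0..1} \<lparr>carrier := Diff_plus_carrier r\<rparr>"

section \<open>Word length and distortion\<close>

text \<open>The length is only meaningful for \<^term>\<open>g \<in> generate G S\<close>.\<close>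

definition word_length :: "('a, 'b) monoid_scheme \<Rightarrow> 'a set \<Rightarrow> 'a \<Rightarrow> nat" where
  "word_length G S g =
     (LEAST n. \<exists>ws. length ws = n \<and> set ws \<subseteq> S \<union> m_inv G ` S \<and> foldr (\<otimes>\<^bsub>G\<^esub>) ws \<one>\<^bsub>G\<^esub> = g)"

definition distorted :: "('a, 'b) monoid_scheme \<Rightarrow> 'a \<Rightarrow> bool" where
  "distorted G f \<longleftrightarrow>
     (\<exists>\<Gamma> S. subgroup \<Gamma> G \<and> finite S \<and> S \<subseteq> \<Gamma> \<and> generate G S = \<Gamma> \<and> f \<in> \<Gamma> \<and>
        (\<lambda>n. real (word_length G S (f [^]\<^bsub>G\<^esub> (n::nat))) / real n) \<longlonglongrightarrow> 0)"

definition undistorted :: "('a, 'b) monoid_scheme \<Rightarrow> 'a \<Rightarrow> bool" where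
  "undistorted G f \<longleftrightarrow> f \<in> carrier G \<and> \<not> distorted G f"

section \<open>The diffeomorphisms form a group\<close>

lemma Ck_on_Suc_imp: "Ck_on (Suc k) f S \<Longrightarrow> Ck_on k f S"
proof (induction k arbitrary: f)
  case 0
  then show ?case
    by (auto simp: continuous_on_eq_continuous_within intro: DERIV_continuous)
next
  case (Suc k)
  then show ?case by (metis Ck_on.simps(2))
qed

lemma Ck_on_cong: "(\<And>x. x \<in> S \<Longrightarrow> f x = g x) \<Longrightarrow> Ck_on k f S \<longleftrightarrow> Ck_on k g S"
proof (cases k)
  case 0
  assume "\<And>x. x \<in> S \<Longrightarrow> f x = g x"
  with 0 show ?thesis by (simp cong: continuous_on_cong)
next
  case (Suc m)
  assume eq: "\<And>x. x \<in> S \<Longrightarrow> f x = g x"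
  have "(f has_real_derivative d) (at x within S) \<longleftrightarrow> (g has_real_derivative d) (at x within S)"
    if "x \<in> S" for d x
    using that eq by (metis has_field_derivative_transform_within zero_less_one)
  with Suc show ?thesis by simp
qed

lemma Ck_on_add: "Ck_on k f S \<Longrightarrow> Ck_on k g S \<Longrightarrow> Ck_on k (\<lambda>x. f x + g x) S"
proof (induction k arbitrary: f g)
  case 0
  then show ?case by (auto intro: continuous_intros)
next
  case (Suc k)
  then obtain f' g' where
    "\<forall>x\<in>S. (f has_real_derivative f' x) (at x within S)" "Ck_on k f' S"
    "\<forall>x\<in>S. (g has_real_derivative g' x) (at x within S)" "Ck_on k g' S"
    by auto
  with Suc.IH show ?case
    by (auto intro!: exI[of _ "\<lambda>x. f' x + g' x"] DERIV_add)
qed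

lemma Ck_on_mult: "Ck_on k f S \<Longrightarrow> Ck_on k g S \<Longrightarrow> Ck_on k (\<lambda>x. f x * g x) S"
proof (induction k arbitrary: f g)
  case 0
  then show ?case by (auto intro: continuous_intros)
next
  case (Suc k)
  then obtain f' g' where *:
    "\<forall>x\<in>S. (f has_real_derivative f' x) (at x within S)" "Ck_on k f' S"
    "\<forall>x\<in>S. (g has_real_derivative g' x) (at x within S)" "Ck_on k g' S"
    by auto
  have "Ck_on k f S" "Ck_on k g S" using Suc.prems Ck_on_Suc_imp by blast+
  with * Suc.IH show ?case
    by (auto intro!: exI[of _ "\<lambda>x. f' x * g x + g' x * f x"] Ck_on_add DERIV_mult)
qed

lemma Ck_on_compose:
  "Ck_on k f S \<Longrightarrow> Ck_on k g S \<Longrightarrow> g ` S \<subseteq> S \<Longrightarrow> Ck_on k (\<lambda>x. f (g x)) S"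
proof (induction k arbitrary: f)
  case 0
  then show ?case by (auto intro: continuous_on_compose2)
next
  case (Suc k)
  then obtain f' g' where *:
    "\<forall>x\<in>S. (f has_real_derivative f' x) (at x within S)" "Ck_on k f' S"
    "\<forall>x\<in>S. (g has_real_derivative g' x) (at x within S)" "Ck_on k g' S"
    by auto
  have "Ck_on k g S" using Suc.prems Ck_on_Suc_imp by blast
  then have "Ck_on k (\<lambda>x. f' (g x) * g' x) S"
    using Suc.IH Suc.prems(3) * by (intro Ck_on_mult) auto
  moreover have "((\<lambda>x. f (g x)) has_real_derivative f' (g x) * g' x) (at x within S)"
    if "x \<in> S" for x
  proof -
    have "(f has_real_derivative f' (g x)) (at (g x) within g ` S)"
      using * Suc.prems(3) that by (meson DERIV_subset image_subset_iff)
    then show ?thesis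
      using DERIV_image_chain[of f "f' (g x)" g x S "g' x"] * that by (simp add: o_def)
  qed
  ultimately show ?case
    by (auto intro!: exI[of _ "\<lambda>x. f' (g x) * g' x"])
qed

lemma Ck_on_const: "Ck_on k (\<lambda>_. c) S"
  by (induction k arbitrary: c) (auto intro!: exI[of _ "\<lambda>_. 0"])

lemma Ck_on_id: "Ck_on k (\<lambda>x. x) S"
  by (cases k) (auto intro!: exI[of _ "\<lambda>_. 1"] DERIV_ident Ck_on_const)

lemma subgroup_Diff_plus: "subgroup (Diff_plus_carrier r) (BijGroup {0..1})"
proof (rule group.subgroupI[OF group_BijGroup])
  let ?I = "{0..1::real}"
  show "Diff_plus_carrier r \<subseteq> carrier (BijGroup ?I)"
    by (auto simp: Diff_plus_carrier_def BijGroup_def)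
  have inv_id: "inv_into ?I (restrict (\<lambda>x. x) ?I) x = x" if "x \<in> ?I" for x
    using that by (metis (mono_tags, lifting) f_inv_into_f image_eqI inv_into_into restrict_apply')
  have "restrict (\<lambda>x. x) ?I \<in> Diff_plus_carrier r"
    unfolding Diff_plus_carrier_def
    using Ck_on_id Ck_on_cong[of ?I "restrict (\<lambda>x. x) ?I" "\<lambda>x. x"]
      Ck_on_cong[of ?I "inv_into ?I (restrict (\<lambda>x. x) ?I)" "\<lambda>x. x", OF inv_id]
    by (auto simp: id_Bij strict_mono_on_def)
  then show "Diff_plus_carrier r \<noteq> {}" by blast
next
  let ?I = "{0..1::real}"
  fix f assume f: "f \<in> Diff_plus_carrier r"
  then have fB: "f \<in> Bij ?I" and bij: "bij_betw f ?I ?I" and mono: "strict_mono_on ?I f"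
    by (auto simp: Diff_plus_carrier_def Bij_def)
  let ?g = "restrict (inv_into ?I f) ?I"
  have g: "?g \<in> Bij ?I" using fB by (rule restrict_inv_into_Bij)
  have inv_g: "inv_into ?I ?g x = f x" if "x \<in> ?I" for x
    using that g bij fB
    by (intro inv_into_f_eq)
       (auto simp: Bij_def bij_betw_def inv_into_f_f dest: bij_betw_imp_inj_on)
  have "strict_mono_on ?I ?g"
  proof (rule strict_mono_onI)
    fix x y assume xy: "x \<in> ?I" "y \<in> ?I" "x < y"
    have m: "inv_into ?I f x \<in> ?I" "inv_into ?I f y \<in> ?I"
      using xy bij_betw_inv_into[OF bij] by (auto simp: bij_betw_def)
    have e: "f (inv_into ?I f x) = x" "f (inv_into ?I f y) = y"
      using xy bij bij_betw_inv_into_right by metis+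
    show "?g x < ?g y"
      using xy m e mono strict_mono_on_less by (metis restrict_apply')
  qed
  then have "?g \<in> Diff_plus_carrier r"
    using f g Ck_on_cong[of ?I ?g "inv_into ?I f"] Ck_on_cong[of ?I "inv_into ?I ?g" f, OF inv_g]
    by (auto simp: Diff_plus_carrier_def)
  then show "inv\<^bsub>BijGroup ?I\<^esub> f \<in> Diff_plus_carrier r"
    using inv_BijGroup[OF fB] by simp
next
  let ?I = "{0..1::real}"
  fix f g assume fg: "f \<in> Diff_plus_carrier r" "g \<in> Diff_plus_carrier r"
  then have B: "f \<in> Bij ?I" "g \<in> Bij ?I" and mono: "strict_mono_on ?I f" "strict_mono_on ?I g"
    and bij: "bij_betw f ?I ?I" "bij_betw g ?I ?I"
    by (auto simp: Diff_plus_carrier_def Bij_def)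
  let ?h = "compose ?I f g"
  have h: "?h \<in> Bij ?I" using B by (rule compose_Bij)
  have gI: "g ` ?I = ?I" and fI: "inv_into ?I f ` ?I = ?I"
    using bij(2) bij_betw_inv_into[OF bij(1)] by (simp_all add: bij_betw_def)
  have "strict_mono_on ?I ?h"
  proof (rule strict_mono_onI)
    fix x y assume xy: "x \<in> ?I" "y \<in> ?I" "x < y"
    have "g x \<in> ?I" "g y \<in> ?I" using xy gI by blast+
    moreover have "g x < g y" using xy mono(2) by (blast intro: strict_mono_onD)
    ultimately have "f (g x) < f (g y)" using mono(1) by (blast intro: strict_mono_onD)
    then show "?h x < ?h y" using xy by (simp add: compose_def)
  qed
  moreover have inv_h: "inv_into ?I ?h x = inv_into ?I g (inv_into ?I f x)" if "x \<in> ?I" for x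
  proof (rule inv_into_f_eq)
    have 1: "inv_into ?I f x \<in> ?I" using that fI by blast
    show 2: "inv_into ?I g (inv_into ?I f x) \<in> ?I"
      using 1 bij_betw_inv_into[OF bij(2)] by (auto simp: bij_betw_def)
    show "inj_on ?h ?I" using h by (auto simp: Bij_def bij_betw_def)
    have "g (inv_into ?I g (inv_into ?I f x)) = inv_into ?I f x"
      using bij_betw_inv_into_right[OF bij(2)] 1 by blast
    moreover have "f (inv_into ?I f x) = x" using bij_betw_inv_into_right[OF bij(1)] that by blast
    ultimately show "?h (inv_into ?I g (inv_into ?I f x)) = x" using 2 by (simp add: compose_def)
  qed
  moreover have "Ck_on k ?h ?I \<and> Ck_on k (inv_into ?I ?h) ?I" if "enat k \<le> r" for k
  proof
    have k: "Ck_on k f ?I" "Ck_on k g ?I" "Ck_on k (inv_into ?I f) ?I" "Ck_on k (inv_into ?I g) ?I"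
      using fg that by (auto simp: Diff_plus_carrier_def)
    show "Ck_on k ?h ?I"
      using Ck_on_compose[OF k(1,2)] gI Ck_on_cong[of ?I ?h "\<lambda>x. f (g x)"]
      by (simp add: compose_def)
    show "Ck_on k (inv_into ?I ?h) ?I"
      using Ck_on_compose[OF k(4,3)] fI
        Ck_on_cong[of ?I "inv_into ?I ?h" "\<lambda>x. inv_into ?I g (inv_into ?I f x)", OF inv_h]
      by simp
  qed
  ultimately have "?h \<in> Diff_plus_carrier r" using h by (auto simp: Diff_plus_carrier_def)
  then show "f \<otimes>\<^bsub>BijGroup ?I\<^esub> g \<in> Diff_plus_carrier r"
    using B by (simp add: BijGroup_def)
qed

lemma group_Diff_plus: "group (Diff_plus r)"
  unfolding Diff_plus_def using subgroup_Diff_plus group_BijGroup by (rule subgroup.subgroup_is_group)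

end

theory Submission
  imports Defs "HOL-Real_Asymp.Real_Asymp"
begin

text \<open>In the coordinate \<open>t = tan (pi (x - 1/2))\<close> on the open interval, translations become smooth
  diffeomorphisms of \<open>[0,1]\<close> and the dilation \<open>t \<mapsto> 2 t\<close> a \<open>C\<^sup>1\<close> one that conjugates a translation to its
  square.  Let \<open>\<kappa>\<^sub>c\<close> be a flow supported on \<open>[0,1] \<subseteq> \<real>\<close>, flat at the endpoints, and let
  \<open>f = k S k\<^sup>-\<^sup>1 S\<^sup>-\<^sup>1 S\<^sup>4\<close> with \<open>k = \<kappa>\<^sub>1\<close> and \<open>S t = t + 1\<close>.  Up to a translation, \<open>f\<^sup>N\<close> places a copy
  of \<open>k S k\<^sup>-\<^sup>1 S\<^sup>-\<^sup>1\<close> in each of \<open>N\<close> consecutive cells of length 4.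

  Every one of these cells contributes a definite amount to the variation of \<open>log Df\<^sup>N\<close>, which
  therefore grows linearly; since this variation is subadditive and finite on \<open>C\<^sup>2\<close> diffeomorphisms,
  \<open>f\<close> is undistorted among them.

  In class \<open>C\<^sup>1\<close> there is the diffeomorphism \<open>H\<close> that acts by \<open>\<kappa>\<^sub>1\<^sub>/\<^sub>(\<^sub>j\<^sub>+\<^sub>1\<^sub>)\<close> in the cells \<open>2\<^sup>j, \<dots>, 2\<^sup>j\<^sup>+\<^sup>1 - 1\<close>:
  it is \<open>C\<^sup>1\<close> at the endpoint because \<open>\<kappa>\<^sub>c \<rightarrow> id\<close> in \<open>C\<^sup>1\<close> as \<open>c \<rightarrow> 0\<close>.  Its commutator with a map
  equal to \<open>S\<close> on that block of cells and to the identity on the other supports is the \<open>(j+1)\<close>-st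
  root of the product of the \<open>2\<^sup>j\<close> copies of \<open>k S k\<^sup>-\<^sup>1 S\<^sup>-\<^sup>1\<close>.  As long translations are cheap, \<open>f\<close> to the
  power \<open>2\<^sup>j\<close> has word length \<open>O(j\<^sup>2)\<close>.\<close>

section \<open>Word length\<close>

text \<open>\<open>word_length\<close> is a LEAST and handles products badly. Words of an exact
  length compose freely, and each of them bounds the length by
  \<open>word_length_le\<close>.\<close>

definition is_word :: "('a, 'b) monoid_scheme \<Rightarrow> 'a set \<Rightarrow> 'a \<Rightarrow> nat \<Rightarrow> bool" where
  "is_word G S g n \<longleftrightarrow>
     (\<exists>ws. length ws = n \<and> set ws \<subseteq> S \<union> m_inv G ` S \<and> foldr (\<otimes>\<^bsub>G\<^esub>) ws \<one>\<^bsub>G\<^esub> = g)"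

lemma word_length_eq_Least: "word_length G S g = (LEAST n. is_word G S g n)"
  by (simp add: word_length_def is_word_def)

lemma word_length_le: "is_word G S g n \<Longrightarrow> word_length G S g \<le> n"
  by (simp add: word_length_eq_Least Least_le)

section \<open>Words in a group, and criteria for being distorted or not\<close>

context group
begin

lemma foldr_closed: "set ws \<subseteq> carrier G \<Longrightarrow> foldr (\<otimes>) ws \<one> \<in> carrier G"
  by (induction ws) auto

lemma foldr_append:
  "set us \<subseteq> carrier G \<Longrightarrow> set vs \<subseteq> carrier G \<Longrightarrow>
    foldr (\<otimes>) (us @ vs) \<one> = foldr (\<otimes>) us \<one> \<otimes> foldr (\<otimes>) vs \<one>"
  by (induction us) (auto simp: foldr_closed m_assoc)

lemma letters_closed: "S \<subseteq> carrier G \<Longrightarrow> S \<union> m_inv G ` S \<subseteq> carrier G"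
  by auto

lemma is_word_one: "is_word G S \<one> 0"
  by (simp add: is_word_def)

lemma is_word_generator: "S \<subseteq> carrier G \<Longrightarrow> s \<in> S \<Longrightarrow> is_word G S s 1"
  unfolding is_word_def by (intro exI[of _ "[s]"]) auto

lemma is_word_closed: "S \<subseteq> carrier G \<Longrightarrow> is_word G S g n \<Longrightarrow> g \<in> carrier G"
  unfolding is_word_def using foldr_closed letters_closed by (metis subset_trans)

lemma is_word_mult:
  assumes "S \<subseteq> carrier G" "is_word G S g m" "is_word G S h n"
  shows "is_word G S (g \<otimes> h) (m + n)"
proof -
  from assms(2,3) obtain us vs where
    "length us = m" "set us \<subseteq> S \<union> m_inv G ` S" "foldr (\<otimes>) us \<one> = g"
    "length vs = n" "set vs \<subseteq> S \<union> m_inv G ` S" "foldr (\<otimes>) vs \<one> = h"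
    by (auto simp: is_word_def)
  then show ?thesis
    unfolding is_word_def using foldr_append[of us vs] letters_closed[OF assms(1)]
    by (intro exI[of _ "us @ vs"]) auto
qed

lemma is_word_inv_letter:
  assumes "S \<subseteq> carrier G" "x \<in> S \<union> m_inv G ` S"
  shows "is_word G S (inv x) 1"
proof -
  have "inv x \<in> S \<union> m_inv G ` S" using assms by auto
  moreover have "inv x \<in> carrier G" using assms by auto
  ultimately show ?thesis
    unfolding is_word_def by (intro exI[of _ "[inv x]"]) auto
qed

lemma is_word_inv:
  assumes "S \<subseteq> carrier G" "is_word G S g n"
  shows "is_word G S (inv g) n"
proof -
  from assms(2) obtain ws where
    "length ws = n" "set ws \<subseteq> S \<union> m_inv G ` S" "foldr (\<otimes>) ws \<one> = g"
    by (auto simp: is_word_def)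
  then show ?thesis
  proof (induction ws arbitrary: n g)
    case Nil
    then show ?case using is_word_one by auto
  next
    case (Cons x ws)
    let ?h = "foldr (\<otimes>) ws \<one>"
    have h: "is_word G S (inv ?h) (length ws)" using Cons by auto
    have x: "x \<in> carrier G" "?h \<in> carrier G"
      using Cons.prems letters_closed[OF assms(1)] by (auto intro!: foldr_closed)
    have "is_word G S (inv ?h \<otimes> inv x) (length ws + 1)"
      using is_word_mult[OF assms(1) h is_word_inv_letter[OF assms(1)]] Cons.prems by auto
    moreover have "g = x \<otimes> ?h" using Cons.prems by simp
    ultimately show ?case using x Cons.prems by (simp add: inv_mult_group)
  qed
qed

lemma is_word_pow:
  assumes "S \<subseteq> carrier G" "is_word G S g n"
  shows "is_word G S (g [^] (k::nat)) (k * n)"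
proof (induction k)
  case 0
  then show ?case by (simp add: is_word_one)
next
  case (Suc k)
  then show ?case
    using is_word_mult[OF assms(1) Suc assms(2)] by (simp add: add.commute)
qed

lemma is_word_generate:
  assumes "S \<subseteq> carrier G" "g \<in> generate G S"
  shows "\<exists>n. is_word G S g n"
  using assms(2)
proof (induction rule: generate.induct)
  case one
  then show ?case using is_word_one by blast
next
  case (incl h)
  then show ?case using is_word_generator[OF assms(1)] by blast
next
  case (inv h)
  then show ?case using is_word_inv_letter[OF assms(1)] by blast
next
  case (eng h1 h2)
  then show ?case using is_word_mult[OF assms(1)] by blast
qed

lemma is_word_word_length:
  assumes "S \<subseteq> carrier G" "g \<in> generate G S"
  shows "is_word G S g (word_length G S g)"
  unfolding word_length_eq_Least using is_word_generate[OF assms] by (rule LeastI_ex)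

text \<open>Since the length of a power is subadditive in the exponent, it suffices to find sparse
  exponents \<open>N\<close> for which it is small compared to \<open>N\<close>.\<close>

lemma distortedI:
  assumes S: "finite S" "S \<subseteq> carrier G" "f \<in> S"
    and sparse: "\<And>e. e > 0 \<Longrightarrow> \<exists>N l. N > 0 \<and> is_word G S (f [^] (N::nat)) l \<and> real l \<le> e * real N"
  shows "distorted G f"
proof -
  let ?L = "\<lambda>n. real (word_length G S (f [^] (n::nat))) / real n"
  have "?L \<longlonglongrightarrow> 0"
  proof (rule LIMSEQ_I)
    fix r :: real assume r: "r > 0"
    then obtain N l where N: "N > 0" "is_word G S (f [^] N) l" "real l \<le> r / 2 * real N"
      using sparse[of "r / 2"] by auto
    \<comment> \<open>Past this threshold the fewer than \<open>N\<close> letters \<open>f\<close>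
      spent on the remainder modulo \<open>N\<close> cost less than \<open>r / 2 * n\<close>; the
      other half of \<open>r\<close> pays for the blocks of length \<open>N\<close>.\<close>
    obtain K :: nat where K: "real K > 2 * real N / r" using reals_Archimedean2 by blast
    have "norm (?L n - 0) < r" if n: "n \<ge> Suc K" for n
    proof -
      have f: "f \<in> carrier G" using S by auto
      have "f [^] n = (f [^] N) [^] (n div N) \<otimes> f [^] (n mod N)"
        using f by (simp add: nat_pow_pow nat_pow_mult)
      moreover have "is_word G S ((f [^] N) [^] (n div N) \<otimes> f [^] (n mod N))
          ((n div N) * l + (n mod N) * 1)"
        by (intro is_word_mult is_word_pow N S is_word_generator)
      ultimately have "word_length G S (f [^] n) \<le> (n div N) * l + n mod N"
        using word_length_le by fastforce
      then have "real (word_length G S (f [^] n)) \<le> real ((n div N) * l + n mod N)"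
        using of_nat_le_iff by blast
      also have "\<dots> \<le> real (n div N) * (r / 2 * real N) + real N"
        using N mult_left_mono[OF N(3), of "real (n div N)"] mod_less_divisor[OF N(1), of n]
        by (simp del: mod_less_divisor)
      also have "real (n div N) * (r / 2 * real N) = r / 2 * real (n div N * N)"
        by simp
      also have "\<dots> \<le> r / 2 * real n"
        using r by (intro mult_left_mono) (simp_all del: of_nat_mult)
      finally have 1: "real (word_length G S (f [^] n)) \<le> r / 2 * real n + real N" by simp
      have "2 * real N / r < real n" using K n by linarith
      then have "real N < r / 2 * real n" using r by (simp add: field_simps)
      with 1 have "real (word_length G S (f [^] n)) < r * real n" by linarith
      moreover have "real n > 0" using n by simp
      ultimately show ?thesis by (simp add: field_simps)
    qed
    then show "\<exists>no. \<forall>n\<ge>no. norm (?L n - 0) < r" by blast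
  qed
  moreover have "f \<in> generate G S" using S by (simp add: generate.incl)
  ultimately show ?thesis
    unfolding distorted_def
    using generate_is_subgroup[OF S(2)] S generate.incl[of _ S G]
    by (intro exI[of _ "generate G S"] exI[of _ S]) auto
qed

text \<open>\<open>B g M\<close> expresses that a length function on the group (for us, the variation of
  \<open>log g'\<close>, which has no value in general) is at most \<open>M\<close> at \<open>g\<close>.\<close>

lemma not_distortedI:
  fixes B :: "'a \<Rightarrow> real \<Rightarrow> bool"
  assumes one: "B \<one> 0"
    and mono: "\<And>g M M'. B g M \<Longrightarrow> M \<le> M' \<Longrightarrow> B g M'"
    and mult: "\<And>g h M M'. g \<in> carrier G \<Longrightarrow> h \<in> carrier G \<Longrightarrow> B g M \<Longrightarrow> B h M' \<Longrightarrow> B (g \<otimes> h) (M + M')"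
    and inv: "\<And>g M. g \<in> carrier G \<Longrightarrow> B g M \<Longrightarrow> B (inv g) M"
    and fin: "\<And>g. g \<in> carrier G \<Longrightarrow> \<exists>M. B g M"
    and grow: "c > 0" "\<And>n M. n \<ge> n0 \<Longrightarrow> B (f [^] (n::nat)) M \<Longrightarrow> c * real n \<le> M"
  shows "\<not> distorted G f"
proof
  assume "distorted G f"
  then obtain \<Gamma> S where \<Gamma>: "subgroup \<Gamma> G" "finite S" "S \<subseteq> \<Gamma>" "generate G S = \<Gamma>" "f \<in> \<Gamma>"
    and lim: "(\<lambda>n. real (word_length G S (f [^] (n::nat))) / real n) \<longlonglongrightarrow> 0"
    by (auto simp: distorted_def)
  have S: "S \<subseteq> carrier G" using \<Gamma> subgroup.subset by blast
  obtain b where b: "\<And>s. s \<in> S \<Longrightarrow> B s (b s)" using fin S by (metis subsetD)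
  \<comment> \<open>The summand 1 keeps \<open>M\<close> positive even for an empty
    \<open>S\<close>, as the final division by \<open>M\<close> requires.\<close>
  define M where "M = (\<Sum>s\<in>S. \<bar>b s\<bar>) + 1"
  have "b s \<le> M" if "s \<in> S" for s
    using member_le_sum[OF that _ \<Gamma>(2), of "\<lambda>s. \<bar>b s\<bar>"] by (auto simp: M_def)
  then have gen: "B s M" if "s \<in> S" for s using b mono that by blast
  then have letter: "B s M" if "s \<in> S \<union> m_inv G ` S" for s using inv that S by blast
  have M: "M > 0" unfolding M_def by (smt (verit) sum_nonneg)
  have word: "B (foldr (\<otimes>) ws \<one>) (M * real (length ws))" if "set ws \<subseteq> S \<union> m_inv G ` S" for ws
    using that
  proof (induction ws)
    case Nil
    then show ?case using one by simp
  next
    case (Cons x ws)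
    then have "B (x \<otimes> foldr (\<otimes>) ws \<one>) (M + M * real (length ws))"
      using letters_closed[OF S] by (intro mult letter) (auto intro!: foldr_closed)
    then show ?case by (simp add: algebra_simps)
  qed
  have "c / M \<le> real (word_length G S (f [^] n)) / real n" if n: "n \<ge> max 1 n0" for n
  proof -
    have "f [^] n \<in> generate G S"
      using \<Gamma> subgroup_int_pow_closed[OF \<Gamma>(1,5), of "int n"] by (simp add: int_pow_int)
    then have "is_word G S (f [^] n) (word_length G S (f [^] n))"
      using is_word_word_length[OF S] by blast
    then have "B (f [^] n) (M * real (word_length G S (f [^] n)))"
      unfolding is_word_def using word by metis
    then have "c * real n \<le> M * real (word_length G S (f [^] n))" using grow n by simp
    then show ?thesis using M n by (simp add: field_simps)
  qed
  then have "c / M \<le> 0"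
    by (intro LIMSEQ_le_const[OF lim] exI[of _ "max 1 n0"]) auto
  then show False using M grow(1) by (simp add: field_simps)
qed

end

section \<open>Diffeomorphisms of the unit interval\<close>

lemma Ck_on_inverse:
  "Ck_on k f S \<Longrightarrow> (\<And>x. x \<in> S \<Longrightarrow> f x \<noteq> 0) \<Longrightarrow> Ck_on k (\<lambda>x. inverse (f x)) S"
proof (induction k)
  case 0
  then show ?case by (auto intro!: continuous_intros)
next
  case (Suc k)
  then obtain f' where f': "\<forall>x\<in>S. (f has_real_derivative f' x) (at x within S)" "Ck_on k f' S"
    by auto
  have "Ck_on k (\<lambda>x. inverse (f x)) S" using Suc Ck_on_Suc_imp by blast
  then have "Ck_on k (\<lambda>x. (-1) * (f' x * (inverse (f x) * inverse (f x)))) S"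
    using f' by (intro Ck_on_mult Ck_on_const)
  moreover have "((\<lambda>x. inverse (f x)) has_real_derivative
      (-1) * (f' x * (inverse (f x) * inverse (f x)))) (at x within S)" if x: "x \<in> S" for x
    using DERIV_inverse'[OF f'(1)[rule_format, OF x] Suc.prems(2)[OF x]] by (simp add: mult_ac)
  ultimately show ?case
    unfolding Ck_on.simps
    by (intro exI[of _ "\<lambda>x. (-1) * (f' x * (inverse (f x) * inverse (f x)))"]) simp
qed

section \<open>One-sided derivatives and regularity up to the endpoints\<close>

lemma at_within_unit_neq_bot: "x \<in> {0..1::real} \<Longrightarrow> at x within {0..1} \<noteq> bot"
  by (simp add: trivial_limit_within islimpt_Icc)

lemma unit_derivative_unique:
  assumes "x \<in> {0..1::real}"
    "(f has_real_derivative d) (at x within {0..1})"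
    "(f has_real_derivative e) (at x within {0..1})"
  shows "d = e"
  using assms(2,3) tendsto_unique[OF at_within_unit_neq_bot[OF assms(1)]]
  by (simp add: has_field_derivative_iff)

text \<open>The derivative in \<open>Ck_on\<close> is an existential witness. By uniqueness of
  derivatives on the interval, its regularity passes to any explicitly known derivative.\<close>

lemma Ck_on_derivative:
  assumes "Ck_on (Suc k) f {0..1::real}"
    "\<And>x. x \<in> {0..1} \<Longrightarrow> (f has_real_derivative g x) (at x within {0..1})"
  shows "Ck_on k g {0..1}"
proof -
  obtain f' where f': "\<forall>x\<in>{0..1}. (f has_real_derivative f' x) (at x within {0..1})" "Ck_on k f' {0..1}"
    using assms(1) by auto
  then have "f' x = g x" if "x \<in> {0..1}" for x
    using unit_derivative_unique assms(2) that by blast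
  then show ?thesis using f'(2) Ck_on_cong by blast
qed

text \<open>By the fundamental theorem, used in the interior only, \<open>F\<close> is a constant
  plus the integral of \<open>G\<close>, and the integral of a continuous function is differentiable
  at the endpoints as well.\<close>

lemma derivative_up_to_boundary:
  fixes F G :: "real \<Rightarrow> real"
  assumes cont: "continuous_on {0..1} F" "continuous_on {0..1} G"
    and deriv: "\<And>x. 0 < x \<Longrightarrow> x < 1 \<Longrightarrow> (F has_real_derivative G x) (at x)"
    and x: "x \<in> {0..1}"
  shows "(F has_real_derivative G x) (at x within {0..1})"
proof -
  have "(G has_integral F y - F 0) {0..y}" if "y \<in> {0..1}" for y
    using that cont continuous_on_subset[OF cont(1), of "{0..y}"] deriv
    by (intro fundamental_theorem_of_calculus_interior)
       (auto simp flip: has_real_derivative_iff_has_vector_derivative)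
  then have eq: "F 0 + integral {0..y} G = F y" if "y \<in> {0..1}" for y
    using integral_unique[of G _ "{0..y}"] that by fastforce
  have "((\<lambda>y. F 0 + integral {0..y} G) has_real_derivative G x) (at x within {0..1})"
    using integral_has_real_derivative[OF cont(2) x] by (auto intro!: derivative_eq_intros)
  then show ?thesis
    by (rule has_field_derivative_transform_within[OF _ zero_less_one x]) (use eq in auto)
qed

text \<open>Positivity of the derivative \<open>G\<close> stands for invertibility: bijectivity and
  the derivative of the inverse are deduced below. Continuity of \<open>G\<close> is assumed
  separately where it enters.\<close>

locale interval_diffeo =
  fixes F G :: "real \<Rightarrow> real"
  assumes ext: "F \<in> extensional {0..1}"
    and F0: "F 0 = 0" and F1: "F 1 = 1"
    and deriv: "\<And>x. x \<in> {0..1} \<Longrightarrow> (F has_real_derivative G x) (at x within {0..1})"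
    and pos: "\<And>x. x \<in> {0..1} \<Longrightarrow> G x > 0"
begin

lemma cont: "continuous_on {0..1} F"
  using deriv by (meson DERIV_continuous_on)

lemma deriv_at: "0 < x \<Longrightarrow> x < 1 \<Longrightarrow> (F has_real_derivative G x) (at x)"
  using deriv[of x] by (simp add: at_within_Icc_at)

lemma mono: "strict_mono_on {0..1} F"
proof (rule strict_mono_onI)
  fix x y :: real assume xy: "x \<in> {0..1}" "y \<in> {0..1}" "x < y"
  have "continuous_on {x..y} F" using cont continuous_on_subset xy by fastforce
  moreover have "DERIV F z :> G z" "G z > 0" if "x < z" "z < y" for z
    using that xy deriv_at pos by auto
  ultimately show "F x < F y"
    using DERIV_pos_imp_increasing_open[OF \<open>x < y\<close>] by metis
qed

lemma bij: "bij_betw F {0..1} {0..1}"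
proof -
  have "inj_on F {0..1}" using mono strict_mono_on_imp_inj_on by blast
  moreover have "F ` {0..1} = {0..1}"
  proof
    show "F ` {0..1} \<subseteq> {0..1}"
    proof
      fix y assume "y \<in> F ` {0..1}"
      then obtain x where x: "x \<in> {0..1}" "y = F x" by blast
      then have "F 0 \<le> F x" "F x \<le> F 1"
        using strict_mono_on_leD[OF mono, of 0 x] strict_mono_on_leD[OF mono, of x 1] by auto
      then show "y \<in> {0..1}" using x F0 F1 by auto
    qed
    show "{0..1} \<subseteq> F ` {0..1}"
    proof
      fix y :: real assume "y \<in> {0..1}"
      then show "y \<in> F ` {0..1}" using IVT'[of F 0 y 1] cont F0 F1 by auto
    qed
  qed
  ultimately show ?thesis by (simp add: bij_betw_def)
qed

abbreviation "E \<equiv> inv_into {0..1} F"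

lemma E_mem: "y \<in> {0..1} \<Longrightarrow> E y \<in> {0..1}"
  using bij by (metis bij_betw_def inv_into_into)

lemma E_right: "y \<in> {0..1} \<Longrightarrow> F (E y) = y"
  using bij bij_betw_inv_into_right by metis

lemma E_left: "x \<in> {0..1} \<Longrightarrow> E (F x) = x"
  using bij bij_betw_inv_into_left by metis

lemma E_cont: "continuous_on {0..1} E"
  using continuous_on_inv[OF cont compact_Icc] E_left bij by (metis bij_betw_def)

text \<open>The inverse function rule gives the formula in the interior, whose points have interior
  preimages because the endpoints are fixed; \<open>derivative_up_to_boundary\<close> adds the
  endpoints.\<close>

lemma E_deriv:
  assumes "continuous_on {0..1} G" "y \<in> {0..1}"
  shows "(E has_real_derivative inverse (G (E y))) (at y within {0..1})"
proof (rule derivative_up_to_boundary[OF E_cont _ _ assms(2)])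
  have "G (E y) \<noteq> 0" if "y \<in> {0..1}" for y using pos E_mem that by (metis less_irrefl)
  then show "continuous_on {0..1} (\<lambda>y. inverse (G (E y)))"
    by (intro continuous_on_inverse continuous_on_compose2[OF assms(1) E_cont]) (auto dest: E_mem)
next
  fix y :: real assume y: "0 < y" "y < 1"
  have "E y \<noteq> 0" "E y \<noteq> 1" using E_right[of y] y F0 F1 by auto
  then have E: "0 < E y" "E y < 1" using E_mem[of y] y by auto
  show "(E has_real_derivative inverse (G (E y))) (at y)"
  proof (rule DERIV_inverse_function[where f = F and a = 0 and b = 1])
    show "(F has_real_derivative G (E y)) (at (E y))" using E by (rule deriv_at)
    show "G (E y) \<noteq> 0" using pos[of "E y"] E by simp
    show "isCont E y" using E_cont y continuous_on_interior[of "{0..1}" E y] by simp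
  qed (use y E_right in auto)
qed

text \<open>Bootstrapping: the derivative of \<open>E\<close> is the inverse of \<open>G\<close>
  composed with \<open>E\<close>, so \<open>E\<close> gains one order at each step as long as
  \<open>G\<close> permits it.\<close>

lemma E_Ck:
  assumes "Ck_on k F {0..1}" "Ck_on 1 F {0..1}"
  shows "Ck_on k E {0..1}"
  using assms(1)
proof (induction k)
  case 0
  then show ?case using E_cont by simp
next
  case (Suc k)
  have G: "Ck_on k G {0..1}" using Suc.prems deriv by (rule Ck_on_derivative)
  have "continuous_on {0..1} G" using Ck_on_derivative[of 0 F G] assms(2) deriv by simp
  moreover have "Ck_on k (\<lambda>y. inverse (G (E y))) {0..1}"
  proof (rule Ck_on_inverse)
    show "Ck_on k (\<lambda>y. G (E y)) {0..1}"
    proof (rule Ck_on_compose[OF G])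
      show "Ck_on k E {0..1}" by (rule Suc.IH) (rule Ck_on_Suc_imp[OF Suc.prems])
      show "E ` {0..1} \<subseteq> {0..1}" using E_mem by blast
    qed
    show "\<And>y. y \<in> {0..1} \<Longrightarrow> G (E y) \<noteq> 0" using pos E_mem by (metis less_irrefl)
  qed
  ultimately show ?case using E_deriv by (auto intro!: exI[of _ "\<lambda>y. inverse (G (E y))"])
qed

lemma in_Diff_plus_carrier:
  assumes "\<And>k. enat k \<le> r \<Longrightarrow> Ck_on k F {0..1}" "1 \<le> r"
  shows "F \<in> Diff_plus_carrier r"
proof -
  have "Ck_on 1 F {0..1}" by (metis assms one_enat_def)
  then show ?thesis
    unfolding Diff_plus_carrier_def Bij_def using assms ext bij mono E_Ck by auto
qed

end

section \<open>The group operations as operations on maps\<close>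

lemma carrier_Diff_plus [simp]: "carrier (Diff_plus r) = Diff_plus_carrier r"
  by (simp add: Diff_plus_def)

lemma one_Diff_plus: "\<one>\<^bsub>Diff_plus r\<^esub> = restrict (\<lambda>x. x) {0..1}"
  by (simp add: Diff_plus_def BijGroup_def)

lemma mult_Diff_plus:
  assumes "f \<in> Diff_plus_carrier r" "g \<in> Diff_plus_carrier r"
  shows "f \<otimes>\<^bsub>Diff_plus r\<^esub> g = compose {0..1} f g"
  using assms by (auto simp: Diff_plus_def BijGroup_def Diff_plus_carrier_def)

lemma Diff_plus_carrier_antimono: "r \<le> s \<Longrightarrow> Diff_plus_carrier s \<subseteq> Diff_plus_carrier r"
  by (auto simp: Diff_plus_carrier_def)

section \<open>The projective coordinate on the open interval\<close>

text \<open>\<open>\<sigma>\<close> and its inverse \<open>\<tau>\<close> identify the line with the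
  open interval by an angle. Both endpoints lie over the point at infinity of the projective line,
  which is why translations remain smooth there.\<close>

definition \<sigma> :: "real \<Rightarrow> real" where "\<sigma> t = 1/2 + arctan t / pi"
definition \<tau> :: "real \<Rightarrow> real" where "\<tau> x = tan (pi * (x - 1/2))"

lemma \<sigma>_range: "0 < \<sigma> t" "\<sigma> t < 1"
  using arctan_lbound[of t] arctan_ubound[of t] by (simp_all add: \<sigma>_def field_simps)

lemma \<tau>_\<sigma> [simp]: "\<tau> (\<sigma> t) = t"
  by (simp add: \<sigma>_def \<tau>_def tan_arctan)

lemma pi_half_bounds:
  assumes "0 < x" "x < 1"
  shows "- (pi/2) < pi * (x - 1/2)" "pi * (x - 1/2) < pi/2"
proof -
  have "pi * 0 < pi * x" "pi * x < pi * 1" using assms by simp_all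
  then show "- (pi/2) < pi * (x - 1/2)" "pi * (x - 1/2) < pi/2" by (simp_all add: algebra_simps)
qed

lemma \<sigma>_\<tau>: "0 < x \<Longrightarrow> x < 1 \<Longrightarrow> \<sigma> (\<tau> x) = x"
  using pi_half_bounds[of x] by (simp add: \<sigma>_def \<tau>_def arctan_tan)

lemma \<sigma>_strict_mono: "s < t \<Longrightarrow> \<sigma> s < \<sigma> t"
  by (simp add: \<sigma>_def arctan_less_iff divide_strict_right_mono)

lemma one_plus_sq_pos: "0 < 1 + (t::real)\<^sup>2"
  by (smt (verit) zero_le_power2)

lemma DERIV_\<sigma>: "(\<sigma> has_real_derivative 1 / (pi * (1 + t\<^sup>2))) (at t)"
  unfolding \<sigma>_def using one_plus_sq_pos[of t]
  by (auto intro!: derivative_eq_intros simp: divide_simps)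

lemma cos_pos_unit: "0 < x \<Longrightarrow> x < 1 \<Longrightarrow> cos (pi * (x - 1/2)) > 0"
  using pi_half_bounds by (intro cos_gt_zero_pi) auto

text \<open>The weight produced by the chain rule blows up like the inverse square of the distance
  to an endpoint; the sine expresses this at both endpoints at once.\<close>

lemma one_plus_\<tau>_sq:
  assumes "0 < x" "x < 1"
  shows "1 + (\<tau> x)\<^sup>2 = inverse ((sin (pi * x))\<^sup>2)"
proof -
  have "sin (pi * x) = cos (pi * (x - 1/2))"
    by (simp add: cos_diff right_diff_distrib)
  then show ?thesis
    using cos_pos_unit[OF assms] tan_sec[of "pi * (x - 1/2)"] by (simp add: \<tau>_def power_inverse)
qed

lemma DERIV_\<tau>:
  assumes "0 < x" "x < 1"
  shows "(\<tau> has_real_derivative pi * (1 + (\<tau> x)\<^sup>2)) (at x)"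
proof -
  have c: "cos (pi * (x - 1/2)) \<noteq> 0" using cos_pos_unit[OF assms] by simp
  have "(\<tau> has_real_derivative inverse ((cos (pi * (x - 1/2)))\<^sup>2) * pi) (at x)"
    unfolding \<tau>_def using c
    by (intro DERIV_chain2[of tan _ "\<lambda>x. pi * (x - 1/2)"] DERIV_tan)
       (auto intro!: derivative_eq_intros)
  then show ?thesis
    using tan_sec[OF c] by (simp add: \<tau>_def power_inverse mult.commute)
qed

lemma \<sigma>_lipschitz: "\<bar>\<sigma> s - \<sigma> t\<bar> \<le> \<bar>s - t\<bar>"
proof -
  have "norm (\<sigma> s - \<sigma> t) \<le> 1 * norm (s - t)"
  proof (rule field_differentiable_bound[of UNIV \<sigma> "\<lambda>t. 1 / (pi * (1 + t\<^sup>2))"])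
    fix t :: real
    have "1 * 1 \<le> pi * (1 + t\<^sup>2)" using pi_ge_two by (intro mult_mono) auto
    then show "norm (1 / (pi * (1 + t\<^sup>2))) \<le> 1" by simp
  qed (auto intro: DERIV_\<sigma>)
  then show ?thesis by simp
qed

section \<open>Growth and decay of all derivatives\<close>

text \<open>One recursion for two classes: with \<open>rapid_decay\<close> these are the Schwartz
  conditions up to order \<open>k\<close>, with \<open>poly_bounded\<close> those of the multipliers
  of such functions.\<close>

fun Dk :: "((real \<Rightarrow> real) \<Rightarrow> bool) \<Rightarrow> nat \<Rightarrow> (real \<Rightarrow> real) \<Rightarrow> bool" where
  "Dk P 0 f \<longleftrightarrow> P f"
| "Dk P (Suc k) f \<longleftrightarrow> P f \<and> (\<exists>f'. (\<forall>w. (f has_real_derivative f' w) (at w)) \<and> Dk P k f')"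

definition poly_bounded :: "(real \<Rightarrow> real) \<Rightarrow> bool" where
  "poly_bounded f \<longleftrightarrow> (\<exists>m C. \<forall>w. \<bar>f w\<bar> \<le> C * (1 + w\<^sup>2) ^ m)"

definition rapid_decay :: "(real \<Rightarrow> real) \<Rightarrow> bool" where
  "rapid_decay f \<longleftrightarrow> (\<forall>m. \<exists>C. \<forall>w. \<bar>f w\<bar> * (1 + w\<^sup>2) ^ m \<le> C)"

lemma Dk_base: "Dk P k f \<Longrightarrow> P f"
  by (cases k) auto

lemma Dk_Suc_imp: "Dk P (Suc k) f \<Longrightarrow> Dk P k f"
proof (induction k arbitrary: f)
  case (Suc k)
  then show ?case by (metis Dk.simps(2))
qed auto

lemma Dk_weaken: "(\<And>f. P f \<Longrightarrow> Q f) \<Longrightarrow> Dk P k f \<Longrightarrow> Dk Q k f"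
  by (induction k arbitrary: f) auto

lemma Dk_SucI:
  "P f \<Longrightarrow> (\<And>w. (f has_real_derivative f' w) (at w)) \<Longrightarrow> Dk P k f' \<Longrightarrow> Dk P (Suc k) f"
  by auto

lemma Dk_SucE:
  assumes "Dk P (Suc k) f"
  obtains f' where "\<And>w. (f has_real_derivative f' w) (at w)" "Dk P k f'"
  using assms by auto

lemma Dk_add:
  assumes P: "\<And>f g. P f \<Longrightarrow> P g \<Longrightarrow> P (\<lambda>w. f w + g w)"
  shows "Dk P k f \<Longrightarrow> Dk P k g \<Longrightarrow> Dk P k (\<lambda>w. f w + g w)"
proof (induction k arbitrary: f g)
  case 0
  then show ?case using P by simp
next
  case (Suc k)
  from Suc.prems obtain f' g' where *:
    "\<And>w. (f has_real_derivative f' w) (at w)" "Dk P k f'"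
    "\<And>w. (g has_real_derivative g' w) (at w)" "Dk P k g'"
    by (meson Dk_SucE)
  show ?case
  proof (rule Dk_SucI)
    show "P (\<lambda>w. f w + g w)" using Suc.prems Dk_base P by blast
    show "Dk P k (\<lambda>w. f' w + g' w)" using * Suc.IH by blast
  qed (use * in \<open>auto intro: DERIV_add\<close>)
qed

text \<open>By the Leibniz rule each derivative of the product is a sum of terms with one factor
  from \<open>P\<close> and one from \<open>Q\<close>; hence the two closure conditions, both with
  conclusion in \<open>P\<close>.\<close>

lemma Dk_mult:
  assumes P: "\<And>f g. P f \<Longrightarrow> P g \<Longrightarrow> P (\<lambda>w. f w + g w)"
    and PQ: "\<And>f g. P f \<Longrightarrow> Q g \<Longrightarrow> P (\<lambda>w. f w * g w)"
  shows "Dk P k f \<Longrightarrow> Dk Q k g \<Longrightarrow> Dk P k (\<lambda>w. f w * g w)"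
proof (induction k arbitrary: f g)
  case 0
  then show ?case using PQ by simp
next
  case (Suc k)
  from Suc.prems obtain f' g' where *:
    "\<And>w. (f has_real_derivative f' w) (at w)" "Dk P k f'"
    "\<And>w. (g has_real_derivative g' w) (at w)" "Dk Q k g'"
    by (meson Dk_SucE)
  show ?case
  proof (rule Dk_SucI)
    show "P (\<lambda>w. f w * g w)" using Suc.prems Dk_base PQ by blast
    show "Dk P k (\<lambda>w. f' w * g w + f w * g' w)"
      using * Suc Dk_Suc_imp by (intro Dk_add P Suc.IH) blast+
    show "((\<lambda>w. f w * g w) has_real_derivative f' w * g w + f w * g' w) (at w)" for w
      using DERIV_mult[OF *(1) *(3), of w] by (simp add: mult.commute)
  qed
qed

section \<open>Closure properties of polynomial growth and of rapid decay\<close>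

lemma poly_bounded_weaken:
  fixes f :: "real \<Rightarrow> real"
  assumes "\<And>w. \<bar>f w\<bar> \<le> C * (1 + w\<^sup>2) ^ m" "m \<le> n"
  shows "\<bar>f w\<bar> \<le> \<bar>C\<bar> * (1 + w\<^sup>2) ^ n"
proof -
  have "C * (1 + w\<^sup>2) ^ m \<le> \<bar>C\<bar> * (1 + w\<^sup>2) ^ n"
    using assms(2) by (intro mult_mono power_increasing) auto
  then show ?thesis using assms(1)[of w] by linarith
qed

lemma poly_bounded_add:
  assumes "poly_bounded f" "poly_bounded g"
  shows "poly_bounded (\<lambda>w. f w + g w)"
proof -
  from assms obtain m C n D where *: "\<And>w. \<bar>f w\<bar> \<le> C * (1 + w\<^sup>2) ^ m" "\<And>w. \<bar>g w\<bar> \<le> D * (1 + w\<^sup>2) ^ n"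
    by (auto simp: poly_bounded_def)
  have "\<bar>f w + g w\<bar> \<le> (\<bar>C\<bar> + \<bar>D\<bar>) * (1 + w\<^sup>2) ^ max m n" for w
    using poly_bounded_weaken[of f C m "max m n" w, OF *(1)]
      poly_bounded_weaken[of g D n "max m n" w, OF *(2)]
    unfolding distrib_right by linarith
  then show ?thesis unfolding poly_bounded_def by blast
qed

lemma poly_bounded_mult:
  assumes "poly_bounded f" "poly_bounded g"
  shows "poly_bounded (\<lambda>w. f w * g w)"
proof -
  from assms obtain m C n D where *: "\<And>w. \<bar>f w\<bar> \<le> C * (1 + w\<^sup>2) ^ m" "\<And>w. \<bar>g w\<bar> \<le> D * (1 + w\<^sup>2) ^ n"
    by (auto simp: poly_bounded_def)
  have "\<bar>f w * g w\<bar> \<le> (C * D) * (1 + w\<^sup>2) ^ (m + n)" for w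
    using mult_mono'[OF *(1)[of w] *(2)[of w]] by (simp add: abs_mult power_add mult_ac)
  then show ?thesis unfolding poly_bounded_def by blast
qed

lemma poly_bounded_bounded: "(\<And>w. \<bar>f w\<bar> \<le> C) \<Longrightarrow> poly_bounded f"
  unfolding poly_bounded_def by (rule exI[of _ 0]) auto

lemma rapid_decay_add:
  assumes "rapid_decay f" "rapid_decay g"
  shows "rapid_decay (\<lambda>w. f w + g w)"
  unfolding rapid_decay_def
proof
  fix m
  from assms obtain C D where *: "\<And>w. \<bar>f w\<bar> * (1 + w\<^sup>2) ^ m \<le> C" "\<And>w. \<bar>g w\<bar> * (1 + w\<^sup>2) ^ m \<le> D"
    unfolding rapid_decay_def by meson
  have "\<bar>f w + g w\<bar> * (1 + w\<^sup>2) ^ m \<le> C + D" for w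
  proof -
    have "\<bar>f w + g w\<bar> * (1 + w\<^sup>2) ^ m \<le> (\<bar>f w\<bar> + \<bar>g w\<bar>) * (1 + w\<^sup>2) ^ m"
      by (intro mult_right_mono) auto
    then show ?thesis using *[of w] by (simp add: distrib_right)
  qed
  then show "\<exists>C. \<forall>w. \<bar>f w + g w\<bar> * (1 + w\<^sup>2) ^ m \<le> C" by blast
qed

lemma rapid_decay_mult:
  assumes "rapid_decay f" "poly_bounded g"
  shows "rapid_decay (\<lambda>w. f w * g w)"
  unfolding rapid_decay_def
proof
  fix m
  from assms(2) obtain n D where g: "\<And>w. \<bar>g w\<bar> \<le> D * (1 + w\<^sup>2) ^ n"
    by (auto simp: poly_bounded_def)
  from assms(1) obtain C where f: "\<And>w. \<bar>f w\<bar> * (1 + w\<^sup>2) ^ (m + n) \<le> C"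
    unfolding rapid_decay_def by meson
  have D: "D \<ge> 0" using g[of 0] by simp
  have "\<bar>f w * g w\<bar> * (1 + w\<^sup>2) ^ m \<le> D * C" for w
  proof -
    have "\<bar>f w * g w\<bar> * (1 + w\<^sup>2) ^ m \<le> \<bar>f w\<bar> * (D * (1 + w\<^sup>2) ^ n) * (1 + w\<^sup>2) ^ m"
      unfolding abs_mult by (intro mult_right_mono mult_left_mono g) auto
    also have "\<dots> = D * (\<bar>f w\<bar> * (1 + w\<^sup>2) ^ (m + n))" by (simp add: power_add)
    also have "\<dots> \<le> D * C" using D f by (rule mult_left_mono[rotated])
    finally show ?thesis .
  qed
  then show "\<exists>C. \<forall>w. \<bar>f w * g w\<bar> * (1 + w\<^sup>2) ^ m \<le> C" by blast
qed

lemma rapid_decay_mono: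
  assumes "rapid_decay g" "\<And>w. \<bar>f w\<bar> \<le> C * \<bar>g w\<bar>"
  shows "rapid_decay f"
  unfolding rapid_decay_def
proof
  fix m
  from assms(1) obtain D where g: "\<And>w. \<bar>g w\<bar> * (1 + w\<^sup>2) ^ m \<le> D"
    unfolding rapid_decay_def by meson
  have "\<bar>f w\<bar> * (1 + w\<^sup>2) ^ m \<le> \<bar>C\<bar> * D" for w
  proof -
    have "\<bar>f w\<bar> \<le> \<bar>C\<bar> * \<bar>g w\<bar>"
      using assms(2)[of w] mult_right_mono[OF abs_ge_self[of C], of "\<bar>g w\<bar>"] by simp
    then have "\<bar>f w\<bar> * (1 + w\<^sup>2) ^ m \<le> \<bar>C\<bar> * \<bar>g w\<bar> * (1 + w\<^sup>2) ^ m"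
      by (intro mult_right_mono) auto
    also have "\<dots> \<le> \<bar>C\<bar> * D" using g[of w] by (simp add: mult.assoc mult_left_mono)
    finally show ?thesis .
  qed
  then show "\<exists>C. \<forall>w. \<bar>f w\<bar> * (1 + w\<^sup>2) ^ m \<le> C" by blast
qed

lemma rapid_decay_imp_poly_bounded: "rapid_decay f \<Longrightarrow> poly_bounded f"
  unfolding rapid_decay_def poly_bounded_def by (metis mult.right_neutral power_0)

lemma pb_add:
  "Dk poly_bounded k f \<Longrightarrow> Dk poly_bounded k g \<Longrightarrow> Dk poly_bounded k (\<lambda>w. f w + g w)"
  by (rule Dk_add) (simp_all add: poly_bounded_add)

lemma pb_mult:
  "Dk poly_bounded k f \<Longrightarrow> Dk poly_bounded k g \<Longrightarrow> Dk poly_bounded k (\<lambda>w. f w * g w)"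
  by (rule Dk_mult[of poly_bounded poly_bounded]) (simp_all add: poly_bounded_add poly_bounded_mult)

lemma rd_add:
  "Dk rapid_decay k f \<Longrightarrow> Dk rapid_decay k g \<Longrightarrow> Dk rapid_decay k (\<lambda>w. f w + g w)"
  by (rule Dk_add) (simp_all add: rapid_decay_add)

lemma rd_mult:
  "Dk rapid_decay k f \<Longrightarrow> Dk poly_bounded k g \<Longrightarrow> Dk rapid_decay k (\<lambda>w. f w * g w)"
  by (rule Dk_mult[of rapid_decay poly_bounded]) (simp_all add: rapid_decay_add rapid_decay_mult)

lemma rd_imp_pb: "Dk rapid_decay k f \<Longrightarrow> Dk poly_bounded k f"
  using Dk_weaken rapid_decay_imp_poly_bounded by blast

lemma pb_const: "Dk poly_bounded k (\<lambda>_. c)"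
  by (induction k arbitrary: c)
     (auto intro!: poly_bounded_bounded[of _ "\<bar>c\<bar>" for c] exI[of _ "\<lambda>_. 0"])

lemma pb_id: "Dk poly_bounded k (\<lambda>w. w)"
proof -
  have "\<bar>w\<bar> \<le> 1 * (1 + w\<^sup>2) ^ 1" for w :: real
    using zero_le_power2[of "\<bar>w\<bar> - 1"] by (simp add: power2_eq_square algebra_simps)
  then have "poly_bounded (\<lambda>w. w)" unfolding poly_bounded_def by blast
  then show ?thesis by (cases k) (auto intro!: exI[of _ "\<lambda>_. 1"] pb_const)
qed

text \<open>The function is bounded by 1 whatever \<open>\<phi>\<close> is, and its derivative is a
  polynomial in \<open>\<phi>\<close>, the derivative of \<open>\<phi>\<close> and the function
  itself, so induction applies.\<close>

lemma pb_inverse_one_plus_sq: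
  "Dk poly_bounded k \<phi> \<Longrightarrow> Dk poly_bounded k (\<lambda>w. 1 / (1 + (\<phi> w)\<^sup>2))"
proof (induction k)
  case 0
  have "\<bar>1 / (1 + (\<phi> w)\<^sup>2)\<bar> \<le> 1" for w
    using one_plus_sq_pos[of "\<phi> w"] by (simp add: divide_le_eq_1)
  then have "poly_bounded (\<lambda>w. 1 / (1 + (\<phi> w)\<^sup>2))" by (rule poly_bounded_bounded)
  then show ?case by simp
next
  case (Suc k)
  then obtain \<phi>' where *: "\<And>w. (\<phi> has_real_derivative \<phi>' w) (at w)" "Dk poly_bounded k \<phi>'"
    by (meson Dk_SucE)
  let ?i = "\<lambda>w. 1 / (1 + (\<phi> w)\<^sup>2)"
  have i: "Dk poly_bounded k ?i" "Dk poly_bounded k \<phi>" using Suc Dk_Suc_imp by blast+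
  show ?case
  proof (rule Dk_SucI)
    show "poly_bounded ?i" using i Dk_base by blast
    show "Dk poly_bounded k (\<lambda>w. (-2) * (\<phi> w * (\<phi>' w * (?i w * ?i w))))"
      using i * by (intro pb_mult pb_const)
    show "(?i has_real_derivative (-2) * (\<phi> w * (\<phi>' w * (?i w * ?i w)))) (at w)" for w
      using one_plus_sq_pos[of "\<phi> w"] *(1)[of w]
      by (auto intro!: derivative_eq_intros simp: power2_eq_square)
  qed
qed

text \<open>One order is given up: continuity of the last derivative is obtained from its
  differentiability, not from \<open>P\<close>.\<close>

lemma Dk_imp_Ck_on: "Dk P (Suc k) f \<Longrightarrow> Ck_on k f S"
proof (induction k arbitrary: f)
  case 0
  then show ?case
    by (metis DERIV_continuous_on Ck_on.simps(1) Dk.simps(2) has_field_derivative_at_within)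
next
  case (Suc k)
  then obtain f' where "\<And>w. (f has_real_derivative f' w) (at w)" "Dk P (Suc k) f'"
    by (meson Dk_SucE)
  then have "Ck_on k f' S" "\<forall>x\<in>S. (f has_real_derivative f' x) (at x within S)"
    using Suc.IH has_field_derivative_at_within by blast+
  then show ?case unfolding Ck_on.simps by blast
qed

subsection \<open>Rapidly decaying functions in the projective coordinate\<close>

text \<open>The pullback of \<open>g\<close> under the chart, extended by zero to the whole line and
  not just to the interval: the result is again a function on the line, so the construction can be
  iterated.\<close>

definition hat :: "(real \<Rightarrow> real) \<Rightarrow> real \<Rightarrow> real" where
  "hat g x = (if 0 < x \<and> x < 1 then g (\<tau> x) else 0)"

lemma DERIV_zero_of_quadratic:
  assumes "\<And>x. \<bar>f x\<bar> \<le> C * (x - a)\<^sup>2"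
  shows "(f has_real_derivative 0) (at (a::real))"
proof -
  have fa: "f a = 0" using assms[of a] by simp
  have "((\<lambda>x. \<bar>C\<bar> * \<bar>x - a\<bar>) \<longlongrightarrow> 0) (at a)"
    by (rule tendsto_eq_intros | simp)+
  moreover have "\<forall>\<^sub>F x in at a. norm ((f x - f a) / (x - a)) \<le> \<bar>C\<bar> * \<bar>x - a\<bar>"
  proof (rule eventually_at_topological[THEN iffD2], intro exI[of _ UNIV] conjI ballI impI)
    fix x assume "x \<noteq> a"
    have "\<bar>f x\<bar> \<le> \<bar>C\<bar> * (x - a)\<^sup>2"
      using assms[of x] mult_right_mono[OF abs_ge_self[of C], of "(x - a)\<^sup>2"] by simp
    then have "\<bar>f x\<bar> \<le> (\<bar>C\<bar> * \<bar>x - a\<bar>) * \<bar>x - a\<bar>"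
      by (simp add: power2_eq_square mult.assoc flip: abs_mult)
    then show "norm ((f x - f a) / (x - a)) \<le> \<bar>C\<bar> * \<bar>x - a\<bar>"
      using \<open>x \<noteq> a\<close> fa by (simp add: divide_simps)
  qed auto
  ultimately have "((\<lambda>x. (f x - f a) / (x - a)) \<longlongrightarrow> 0) (at a)"
    by (rule Lim_null_comparison[rotated])
  then show ?thesis by (simp add: has_field_derivative_iff)
qed

text \<open>In the interior this is the chain rule. At the endpoints, decay against the weight
  \<open>1 + w^2\<close> bounds \<open>hat g\<close> by a multiple of the squared sine, so it
  vanishes to second order there.\<close>

lemma DERIV_hat:
  assumes "rapid_decay g" and g: "\<And>w. (g has_real_derivative g' w) (at w)"
  shows "(hat g has_real_derivative hat (\<lambda>w. g' w * (pi * (1 + w\<^sup>2))) x) (at x)"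
proof -
  from assms(1) obtain C where C: "\<And>w. \<bar>g w\<bar> * (1 + w\<^sup>2) ^ 1 \<le> C"
    unfolding rapid_decay_def by meson
  have C0: "C \<ge> 0" using C[of 0] by simp
  have bound: "\<bar>hat g x\<bar> \<le> C * (sin (pi * x))\<^sup>2" for x
  proof (cases "0 < x \<and> x < 1")
    case True
    then have "\<bar>g (\<tau> x)\<bar> * inverse ((sin (pi * x))\<^sup>2) \<le> C"
      using C[of "\<tau> x"] one_plus_\<tau>_sq[of x] by simp
    moreover have "sin (pi * x) > 0"
      using True by (intro sin_gt_zero) (auto simp: field_simps)
    ultimately show ?thesis using True by (simp add: hat_def field_simps)
  qed (use C0 in \<open>auto simp: hat_def\<close>)
  have sq: "C * (sin y)\<^sup>2 \<le> C * y\<^sup>2" for y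
    using abs_sin_x_le_abs_x[of y] C0 by (intro mult_left_mono) (auto simp flip: abs_le_square_iff)
  consider "x < 0 \<or> x > 1" | "x = 0" | "x = 1" | "0 < x" "x < 1" by linarith
  then show ?thesis
  proof cases
    case 1
    have "((\<lambda>_. 0) has_real_derivative 0) (at x)" by simp
    then have "(hat g has_real_derivative 0) (at x)"
      by (rule has_field_derivative_transform_within_open[of _ _ _ "- {0..1}"])
         (use 1 in \<open>auto simp: hat_def open_Compl\<close>)
    then show ?thesis using 1 by (auto simp: hat_def)
  next
    case 2
    have "\<bar>hat g x\<bar> \<le> (C * pi\<^sup>2) * (x - 0)\<^sup>2" for x
      using bound[of x] sq[of "pi * x"] by (simp add: power_mult_distrib mult_ac)
    from DERIV_zero_of_quadratic[OF this] show ?thesis using 2 by (simp add: hat_def[of _ 0])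
  next
    case 3
    \<comment> \<open>The squared sine has period 1 in \<open>x\<close>, which transfers the
      estimate at 0 to the endpoint 1.\<close>
    have sin: "(sin (pi * x))\<^sup>2 = (sin (pi * (x - 1)))\<^sup>2" for x
      by (simp add: right_diff_distrib sin_diff)
    have "\<bar>hat g x\<bar> \<le> (C * pi\<^sup>2) * (x - 1)\<^sup>2" for x
      using order_trans[OF bound[of x, unfolded sin[of x]] sq[of "pi * (x - 1)"]]
      by (simp add: power_mult_distrib mult_ac)
    from DERIV_zero_of_quadratic[OF this] show ?thesis using 3 by (simp add: hat_def[of _ 1])
  next
    case 4
    have "((\<lambda>x. g (\<tau> x)) has_real_derivative g' (\<tau> x) * (pi * (1 + (\<tau> x)\<^sup>2))) (at x)"
      using DERIV_chain2[OF g DERIV_\<tau>[OF 4]] .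
    then have "(hat g has_real_derivative g' (\<tau> x) * (pi * (1 + (\<tau> x)\<^sup>2))) (at x)"
      by (rule has_field_derivative_transform_within_open[of _ _ _ "{0<..<1}"]) (use 4 in \<open>auto simp: hat_def\<close>)
    then show ?thesis using 4 by (simp add: hat_def)
  qed
qed

lemma rapid_decay_hat:
  assumes "rapid_decay g"
  shows "rapid_decay (hat g)"
  unfolding rapid_decay_def
proof
  fix m
  from assms obtain C where C: "\<And>w. \<bar>g w\<bar> * (1 + w\<^sup>2) ^ 0 \<le> C"
    unfolding rapid_decay_def by meson
  have C0: "C \<ge> 0" using C[of 0] by simp
  have "\<bar>hat g x\<bar> * (1 + x\<^sup>2) ^ m \<le> C * 2 ^ m" for x
  proof (cases "0 < x \<and> x < 1")
    case True
    then have "x\<^sup>2 \<le> 1" by (simp add: power2_eq_square mult_le_one)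
    then show ?thesis using True C[of "\<tau> x"] C0 by (intro mult_mono power_mono) (auto simp: hat_def)
  qed (use C0 in \<open>auto simp: hat_def\<close>)
  then show "\<exists>C. \<forall>x. \<bar>hat g x\<bar> * (1 + x\<^sup>2) ^ m \<le> C" by blast
qed

text \<open>The derivative of \<open>hat g\<close> is \<open>hat\<close> of the derivative of
  \<open>g\<close> times a polynomial; rapid decay absorbs the polynomial, and the induction
  continues.\<close>

lemma rd_hat: "Dk rapid_decay k g \<Longrightarrow> Dk rapid_decay k (hat g)"
proof (induction k arbitrary: g)
  case 0
  then show ?case by (simp add: rapid_decay_hat)
next
  case (Suc k)
  then obtain g' where g': "\<And>w. (g has_real_derivative g' w) (at w)" "Dk rapid_decay k g'"
    by (meson Dk_SucE)
  have g: "rapid_decay g" using Suc Dk_base by blast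
  have "Dk poly_bounded k (\<lambda>w. pi * (1 + w * w))"
    by (intro pb_mult pb_add pb_const pb_id)
  then have "Dk rapid_decay k (\<lambda>w. g' w * (pi * (1 + w\<^sup>2)))"
    unfolding power2_eq_square by (rule rd_mult[OF g'(2)])
  then show ?case
    using Suc.IH DERIV_hat[OF g g'(1)] rapid_decay_hat[OF g] by (intro Dk_SucI) blast+
qed

text \<open>A rapidly decaying displacement of the line remains so when measured in the interval
  coordinate. Order zero is the Lipschitz bound for \<open>\<sigma>\<close>; for the derivatives,
  one differentiation exhibits a decaying factor.\<close>

lemma rd_\<sigma>_perturbation:
  assumes "Dk rapid_decay k \<delta>"
  shows "Dk rapid_decay k (\<lambda>w. \<sigma> (w + \<delta> w) - \<sigma> w)"
proof -
  have base: "rapid_decay (\<lambda>w. \<sigma> (w + \<delta> w) - \<sigma> w)"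
  proof (rule rapid_decay_mono[OF Dk_base[OF assms]])
    show "\<bar>\<sigma> (w + \<delta> w) - \<sigma> w\<bar> \<le> 1 * \<bar>\<delta> w\<bar>" for w
      using \<sigma>_lipschitz[of "w + \<delta> w" w] by simp
  qed
  show ?thesis
  proof (cases k)
    case 0
    then show ?thesis using base by simp
  next
    case (Suc j)
    with assms obtain \<delta>' where \<delta>': "\<And>w. (\<delta> has_real_derivative \<delta>' w) (at w)" "Dk rapid_decay j \<delta>'"
      by (meson Dk_SucE)
    have \<delta>: "Dk rapid_decay j \<delta>" using assms Suc Dk_Suc_imp by blast
    let ?i = "\<lambda>w. 1 / (1 + (w + \<delta> w)\<^sup>2)" and ?e = "\<lambda>w::real. 1 / (1 + w\<^sup>2)"
    have i: "Dk poly_bounded j ?i"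
      by (rule pb_inverse_one_plus_sq[OF pb_add[OF pb_id rd_imp_pb[OF \<delta>]]])
    have i0: "Dk poly_bounded j ?e" using pb_inverse_one_plus_sq[OF pb_id] by assumption
    \<comment> \<open>Over a common denominator the difference of the two weights has the factor
      \<open>\<delta> w\<close>, so every term of \<open>?d\<close> is \<open>\<delta>\<close> or
      \<open>\<delta>'\<close> times a function of polynomial growth.\<close>
    let ?d = "\<lambda>w. \<delta>' w * ((1 / pi) * ?i w) + \<delta> w * ((-1 / pi) * ((2 * w + \<delta> w) * (?i w * ?e w)))"
    have "Dk rapid_decay j ?d"
      using \<delta> \<delta>' i i0 rd_imp_pb[OF \<delta>]
      by (intro rd_add rd_mult pb_mult pb_add pb_const pb_id)
    moreover have "((\<lambda>w. \<sigma> (w + \<delta> w) - \<sigma> w) has_real_derivative ?d w) (at w)" for w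
    proof -
      have "((\<lambda>w. \<sigma> (w + \<delta> w)) has_real_derivative 1 / (pi * (1 + (w + \<delta> w)\<^sup>2)) * (1 + \<delta>' w)) (at w)"
        by (rule DERIV_chain2[OF DERIV_\<sigma> DERIV_add[OF DERIV_ident \<delta>'(1)]])
      then have 1: "((\<lambda>w. \<sigma> (w + \<delta> w) - \<sigma> w) has_real_derivative
          1 / (pi * (1 + (w + \<delta> w)\<^sup>2)) * (1 + \<delta>' w) - 1 / (pi * (1 + w\<^sup>2))) (at w)"
        by (rule DERIV_diff[OF _ DERIV_\<sigma>])
      have "?i w - ?e w = ((1 + w\<^sup>2) - (1 + (w + \<delta> w)\<^sup>2)) * (?i w * ?e w)"
        using one_plus_sq_pos[of "w + \<delta> w"] one_plus_sq_pos[of w] by (simp add: diff_frac_eq)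
      also have "(1 + w\<^sup>2) - (1 + (w + \<delta> w)\<^sup>2) = \<delta> w * (- (2 * w + \<delta> w))"
        by (simp add: power2_eq_square algebra_simps)
      finally have "?i w - ?e w = \<delta> w * (- ((2 * w + \<delta> w) * (?i w * ?e w)))"
        by (simp only: mult_minus_left mult_minus_right mult.assoc)
      then have e1: "\<delta>' w * ((1 / pi) * ?i w) + (1 / pi) * (?i w - ?e w) = ?d w" by simp
      have e2: "1 / (pi * a) * (1 + d) - 1 / (pi * b) = d * ((1 / pi) * (1 / a)) + (1 / pi) * (1 / a - 1 / b)"
        for a b d :: real
        by (simp add: divide_inverse algebra_simps)
      show ?thesis using 1 unfolding e2 e1 .
    qed
    ultimately show ?thesis unfolding Suc by (intro Dk_SucI[of rapid_decay _ ?d, OF base])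
  qed
qed

section \<open>A flat flow\<close>

text \<open>An inequality of Peetre type, from \<open>2 * \<bar>y\<bar> \<le> 1 + y^2\<close>. It
  makes the weights at points of bounded distance comparable.\<close>

lemma one_plus_sq_shift: "1 + (y + b)\<^sup>2 \<le> (1 + \<bar>b\<bar>)\<^sup>2 * (1 + y\<^sup>2)" for y b :: real
proof -
  have "2 * \<bar>y\<bar> \<le> 1 + y\<^sup>2" using zero_le_power2[of "\<bar>y\<bar> - 1"] by (simp add: power2_eq_square algebra_simps)
  then have "\<bar>b\<bar> * (2 * \<bar>y\<bar>) \<le> \<bar>b\<bar> * (1 + y\<^sup>2)" by (intro mult_left_mono) auto
  moreover have "2 * (y * b) \<le> \<bar>b\<bar> * (2 * \<bar>y\<bar>)" using abs_ge_self[of "b * y"] by (simp add: abs_mult mult.commute)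
  moreover have "0 \<le> \<bar>b\<bar> * (1 + y\<^sup>2)" "0 \<le> b\<^sup>2 * y\<^sup>2" by auto
  moreover have "(1 + \<bar>b\<bar>)\<^sup>2 * (1 + y\<^sup>2) = 1 + y\<^sup>2 + 2 * (\<bar>b\<bar> * (1 + y\<^sup>2)) + b\<^sup>2 + b\<^sup>2 * y\<^sup>2"
    by (simp add: power2_eq_square algebra_simps)
  moreover have "1 + (y + b)\<^sup>2 = 1 + y\<^sup>2 + 2 * (y * b) + b\<^sup>2"
    by (simp add: power2_eq_square algebra_simps)
  ultimately show ?thesis by linarith
qed

lemma one_plus_sq_ratio_le:
  fixes y z b :: real
  assumes "\<bar>y - z\<bar> \<le> b"
  shows "(1 + y\<^sup>2) / (1 + z\<^sup>2) \<le> (1 + b)\<^sup>2"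
proof -
  have "1 + y\<^sup>2 \<le> (1 + \<bar>y - z\<bar>)\<^sup>2 * (1 + z\<^sup>2)" using one_plus_sq_shift[of z "y - z"] by simp
  also have "\<dots> \<le> (1 + b)\<^sup>2 * (1 + z\<^sup>2)"
    using assms by (intro mult_right_mono power_mono) auto
  finally show ?thesis using one_plus_sq_pos[of z] by (simp add: divide_le_eq)
qed

lemma one_plus_sq_ratio_ge:
  fixes y z b :: real
  assumes "\<bar>y - z\<bar> \<le> b"
  shows "1 / (1 + b)\<^sup>2 \<le> (1 + y\<^sup>2) / (1 + z\<^sup>2)"
proof -
  have "(1 + z\<^sup>2) / (1 + y\<^sup>2) \<le> (1 + b)\<^sup>2"
    using assms by (intro one_plus_sq_ratio_le) (simp add: abs_minus_commute)
  moreover have "0 < (1 + b)\<^sup>2" using assms by (smt (verit) zero_less_power2)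
  ultimately show ?thesis
    using one_plus_sq_pos[of y] one_plus_sq_pos[of z] by (simp add: field_simps)
qed

text \<open>The flow of the vector field \<open>1 / cosh w\<close> for time \<open>c\<close>,
  straightened to translations by \<open>y = sinh w\<close>. This gives the group law in closed
  form, and the exponential decay of the field will make the maps flat at the endpoints of a
  cell.\<close>

definition flow :: "real \<Rightarrow> real \<Rightarrow> real" where "flow c w = arsinh (sinh w + c)"
definition flow_deriv :: "real \<Rightarrow> real \<Rightarrow> real" where
  "flow_deriv c w = cosh w / sqrt (1 + (sinh w + c)\<^sup>2)"

lemma flow_flow: "flow c (flow d w) = flow (c + d) w"
  by (simp add: flow_def algebra_simps)

lemma flow_0 [simp]: "flow 0 w = w"
  by (simp add: flow_def arsinh_sinh_real)

lemma DERIV_flow: "(flow c has_real_derivative flow_deriv c w) (at w)"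
proof -
  have "((\<lambda>w. sinh w + c) has_real_derivative cosh w) (at w)"
    by (auto intro!: derivative_eq_intros)
  from DERIV_chain2[OF arsinh_real_has_field_derivative this] show ?thesis
    by (simp add: flow_def[abs_def] flow_deriv_def add.commute)
qed

lemma cosh_eq_sqrt: "cosh w = sqrt (1 + (sinh w)\<^sup>2)" for w :: real
  using hyperbolic_pythagoras[of w] cosh_real_nonneg[of w]
  by (intro real_sqrt_unique[symmetric]) auto

lemma sqrt_shift_le: "sqrt (1 + (y + b)\<^sup>2) \<le> (1 + \<bar>b\<bar>) * sqrt (1 + y\<^sup>2)"
proof -
  have "sqrt (1 + (y + b)\<^sup>2) \<le> sqrt ((1 + \<bar>b\<bar>)\<^sup>2 * (1 + y\<^sup>2))"
    using one_plus_sq_shift by (intro real_sqrt_le_mono)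
  then show ?thesis by (simp add: real_sqrt_mult)
qed

lemma sqrt_one_plus_sq_pos: "0 < sqrt (1 + (y::real)\<^sup>2)"
  using one_plus_sq_pos by simp

lemma flow_deriv_le: "flow_deriv c w \<le> 1 + \<bar>c\<bar>"
  using sqrt_shift_le[of "sinh w + c" "-c"] sqrt_one_plus_sq_pos[of "sinh w + c"]
  by (simp add: flow_deriv_def cosh_eq_sqrt divide_le_eq)

lemma flow_deriv_ge: "1 / (1 + \<bar>c\<bar>) \<le> flow_deriv c w"
  using sqrt_shift_le[of "sinh w" c] sqrt_one_plus_sq_pos[of "sinh w + c"]
  by (simp add: flow_deriv_def cosh_eq_sqrt field_simps)

lemma flow_deriv_pos: "0 < flow_deriv c w"
  using sqrt_one_plus_sq_pos by (simp add: flow_deriv_def)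

text \<open>The mean value inequality for \<open>arsinh\<close> on the ball of radius
  \<open>\<bar>c\<bar>\<close> about \<open>sinh w\<close>. With \<open>B\<close> left open it
  yields a uniform bound as well as one that decays in \<open>w\<close>.\<close>

lemma flow_displacement_bound:
  assumes "\<And>y. \<bar>y - sinh w\<bar> \<le> \<bar>c\<bar> \<Longrightarrow> 1 / sqrt (y\<^sup>2 + 1) \<le> B"
  shows "\<bar>flow c w - w\<bar> \<le> B * \<bar>c\<bar>"
proof -
  let ?S = "cball (sinh w) \<bar>c\<bar>"
  have "norm (arsinh (sinh w + c) - arsinh (sinh w)) \<le> B * norm (sinh w + c - sinh w)"
  proof (rule field_differentiable_bound[of ?S arsinh "\<lambda>y. 1 / sqrt (y\<^sup>2 + 1)"])
    show "norm (1 / sqrt (y\<^sup>2 + 1)) \<le> B" if "y \<in> ?S" for y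
      using assms[of y] that by (simp add: dist_real_def abs_minus_commute)
  qed (auto intro: arsinh_real_has_field_derivative simp: dist_real_def)
  then show ?thesis by (simp add: flow_def arsinh_sinh_real)
qed

lemma flow_displacement: "\<bar>flow c w - w\<bar> \<le> \<bar>c\<bar>"
proof -
  have "1 / sqrt (y\<^sup>2 + 1) \<le> 1" for y :: real
    using one_plus_sq_pos[of y] by (simp add: add.commute)
  then show ?thesis using flow_displacement_bound[of w c 1] by simp
qed

lemma flow_displacement_cosh: "\<bar>flow c w - w\<bar> \<le> (1 + \<bar>c\<bar>) * \<bar>c\<bar> * (1 / cosh w)"
proof -
  have "1 / sqrt (y\<^sup>2 + 1) \<le> (1 + \<bar>c\<bar>) / cosh w" if "\<bar>y - sinh w\<bar> \<le> \<bar>c\<bar>" for y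
  proof -
    have "cosh w \<le> (1 + \<bar>sinh w - y\<bar>) * sqrt (1 + y\<^sup>2)"
      using sqrt_shift_le[of y "sinh w - y"] by (simp add: cosh_eq_sqrt)
    also have "\<dots> \<le> (1 + \<bar>c\<bar>) * sqrt (1 + y\<^sup>2)"
      using that by (intro mult_right_mono) auto
    finally show ?thesis
      using sqrt_one_plus_sq_pos[of y] cosh_real_pos[of w] by (simp add: field_simps)
  qed
  from flow_displacement_bound[OF this] show ?thesis by (simp add: mult_ac)
qed

subsection \<open>The displacement of the flow decays rapidly with all derivatives\<close>

lemma rapid_decay_sech: "rapid_decay (\<lambda>w. 1 / cosh w)"
  unfolding rapid_decay_def
proof
  fix m :: nat
  \<comment> \<open>\<open>n\<close> is at least \<open>2 * m\<close>, so the power \<open>n\<close>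
    of \<open>1 + \<bar>w\<bar>\<close> dominates, and it is positive for the division. Raising
    \<open>z \<le> exp z\<close> at \<open>z = ?x / n\<close> to the power \<open>n\<close> then
    bounds it by the exponential.\<close>
  define n where "n = 2 * m + 1"
  have n: "n > 0" "2 * m \<le> n" by (simp_all add: n_def)
  have "\<bar>1 / cosh w\<bar> * (1 + w\<^sup>2) ^ m \<le> 2 * exp 1 * real n ^ n" for w :: real
  proof -
    let ?x = "1 + \<bar>w\<bar>"
    have "?x / real n \<le> exp (?x / real n)" using exp_ge_add_one_self[of "?x / real n"] by linarith
    then have "(?x / real n) ^ n \<le> exp (?x / real n) ^ n" by (intro power_mono) auto
    also have "\<dots> = exp ?x" using n by (subst exp_of_nat_mult[symmetric]) simp
    finally have "?x ^ n \<le> real n ^ n * exp ?x" using n by (simp add: power_divide field_simps)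
    also have "exp ?x \<le> exp 1 * (2 * cosh w)"
      by (auto simp: exp_add cosh_def abs_if)
    finally have 1: "?x ^ n \<le> real n ^ n * (exp 1 * (2 * cosh w))" by (simp add: mult_left_mono)
    have "1 + w\<^sup>2 \<le> ?x ^ 2" by (simp add: power2_eq_square algebra_simps)
    then have "(1 + w\<^sup>2) ^ m \<le> (?x ^ 2) ^ m" by (intro power_mono) auto
    also have "\<dots> \<le> ?x ^ n" unfolding power_mult[symmetric] using n by (intro power_increasing) auto
    finally have "(1 + w\<^sup>2) ^ m \<le> real n ^ n * (exp 1 * (2 * cosh w))" using 1 by linarith
    then show ?thesis using cosh_real_pos[of w] by (simp add: field_simps)
  qed
  then show "\<exists>C. \<forall>w::real. \<bar>1 / cosh w\<bar> * (1 + w\<^sup>2) ^ m \<le> C" by (intro exI allI)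
qed

text \<open>Numerator and denominator of \<open>flow_deriv\<close> are compared through the
  difference of their squares, \<open>- (2 * sinh w + c) * c\<close>, which is of the order of
  \<open>cosh w\<close> only; dividing by their sum leaves a bounded difference.\<close>

lemma flow_deriv_displacement: "\<bar>flow_deriv c w - 1\<bar> \<le> (1 + \<bar>c\<bar>) * (2 * \<bar>c\<bar> + c\<^sup>2) * \<bar>1 / cosh w\<bar>"
proof -
  let ?r = "sqrt (1 + (sinh w + c)\<^sup>2)"
  have r: "?r > 0" and C: "cosh w > 0" "cosh w \<ge> 1"
    using sqrt_one_plus_sq_pos cosh_real_pos cosh_real_ge_1 by auto
  have "?r\<^sup>2 = 1 + (sinh w + c)\<^sup>2" using one_plus_sq_pos by simp
  also have "\<dots> = (cosh w)\<^sup>2 + (2 * sinh w + c) * c"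
    using hyperbolic_pythagoras[of w] by (simp add: power2_eq_square algebra_simps)
  finally have "(cosh w - ?r) * (cosh w + ?r) = - ((2 * sinh w + c) * c)"
    by (simp add: power2_eq_square algebra_simps)
  then have "\<bar>(cosh w - ?r) * (cosh w + ?r)\<bar> = \<bar>(2 * sinh w + c) * c\<bar>" by simp
  moreover have "\<bar>cosh w + ?r\<bar> = cosh w + ?r" using r C by simp
  ultimately have "\<bar>cosh w - ?r\<bar> * (cosh w + ?r) = \<bar>2 * sinh w + c\<bar> * \<bar>c\<bar>"
    unfolding abs_mult by simp
  moreover have "\<bar>cosh w - ?r\<bar> * cosh w \<le> \<bar>cosh w - ?r\<bar> * (cosh w + ?r)"
    using r by (intro mult_left_mono) auto
  moreover have "\<bar>2 * sinh w + c\<bar> * \<bar>c\<bar> \<le> (2 * \<bar>c\<bar> + c\<^sup>2) * cosh w"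
  proof -
    have "\<bar>sinh w\<bar> \<le> cosh w"
      unfolding cosh_eq_sqrt by (rule real_le_rsqrt) simp
    then have "\<bar>2 * sinh w + c\<bar> \<le> (2 + \<bar>c\<bar>) * cosh w"
      using C mult_left_mono[OF C(2), of "\<bar>c\<bar>"] by (simp add: algebra_simps)
    then have "\<bar>2 * sinh w + c\<bar> * \<bar>c\<bar> \<le> (2 + \<bar>c\<bar>) * cosh w * \<bar>c\<bar>" by (intro mult_right_mono) auto
    also have "\<dots> = (2 * \<bar>c\<bar> + c\<^sup>2) * cosh w" by (simp add: power2_eq_square algebra_simps)
    finally show ?thesis .
  qed
  ultimately have "\<bar>cosh w - ?r\<bar> * cosh w \<le> (2 * \<bar>c\<bar> + c\<^sup>2) * cosh w" by linarith
  then have 1: "\<bar>cosh w - ?r\<bar> \<le> 2 * \<bar>c\<bar> + c\<^sup>2" using C by simp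
  have "flow_deriv c w - 1 = (cosh w - ?r) * (flow_deriv c w * (1 / cosh w))"
    using r C by (simp add: flow_deriv_def field_simps)
  then have "\<bar>flow_deriv c w - 1\<bar> = \<bar>cosh w - ?r\<bar> * (flow_deriv c w * \<bar>1 / cosh w\<bar>)"
    using flow_deriv_pos[of c w] by (simp add: abs_mult)
  also have "\<dots> \<le> (2 * \<bar>c\<bar> + c\<^sup>2) * ((1 + \<bar>c\<bar>) * \<bar>1 / cosh w\<bar>)"
    using 1 flow_deriv_le[of c w] flow_deriv_pos[of c w]
    by (intro mult_mono mult_right_mono) auto
  finally show ?thesis by (simp add: mult_ac)
qed

lemma DERIV_sech: "((\<lambda>w. 1 / cosh w) has_real_derivative - 1 * (1 / cosh w * (sinh w / cosh w))) (at w)"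
  for w :: real
  using cosh_real_pos[of w] by (auto intro!: derivative_eq_intros simp: power2_eq_square)

lemma DERIV_sinh_cosh: "((\<lambda>w. sinh w / cosh w) has_real_derivative 1 / cosh w * (1 / cosh w)) (at w)"
  for w :: real
  using cosh_real_pos[of w] hyperbolic_pythagoras[of w]
  by (auto intro!: derivative_eq_intros simp: power2_eq_square field_simps)

text \<open>The form matters: \<open>1 / cosh w\<close> times a polynomial in
  \<open>1 / cosh w\<close>, \<open>sinh w / cosh w\<close> and \<open>flow_deriv c\<close>. These
  three functions are thus closed under differentiation, and the factor in front supplies the
  decay.\<close>

lemma DERIV_flow_deriv:
  "(flow_deriv c has_real_derivative
     1 / cosh w * (flow_deriv c w * (flow_deriv c w * (flow_deriv c w *
       (2 * c * (sinh w / cosh w * (sinh w / cosh w)) + c\<^sup>2 * (1 / cosh w * (sinh w / cosh w)) + - c))))) (at w)"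
proof -
  let ?r = "\<lambda>w. sqrt (1 + (sinh w + c)\<^sup>2)"
  define s C r where "s = sinh w" and "C = cosh w" and "r = ?r w"
  have r0: "r > 0" and C0: "C > 0" using sqrt_one_plus_sq_pos cosh_real_pos by (auto simp: r_def C_def)
  have r2: "r\<^sup>2 = C\<^sup>2 + 2 * c * s + c\<^sup>2"
    using one_plus_sq_pos[of "sinh w + c"] hyperbolic_pythagoras[of w]
    by (simp add: r_def C_def s_def power2_eq_square algebra_simps)
  have "((\<lambda>w. 1 + (sinh w + c)\<^sup>2) has_real_derivative 2 * (s + c) * C) (at w)"
    by (auto intro!: derivative_eq_intros simp: s_def C_def)
  then have "(?r has_real_derivative inverse r / 2 * (2 * (s + c) * C)) (at w)"
    unfolding r_def by (intro DERIV_chain2[of sqrt] DERIV_real_sqrt one_plus_sq_pos)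
  moreover have "inverse r / 2 * (2 * (s + c) * C) = (s + c) * C / r"
    using r0 by (simp add: field_simps)
  ultimately have dr: "(?r has_real_derivative (s + c) * C / r) (at w)" by (simp only:)
  have dC: "(cosh has_real_derivative s) (at w)"
    by (auto intro!: derivative_eq_intros simp: s_def)
  have "(flow_deriv c has_real_derivative (s * r - C * ((s + c) * C / r)) / (r * r)) (at w)"
    using DERIV_divide[OF dC dr] r0 by (simp add: flow_deriv_def[abs_def] r_def C_def)
  moreover have "(s * r - C * ((s + c) * C / r)) / (r * r) =
     1 / C * (C / r * (C / r * (C / r * (2 * c * (s / C * (s / C)) + c\<^sup>2 * (1 / C * (s / C)) + - c))))"
  proof -
    have "(s * r - C * ((s + c) * C / r)) / (r * r) = (s * r\<^sup>2 - C\<^sup>2 * (s + c)) / r ^ 3"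
      using r0 by (simp add: field_simps power2_eq_square power3_eq_cube)
    also have "\<dots> = (2 * c * s\<^sup>2 + c\<^sup>2 * s - c * C\<^sup>2) / r ^ 3"
      unfolding r2 by (simp add: power2_eq_square algebra_simps)
    also have "\<dots> = 1 / C * (C / r * (C / r * (C / r * (2 * c * (s / C * (s / C)) + c\<^sup>2 * (1 / C * (s / C)) + - c))))"
      using r0 C0 by (simp add: field_simps power2_eq_square power3_eq_cube)
    finally show ?thesis .
  qed
  ultimately show ?thesis by (simp add: flow_deriv_def r_def s_def C_def)
qed

lemma pb_flow_generators:
  "Dk rapid_decay k (\<lambda>w. 1 / cosh w) \<and> Dk poly_bounded k (\<lambda>w. sinh w / cosh w)
    \<and> Dk poly_bounded k (flow_deriv c)"
proof (induction k)
  case 0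
  have "\<bar>sinh w / cosh w\<bar> \<le> 1" for w :: real
  proof -
    have "\<bar>sinh w\<bar> \<le> cosh w" unfolding cosh_eq_sqrt by (rule real_le_rsqrt) simp
    then show ?thesis using cosh_real_pos[of w] by simp
  qed
  moreover have "\<bar>flow_deriv c w\<bar> \<le> 1 + \<bar>c\<bar>" for w
    using flow_deriv_le[of c w] flow_deriv_pos[of c w] by simp
  ultimately have "poly_bounded (\<lambda>w. sinh w / cosh w)" "poly_bounded (flow_deriv c)"
    by (auto intro: poly_bounded_bounded[of _ 1] poly_bounded_bounded[of _ "1 + \<bar>c\<bar>"])
  then show ?case using rapid_decay_sech by simp
next
  case (Suc k)
  let ?A = "\<lambda>w::real. 1 / cosh w" and ?B = "\<lambda>w::real. sinh w / cosh w"
  have A: "Dk rapid_decay k ?A" and B: "Dk poly_bounded k ?B" and R: "Dk poly_bounded k (flow_deriv c)"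
    using Suc by auto
  note A' = rd_imp_pb[OF A]
  have b: "poly_bounded ?B" "poly_bounded (flow_deriv c)" using B R Dk_base by blast+
  have "Dk rapid_decay k (\<lambda>w. ?A w * (-1 * ?B w))"
    using A B by (intro rd_mult pb_mult pb_const)
  then have "Dk rapid_decay k (\<lambda>w. - 1 * (?A w * ?B w))" by simp
  then have "Dk rapid_decay (Suc k) ?A"
    using DERIV_sech rapid_decay_sech by (intro Dk_SucI)
  moreover have "Dk poly_bounded (Suc k) ?B"
    by (rule Dk_SucI[of poly_bounded, OF b(1) DERIV_sinh_cosh pb_mult[OF A' A']])
  moreover have "Dk poly_bounded (Suc k) (flow_deriv c)"
  proof (rule Dk_SucI[of poly_bounded])
    show "poly_bounded (flow_deriv c)" by (fact b)
    show "Dk poly_bounded k (\<lambda>w. 1 / cosh w * (flow_deriv c w * (flow_deriv c w * (flow_deriv c w *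
       (2 * c * (sinh w / cosh w * (sinh w / cosh w)) + c\<^sup>2 * (1 / cosh w * (sinh w / cosh w)) + - c)))))"
      using A' B R by (intro pb_mult pb_add pb_const)
  qed (rule DERIV_flow_deriv)
  ultimately show ?case by blast
qed

lemma rd_flow_deriv: "Dk rapid_decay k (\<lambda>w. flow_deriv c w - 1)"
proof -
  have base: "rapid_decay (\<lambda>w. flow_deriv c w - 1)"
    using rapid_decay_mono[OF rapid_decay_sech flow_deriv_displacement] .
  show ?thesis
  proof (cases k)
    case 0
    then show ?thesis using base by simp
  next
    case (Suc j)
    have A: "Dk rapid_decay j (\<lambda>w. 1 / cosh w)" and B: "Dk poly_bounded j (\<lambda>w. sinh w / cosh w)"
      and R: "Dk poly_bounded j (flow_deriv c)" using pb_flow_generators by auto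
    note A' = rd_imp_pb[OF A]
    let ?d = "\<lambda>w. 1 / cosh w * (flow_deriv c w * (flow_deriv c w * (flow_deriv c w *
       (2 * c * (sinh w / cosh w * (sinh w / cosh w)) + c\<^sup>2 * (1 / cosh w * (sinh w / cosh w)) + - c))))"
    have "Dk rapid_decay j ?d" using A A' B R by (intro rd_mult pb_mult pb_add pb_const)
    moreover have "((\<lambda>w. flow_deriv c w - 1) has_real_derivative ?d w) (at w)" for w
      using DERIV_diff[OF DERIV_flow_deriv DERIV_const[of 1]] by simp
    ultimately show ?thesis unfolding Suc by (intro Dk_SucI[of rapid_decay _ ?d, OF base])
  qed
qed

lemma rd_flow: "Dk rapid_decay k (\<lambda>w. flow c w - w)"
proof -
  have base: "rapid_decay (\<lambda>w. flow c w - w)"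
    using flow_displacement_cosh[of c]
    by (intro rapid_decay_mono[OF rapid_decay_sech, of _ "(1 + \<bar>c\<bar>) * \<bar>c\<bar>"]) auto
  show ?thesis
  proof (cases k)
    case 0
    then show ?thesis using base by simp
  next
    case (Suc j)
    have "((\<lambda>w. flow c w - w) has_real_derivative flow_deriv c w - 1) (at w)" for w
      by (intro DERIV_diff DERIV_flow DERIV_ident)
    then show ?thesis unfolding Suc by (rule Dk_SucI[of rapid_decay, OF base _ rd_flow_deriv])
  qed
qed

subsection \<open>The flow on the unit cell\<close>

text \<open>The chart is used twice: here it places the flow in the single cell \<open>[0,1]\<close>
  of the line, later \<open>interval_map\<close> carries the whole line to the interval.\<close>

definition \<kappa> :: "real \<Rightarrow> real \<Rightarrow> real" where
  "\<kappa> c t = (if 0 < t \<and> t < 1 then \<sigma> (flow c (\<tau> t)) else t)"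

definition \<kappa>' :: "real \<Rightarrow> real \<Rightarrow> real" where
  "\<kappa>' c t = (if 0 < t \<and> t < 1
     then flow_deriv c (\<tau> t) * ((1 + (\<tau> t)\<^sup>2) / (1 + (flow c (\<tau> t))\<^sup>2)) else 1)"

lemma \<kappa>_fix: "t \<le> 0 \<or> 1 \<le> t \<Longrightarrow> \<kappa> c t = t"
  by (auto simp: \<kappa>_def)

lemma \<kappa>_unit: "0 < t \<Longrightarrow> t < 1 \<Longrightarrow> 0 < \<kappa> c t \<and> \<kappa> c t < 1"
  by (simp add: \<kappa>_def \<sigma>_range)

lemma \<kappa>_\<kappa>: "\<kappa> c (\<kappa> d t) = \<kappa> (c + d) t"
  by (simp add: \<kappa>_def \<sigma>_range flow_flow)

lemma \<kappa>_0 [simp]: "\<kappa> 0 t = t"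
  by (simp add: \<kappa>_def \<sigma>_\<tau>)

text \<open>Splitting \<open>flow c w\<close> into \<open>w\<close> and its rapidly decaying
  displacement gives the shape to which \<open>rd_\<sigma>_perturbation\<close> and
  \<open>rd_hat\<close> apply.\<close>

lemma \<kappa>_eq_hat: "\<kappa> c t = t + hat (\<lambda>w. \<sigma> (w + (flow c w - w)) - \<sigma> w) t"
  by (simp add: \<kappa>_def hat_def \<sigma>_\<tau>)

lemma rd_\<kappa>: "Dk rapid_decay k (\<lambda>t. \<kappa> c t - t)"
  using rd_hat[OF rd_\<sigma>_perturbation[OF rd_flow]] by (simp add: \<kappa>_eq_hat)

lemma DERIV_\<kappa>: "(\<kappa> c has_real_derivative \<kappa>' c t) (at t)"
proof -
  let ?g = "\<lambda>w. \<sigma> (flow c w) - \<sigma> w"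
  let ?g' = "\<lambda>w. 1 / (pi * (1 + (flow c w)\<^sup>2)) * flow_deriv c w - 1 / (pi * (1 + w\<^sup>2))"
  have "rapid_decay ?g"
    using Dk_base[OF rd_\<sigma>_perturbation[OF rd_flow[of 0 c]]] by simp
  moreover have "(?g has_real_derivative ?g' w) (at w)" for w
    by (intro DERIV_diff DERIV_\<sigma> DERIV_chain2[OF DERIV_\<sigma> DERIV_flow])
  ultimately have "(hat ?g has_real_derivative hat (\<lambda>w. ?g' w * (pi * (1 + w\<^sup>2))) t) (at t)"
    by (rule DERIV_hat)
  then have "((\<lambda>t. t + hat ?g t) has_real_derivative 1 + hat (\<lambda>w. ?g' w * (pi * (1 + w\<^sup>2))) t) (at t)"
    by (intro DERIV_add DERIV_ident)
  moreover have "(\<lambda>t. t + hat ?g t) = \<kappa> c"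
    by (simp add: \<kappa>_eq_hat fun_eq_iff)
  moreover have "1 + hat (\<lambda>w. ?g' w * (pi * (1 + w\<^sup>2))) t = \<kappa>' c t"
    using one_plus_sq_pos[of "\<tau> t"] one_plus_sq_pos[of "flow c (\<tau> t)"]
    by (simp add: hat_def \<kappa>'_def left_diff_distrib)
  ultimately show ?thesis by simp
qed

text \<open>Continuity at the gluing points 0 and 1 is not visible in the formula; it follows from
  the second derivative contained in \<open>rd_\<kappa>\<close>.\<close>

lemma isCont_\<kappa>': "isCont (\<kappa>' c) t"
proof -
  obtain d where d: "\<And>t. ((\<lambda>t. \<kappa> c t - t) has_real_derivative d t) (at t)" "Dk rapid_decay 1 d"
    using rd_\<kappa>[of "Suc 1" c] by (rule Dk_SucE) blast
  have "((\<lambda>t. \<kappa> c t - t) has_real_derivative \<kappa>' c t - 1) (at t)" for t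
    by (intro DERIV_diff DERIV_\<kappa> DERIV_ident)
  then have "d t = \<kappa>' c t - 1" for t using d(1) DERIV_unique by blast
  then have "\<kappa>' c = (\<lambda>t. d t + 1)" by (simp add: fun_eq_iff)
  moreover have "isCont d t" using d(2) by (auto intro: DERIV_isCont)
  ultimately show ?thesis by simp
qed

lemma \<kappa>'_pos: "0 < \<kappa>' c t"
  using flow_deriv_pos one_plus_sq_pos by (simp add: \<kappa>'_def)

lemma \<kappa>'_outside: "t \<le> 0 \<or> 1 \<le> t \<Longrightarrow> \<kappa>' c t = 1"
  by (auto simp: \<kappa>'_def)

text \<open>One factor comes from \<open>flow_deriv\<close>, two from the ratio of the weights. With
  \<open>\<kappa>'_ge\<close> this squeezes the derivative to 1 uniformly in \<open>t\<close> as
  \<open>c\<close> tends to 0, that is, \<open>\<kappa> c\<close> tends to the identity in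
  \<open>C^1\<close>.\<close>

lemma \<kappa>'_le: "\<kappa>' c t \<le> (1 + \<bar>c\<bar>) ^ 3"
proof (cases "0 < t \<and> t < 1")
  case True
  have "flow_deriv c (\<tau> t) * ((1 + (\<tau> t)\<^sup>2) / (1 + (flow c (\<tau> t))\<^sup>2)) \<le> (1 + \<bar>c\<bar>) * (1 + \<bar>c\<bar>)\<^sup>2"
    using flow_displacement[of c "\<tau> t"] flow_deriv_le
    by (intro mult_mono one_plus_sq_ratio_le) (auto simp: abs_minus_commute add_nonneg_nonneg)
  then show ?thesis using True by (simp add: \<kappa>'_def power3_eq_cube power2_eq_square mult_ac)
next
  case False
  then have "\<kappa>' c t = 1" unfolding \<kappa>'_def by (rule if_not_P)
  then show ?thesis using one_le_power[of "1 + \<bar>c\<bar>" 3] by simp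
qed

lemma \<kappa>'_ge: "1 / (1 + \<bar>c\<bar>) ^ 3 \<le> \<kappa>' c t"
proof (cases "0 < t \<and> t < 1")
  case True
  have "1 / (1 + \<bar>c\<bar>) * (1 / (1 + \<bar>c\<bar>)\<^sup>2)
      \<le> flow_deriv c (\<tau> t) * ((1 + (\<tau> t)\<^sup>2) / (1 + (flow c (\<tau> t))\<^sup>2))"
    using flow_displacement[of c "\<tau> t"] flow_deriv_ge
    by (intro mult_mono one_plus_sq_ratio_ge)
       (auto simp: abs_minus_commute less_imp_le[OF flow_deriv_pos])
  then show ?thesis using True by (simp add: \<kappa>'_def power3_eq_cube power2_eq_square mult_ac)
next
  case False
  then have "\<kappa>' c t = 1" unfolding \<kappa>'_def by (rule if_not_P)
  then show ?thesis using one_le_power[of "1 + \<bar>c\<bar>" 3] by simp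
qed

section \<open>Lattice diffeomorphisms\<close>

text \<open>Only the first quarter of a cell of length 4 is moved. The rest is room for a copy
  shifted by 1 and for the transition of the translation that is cut off.\<close>

definition P :: "(int \<Rightarrow> real) \<Rightarrow> real \<Rightarrow> real" where
  "P a t = 4 * of_int \<lfloor>t/4\<rfloor> + \<kappa> (a \<lfloor>t/4\<rfloor>) (t - 4 * of_int \<lfloor>t/4\<rfloor>)"

definition P' :: "(int \<Rightarrow> real) \<Rightarrow> real \<Rightarrow> real" where
  "P' a t = \<kappa>' (a \<lfloor>t/4\<rfloor>) (t - 4 * of_int \<lfloor>t/4\<rfloor>)"

lemma cell_cases:
  fixes t :: real
  obtains i :: int where "4 * of_int i \<le> t" "t < 4 * of_int i + 4"
proof
  show "4 * of_int \<lfloor>t/4\<rfloor> \<le> t" "t < 4 * of_int \<lfloor>t/4\<rfloor> + 4" by linarith+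
qed

lemma floor_cell: "4 * of_int i \<le> t \<Longrightarrow> t < 4 * of_int i + 4 \<Longrightarrow> \<lfloor>t/4\<rfloor> = i" for t :: real
  by (rule floor_unique) auto

text \<open>The formula of cell \<open>i\<close> extends into the fixed part of the cell before it.
  So each point of a cell has an open neighbourhood with a single formula, and derivatives need no
  case for cell boundaries.\<close>

lemma cell_neighbourhood:
  fixes t :: real
  assumes "4 * of_int i - 3 \<le> t" "t \<le> 4 * of_int i + 4"
  shows "P a t = 4 * of_int i + \<kappa> (a i) (t - 4 * of_int i)"
    and "P' a t = \<kappa>' (a i) (t - 4 * of_int i)"
proof -
  consider "t < 4 * of_int i" | "4 * of_int i \<le> t" "t < 4 * of_int i + 4" | "t = 4 * of_int i + 4"
    using assms by linarith
  then have "P a t = 4 * of_int i + \<kappa> (a i) (t - 4 * of_int i) \<and> P' a t = \<kappa>' (a i) (t - 4 * of_int i)"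
  proof cases
    case 1
    then have "\<lfloor>t/4\<rfloor> = i - 1" using assms by (intro floor_cell) auto
    then show ?thesis using 1 assms by (simp add: P_def P'_def \<kappa>_fix \<kappa>'_outside)
  next
    case 2
    then show ?thesis using floor_cell by (simp add: P_def P'_def)
  next
    case 3
    then have "\<lfloor>t/4\<rfloor> = i + 1" by (intro floor_cell) auto
    then show ?thesis using 3 by (simp add: P_def P'_def \<kappa>_fix \<kappa>'_outside)
  qed
  then show "P a t = 4 * of_int i + \<kappa> (a i) (t - 4 * of_int i)"
    and "P' a t = \<kappa>' (a i) (t - 4 * of_int i)" by auto
qed

lemma P_cell_range:
  fixes t :: real
  assumes "4 * of_int i \<le> t" "t < 4 * of_int i + 4"
  shows "4 * of_int i \<le> P a t" "P a t < 4 * of_int i + 4"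
    and "t < 4 * of_int i + 1 \<Longrightarrow> P a t < 4 * of_int i + 1"
    and "4 * of_int i + 1 \<le> t \<Longrightarrow> P a t = t"
    and "a i = 0 \<Longrightarrow> P a t = t"
proof -
  define u where "u = t - 4 * of_int i"
  have u: "0 \<le> u" "u < 4" using assms by (auto simp: u_def)
  have P: "P a t = 4 * of_int i + \<kappa> (a i) u" "t = 4 * of_int i + u"
    using cell_neighbourhood(1)[of i t a] assms by (simp_all add: u_def)
  have k: "0 \<le> \<kappa> (a i) u" "\<kappa> (a i) u < 4" "u < 1 \<Longrightarrow> \<kappa> (a i) u < 1"
    using u \<kappa>_unit[of u "a i"] by (auto simp: \<kappa>_def)
  show "4 * of_int i \<le> P a t" "P a t < 4 * of_int i + 4"
    "t < 4 * of_int i + 1 \<Longrightarrow> P a t < 4 * of_int i + 1"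
    "4 * of_int i + 1 \<le> t \<Longrightarrow> P a t = t" "a i = 0 \<Longrightarrow> P a t = t"
    using P k by (auto simp: \<kappa>_fix)
qed

lemma P_P: "P a (P b t) = P (\<lambda>i. a i + b i) t"
proof (rule cell_cases[of t])
  fix i :: int assume t: "4 * of_int i \<le> t" "t < 4 * of_int i + 4"
  show ?thesis
    using cell_neighbourhood(1)[of i t] cell_neighbourhood(1)[of i "P b t" a] P_cell_range(1,2)[OF t, of b] t
    by (simp add: \<kappa>_\<kappa>)
qed

lemma P_zero: "P (\<lambda>_. 0) t = t"
  by (simp add: P_def)

lemma P_minus: "P a (P (\<lambda>i. - a i) t) = t" "P (\<lambda>i. - a i) (P a t) = t"
  by (simp_all add: P_P P_zero)

lemma P_shift: "P a (t + 4 * of_int m) = P (\<lambda>i. a (i + m)) t + 4 * of_int m"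
proof (rule cell_cases[of t])
  fix i :: int assume t: "4 * of_int i \<le> t" "t < 4 * of_int i + 4"
  show ?thesis
    using cell_neighbourhood(1)[of i t] cell_neighbourhood(1)[of "i + m" "t + 4 * of_int m"] t
    by simp
qed

lemma DERIV_P: "(P a has_real_derivative P' a t) (at t)"
proof (rule cell_cases[of t])
  fix i :: int assume t: "4 * of_int i \<le> t" "t < 4 * of_int i + 4"
  have "((\<lambda>t. 4 * of_int i + \<kappa> (a i) (t - 4 * of_int i)) has_real_derivative
      0 + \<kappa>' (a i) (t - 4 * of_int i) * (1 - 0)) (at t)"
    by (intro DERIV_add DERIV_const DERIV_chain2[OF DERIV_\<kappa>] DERIV_diff DERIV_ident)
  then have "(P a has_real_derivative 0 + \<kappa>' (a i) (t - 4 * of_int i) * (1 - 0)) (at t)"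
    by (rule has_field_derivative_transform_within_open[of _ _ _ "{4 * of_int i - 3<..<4 * of_int i + 4}"])
       (use t cell_neighbourhood(1)[symmetric] in auto)
  then show ?thesis using cell_neighbourhood(2)[of i t a] t by simp
qed

lemma isCont_P': "isCont (P' a) t"
proof (rule cell_cases[of t])
  fix i :: int assume t: "4 * of_int i \<le> t" "t < 4 * of_int i + 4"
  have c: "isCont (\<lambda>t. \<kappa>' (a i) (t - 4 * of_int i)) t"
    by (rule isCont_o2[OF _ isCont_\<kappa>']) simp
  have "\<forall>\<^sub>F s in nhds t. P' a s = \<kappa>' (a i) (s - 4 * of_int i)"
    unfolding eventually_nhds using t cell_neighbourhood(2)
    by (intro exI[of _ "{4 * of_int i - 3<..<4 * of_int i + 4}"]) auto
  then show ?thesis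
    using isCont_cong[of "P' a" "\<lambda>t. \<kappa>' (a i) (t - 4 * of_int i)" t] c by blast
qed

lemma P'_pos: "0 < P' a t"
  by (simp add: P'_def \<kappa>'_pos)

lemma P_strict_mono: "s < t \<Longrightarrow> P a s < P a t"
  using DERIV_pos_imp_increasing[of s t "P a"] DERIV_P P'_pos by metis

lemma P_displacement: "\<bar>P a t - t\<bar> \<le> 1"
proof -
  define u where "u = t - 4 * of_int \<lfloor>t/4\<rfloor>"
  have "\<bar>\<kappa> c u - u\<bar> \<le> 1" for c
    using \<kappa>_unit[of u c] by (cases "0 < u \<and> u < 1") (auto simp: \<kappa>_fix not_less)
  moreover have "P a t - t = \<kappa> (a \<lfloor>t/4\<rfloor>) u - u" by (simp add: P_def u_def)
  ultimately show ?thesis by simp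
qed

text \<open>Conjugated by the unit translation, \<open>P b\<close> has its support in the intervals
  \<open>[4 i + 1, 4 i + 2]\<close>, which meet the support of \<open>P a\<close> in endpoints
  only.\<close>

lemma P_commute: "P a (P b (t - 1) + 1) = P b (P a t - 1) + 1"
proof (rule cell_cases[of t])
  fix i :: int assume t: "4 * of_int i \<le> t" "t < 4 * of_int i + 4"
  have fix_before: "P b (s - 1) = s - 1" if "4 * of_int i \<le> s" "s < 4 * of_int i + 1" for s
  proof -
    have "4 * of_int (i - 1) \<le> s - 1" "s - 1 < 4 * of_int (i - 1) + 4" "4 * of_int (i - 1) + 1 \<le> s - 1"
      using that by auto
    then show ?thesis by (rule P_cell_range(4))
  qed
  show ?thesis
  proof (cases "t < 4 * of_int i + 1")
    case True
    then show ?thesis using fix_before[of t] fix_before[of "P a t"] P_cell_range[OF t, of a] t by simp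
  next
    case False
    then have s: "4 * of_int i \<le> t - 1" "t - 1 < 4 * of_int i + 4" using t by auto
    have "P b (t - 1) + 1 < 4 * of_int i + 4"
    proof (cases "t - 1 < 4 * of_int i + 1")
      case True
      then show ?thesis using P_cell_range(3)[OF s, of b] by simp
    next
      case False
      then show ?thesis using P_cell_range(4)[OF s, of b] t by simp
    qed
    then have "P a (P b (t - 1) + 1) = P b (t - 1) + 1"
      using P_cell_range(1)[OF s, of b] by (intro P_cell_range(4)[of i]) auto
    then show ?thesis using P_cell_range(4)[OF t, of a] False by simp
  qed
qed

text \<open>\<open>Q a\<close> acts by \<open>\<kappa>\<close> on \<open>[4 i, 4 i + 1]\<close> and by its inverse on \<open>[4 i + 1, 4 i + 2]\<close>; the two parts
  have disjoint supports, which makes \<open>Q\<close> additive in \<open>a\<close>.\<close>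

definition Q :: "(int \<Rightarrow> real) \<Rightarrow> real \<Rightarrow> real" where
  "Q a t = P a (P (\<lambda>i. - a i) (t - 1) + 1)"

lemma Q_Q: "Q a (Q b t) = Q (\<lambda>i. a i + b i) t"
proof -
  have "Q a (Q b t) = P a (P (\<lambda>i. - a i) (P b (P (\<lambda>i. - b i) (t - 1) + 1) - 1) + 1)"
    by (simp add: Q_def)
  also have "\<dots> = P a (P b (P (\<lambda>i. - a i) (P (\<lambda>i. - b i) (t - 1)) + 1))"
    using P_commute[of b "\<lambda>i. - a i" "P (\<lambda>i. - b i) (t - 1) + 1"] by simp
  finally show ?thesis by (simp add: P_P Q_def)
qed

lemma Q_shift: "Q a (t + 4 * of_int m) = Q (\<lambda>i. a (i + m)) t + 4 * of_int m"
  using P_shift[of "\<lambda>i. - a i" "t - 1" m] P_shift[of a "P (\<lambda>i. - a (i + m)) (t - 1) + 1" m]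
  by (simp add: Q_def algebra_simps)

lemma Q_zero: "Q (\<lambda>_. 0) t = t"
  by (simp add: Q_def P_zero)

lemma Q_pow: "(Q a ^^ n) t = Q (\<lambda>i. real n * a i) t"
  by (induction n arbitrary: t) (simp_all add: Q_zero Q_Q distrib_right)

section \<open>From the line to the interval\<close>

lemma filterlim_\<tau>_at_right_0: "filterlim \<tau> at_bot (at_right 0)"
proof -
  have "filterlim (\<lambda>x. pi * (x - 1/2)) (at_right (- (pi/2))) (at_right 0)"
    unfolding filterlim_at
  proof
    show "\<forall>\<^sub>F x in at_right 0. pi * (x - 1/2) \<in> {- (pi/2)<..} \<and> pi * (x - 1/2) \<noteq> - (pi/2)"
      unfolding eventually_at_right_field by (intro exI[of _ 1]) (auto simp: right_diff_distrib)
    have "((\<lambda>x. pi * (x - 1/2)) \<longlongrightarrow> pi * (0 - 1/2)) (at_right 0)" by (intro tendsto_intros)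
    then show "((\<lambda>x. pi * (x - 1/2)) \<longlongrightarrow> - (pi/2)) (at_right 0)" by simp
  qed
  from filterlim_compose[OF filterlim_tan_at_right this] show ?thesis by (simp add: \<tau>_def[abs_def])
qed

lemma filterlim_\<tau>_at_left_1: "filterlim \<tau> at_top (at_left 1)"
proof -
  have "filterlim (\<lambda>x. pi * (x - 1/2)) (at_left (pi/2)) (at_left 1)"
    unfolding filterlim_at
  proof
    show "\<forall>\<^sub>F x in at_left 1. pi * (x - 1/2) \<in> {..<pi/2} \<and> pi * (x - 1/2) \<noteq> pi/2"
      unfolding eventually_at_left_field by (intro exI[of _ 0]) (auto simp: right_diff_distrib)
    have "((\<lambda>x. pi * (x - 1/2)) \<longlongrightarrow> pi * (1 - 1/2)) (at_left 1)" by (intro tendsto_intros)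
    then show "((\<lambda>x. pi * (x - 1/2)) \<longlongrightarrow> pi/2) (at_left 1)" by simp
  qed
  from filterlim_compose[OF filterlim_tan_at_left this] show ?thesis by (simp add: \<tau>_def[abs_def])
qed

lemma tendsto_\<sigma>_at_top: "(\<sigma> \<longlongrightarrow> 1) at_top"
proof -
  have "((\<lambda>t. 1/2 + arctan t / pi) \<longlongrightarrow> 1/2 + (pi/2) / pi) at_top"
    by (intro tendsto_intros tendsto_arctan_at_top) simp
  then show ?thesis by (simp add: \<sigma>_def[abs_def])
qed

lemma tendsto_\<sigma>_at_bot: "(\<sigma> \<longlongrightarrow> 0) at_bot"
proof -
  have "((\<lambda>t. 1/2 + arctan t / pi) \<longlongrightarrow> 1/2 + (- (pi/2)) / pi) at_bot"
    by (intro tendsto_intros tendsto_arctan_at_bot) simp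
  then show ?thesis by (simp add: \<sigma>_def[abs_def])
qed

definition interval_map :: "(real \<Rightarrow> real) \<Rightarrow> real \<Rightarrow> real" where
  "interval_map \<phi> = restrict (\<lambda>x. if 0 < x \<and> x < 1 then \<sigma> (\<phi> (\<tau> x)) else x) {0..1}"

lemma interval_map_interior: "0 < x \<Longrightarrow> x < 1 \<Longrightarrow> interval_map \<phi> x = \<sigma> (\<phi> (\<tau> x))"
  by (simp add: interval_map_def)

lemma interval_map_\<sigma>: "interval_map \<phi> (\<sigma> t) = \<sigma> (\<phi> t)"
  by (simp add: interval_map_interior \<sigma>_range)

lemma interval_map_boundary: "interval_map \<phi> 0 = 0" "interval_map \<phi> 1 = 1"
  by (simp_all add: interval_map_def)

lemma interval_map_range: "0 < x \<Longrightarrow> x < 1 \<Longrightarrow> 0 < interval_map \<phi> x \<and> interval_map \<phi> x < 1"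
  by (simp add: interval_map_interior \<sigma>_range)

lemma compose_interval_map: "compose {0..1} (interval_map \<phi>) (interval_map \<psi>) = interval_map (\<lambda>t. \<phi> (\<psi> t))"
proof
  fix x :: real
  consider "0 < x" "x < 1" | "x = 0" | "x = 1" | "x \<notin> {0..1}" by fastforce
  then show "compose {0..1} (interval_map \<phi>) (interval_map \<psi>) x = interval_map (\<lambda>t. \<phi> (\<psi> t)) x"
  proof cases
    case 1
    then show ?thesis by (simp add: compose_def interval_map_interior[OF 1] interval_map_\<sigma>)
  qed (auto simp: compose_def interval_map_boundary interval_map_def)
qed

lemma interval_map_id: "interval_map (\<lambda>t. t) = restrict (\<lambda>x. x) {0..1}"
  by (auto simp: interval_map_def \<sigma>_\<tau>)

lemma eventually_interior_right: "\<forall>\<^sub>F x in at_right 0. 0 < x \<and> x < (1::real)"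
  unfolding eventually_at_right_field by (intro exI[of _ 1]) auto

lemma eventually_interior_left: "\<forall>\<^sub>F x in at_left 1. 0 < x \<and> x < (1::real)"
  unfolding eventually_at_left_field by (intro exI[of _ 0]) auto

lemma DERIV_interval_map:
  assumes x: "0 < x" "x < 1" and \<phi>: "(\<phi> has_real_derivative d) (at (\<tau> x))"
  shows "(interval_map \<phi> has_real_derivative d * ((1 + (\<tau> x)\<^sup>2) / (1 + (\<phi> (\<tau> x))\<^sup>2))) (at x)"
proof -
  have "((\<lambda>x. \<sigma> (\<phi> (\<tau> x))) has_real_derivative
      1 / (pi * (1 + (\<phi> (\<tau> x))\<^sup>2)) * (d * (pi * (1 + (\<tau> x)\<^sup>2)))) (at x)"
    by (intro DERIV_chain2[OF DERIV_\<sigma>] DERIV_chain2[where g = \<tau>, OF \<phi>] DERIV_\<tau> x)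
  then have "(interval_map \<phi> has_real_derivative
      1 / (pi * (1 + (\<phi> (\<tau> x))\<^sup>2)) * (d * (pi * (1 + (\<tau> x)\<^sup>2)))) (at x)"
    by (rule has_field_derivative_transform_within_open[of _ _ _ "{0<..<1}"])
       (use x in \<open>auto simp: interval_map_interior\<close>)
  then show ?thesis by simp
qed

text \<open>Conditions under which a diffeomorphism of the line becomes a \<open>C^1\<close>
  diffeomorphism of the closed interval; the last two limits are those of the derivative in the
  interval coordinate. Dilations by \<open>c\<close> have \<open>L = 1 / c\<close>, maps of bounded
  displacement \<open>L = 1\<close>.\<close>

locale line_diffeo =
  fixes \<phi> \<phi>' :: "real \<Rightarrow> real" and L :: real
  assumes deriv: "\<And>t. (\<phi> has_real_derivative \<phi>' t) (at t)"
    and pos: "\<And>t. 0 < \<phi>' t"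
    and cont': "\<And>t. isCont \<phi>' t"
    and L: "0 < L"
    and top: "filterlim \<phi> at_top at_top" and bot: "filterlim \<phi> at_bot at_bot"
    and lim_top: "((\<lambda>t. \<phi>' t * ((1 + t\<^sup>2) / (1 + (\<phi> t)\<^sup>2))) \<longlongrightarrow> L) at_top"
    and lim_bot: "((\<lambda>t. \<phi>' t * ((1 + t\<^sup>2) / (1 + (\<phi> t)\<^sup>2))) \<longlongrightarrow> L) at_bot"
begin

definition D :: "real \<Rightarrow> real" where
  "D x = (if 0 < x \<and> x < 1 then \<phi>' (\<tau> x) * ((1 + (\<tau> x)\<^sup>2) / (1 + (\<phi> (\<tau> x))\<^sup>2)) else L)"

lemma isCont_\<tau>: "0 < x \<Longrightarrow> x < 1 \<Longrightarrow> isCont \<tau> x"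
  using DERIV_\<tau> DERIV_isCont by blast

lemma cont_D: "continuous_on {0..1} D"
proof (rule continuous_on_IccI)
  let ?R = "\<lambda>t. \<phi>' t * ((1 + t\<^sup>2) / (1 + (\<phi> t)\<^sup>2))"
  have ev: "\<forall>\<^sub>F x in at_right 0. ?R (\<tau> x) = D x" "\<forall>\<^sub>F x in at_left 1. ?R (\<tau> x) = D x"
    using eventually_interior_right eventually_interior_left
    by (auto elim!: eventually_mono simp: D_def)
  have "((\<lambda>x. ?R (\<tau> x)) \<longlongrightarrow> L) (at_right 0)" "((\<lambda>x. ?R (\<tau> x)) \<longlongrightarrow> L) (at_left 1)"
    using filterlim_compose[OF lim_bot filterlim_\<tau>_at_right_0]
      filterlim_compose[OF lim_top filterlim_\<tau>_at_left_1] by auto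
  then show "(D \<longlongrightarrow> D 0) (at_right 0)" "(D \<longlongrightarrow> D 1) (at_left 1)"
    using ev tendsto_cong by (force simp: D_def[of 0] D_def[of 1])+
next
  fix x :: real assume x: "0 < x" "x < 1"
  have c: "isCont \<phi> t" for t using deriv DERIV_isCont by blast
  have R: "isCont (\<lambda>t. \<phi>' t * ((1 + t\<^sup>2) / (1 + (\<phi> t)\<^sup>2))) t" for t
    using one_plus_sq_pos[of "\<phi> t"] c cont' by (intro continuous_intros) auto
  have "isCont (\<lambda>x. \<phi>' (\<tau> x) * ((1 + (\<tau> x)\<^sup>2) / (1 + (\<phi> (\<tau> x))\<^sup>2))) x"
    using isCont_o2[OF isCont_\<tau>[OF x] R] .
  moreover have "\<forall>\<^sub>F y in nhds x. \<phi>' (\<tau> y) * ((1 + (\<tau> y)\<^sup>2) / (1 + (\<phi> (\<tau> y))\<^sup>2)) = D y"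
    unfolding eventually_nhds using x by (intro exI[of _ "{0<..<1}"]) (auto simp: D_def)
  ultimately have "isCont D x" using isCont_cong by fast
  then show "D \<midarrow>x\<rightarrow> D x" by (simp add: isCont_def)
qed simp

lemma deriv_interval_map: "0 < x \<Longrightarrow> x < 1 \<Longrightarrow> (interval_map \<phi> has_real_derivative D x) (at x)"
  using DERIV_interval_map[OF _ _ deriv] by (simp add: D_def)

lemma cont_interval_map: "continuous_on {0..1} (interval_map \<phi>)"
proof (rule continuous_on_IccI)
  have ev: "\<forall>\<^sub>F x in at_right 0. \<sigma> (\<phi> (\<tau> x)) = interval_map \<phi> x" "\<forall>\<^sub>F x in at_left 1. \<sigma> (\<phi> (\<tau> x)) = interval_map \<phi> x"
    using eventually_interior_right eventually_interior_left
    by (auto elim!: eventually_mono simp: interval_map_interior)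
  have "((\<lambda>x. \<sigma> (\<phi> (\<tau> x))) \<longlongrightarrow> 0) (at_right 0)"
    by (rule filterlim_compose[OF tendsto_\<sigma>_at_bot filterlim_compose[OF bot filterlim_\<tau>_at_right_0]])
  moreover have "((\<lambda>x. \<sigma> (\<phi> (\<tau> x))) \<longlongrightarrow> 1) (at_left 1)"
    by (rule filterlim_compose[OF tendsto_\<sigma>_at_top filterlim_compose[OF top filterlim_\<tau>_at_left_1]])
  ultimately show "(interval_map \<phi> \<longlongrightarrow> interval_map \<phi> 0) (at_right 0)" "(interval_map \<phi> \<longlongrightarrow> interval_map \<phi> 1) (at_left 1)"
    using ev tendsto_cong by (force simp: interval_map_boundary)+
next
  fix x :: real assume "0 < x" "x < 1"
  then have "isCont (interval_map \<phi>) x" using deriv_interval_map DERIV_isCont by blast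
  then show "interval_map \<phi> \<midarrow>x\<rightarrow> interval_map \<phi> x" by (simp add: isCont_def)
qed simp

sublocale interval_map: interval_diffeo "interval_map \<phi>" D
proof
  show "interval_map \<phi> \<in> extensional {0..1}" by (simp add: interval_map_def)
  show "0 < D x" for x using pos L one_plus_sq_pos by (simp add: D_def)
  show "(interval_map \<phi> has_real_derivative D x) (at x within {0..1})" if "x \<in> {0..1}" for x
    by (rule derivative_up_to_boundary[OF cont_interval_map cont_D deriv_interval_map that])
qed (simp_all add: interval_map_boundary)

lemma interval_map_in_Diff_1: "interval_map \<phi> \<in> Diff_plus_carrier 1"
proof (rule interval_map.in_Diff_plus_carrier)
  have "Ck_on 1 (interval_map \<phi>) {0..1}"
    unfolding One_nat_def Ck_on.simps using interval_map.deriv cont_D by blast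
  moreover have "Ck_on 0 (interval_map \<phi>) {0..1}" using cont_interval_map by simp
  moreover have "k = 0 \<or> k = 1" if "enat k \<le> 1" for k using that by (auto simp: one_enat_def)
  ultimately show "Ck_on k (interval_map \<phi>) {0..1}" if "enat k \<le> 1" for k using that by metis
qed simp

end

text \<open>The ratio of the weights differs from 1 by
  \<open>(t - \<phi> t) * (t + \<phi> t)\<close> over \<open>1 + (\<phi> t)^2\<close>: linear growth
  against a denominator comparable to \<open>1 + t^2\<close>. The ratio tends to 1, and the limit of
  \<open>\<phi>'\<close> decides.\<close>

lemma bounded_displacement_line_diffeo:
  assumes deriv: "\<And>t. (\<phi> has_real_derivative \<phi>' t) (at t)"
    and pos: "\<And>t. 0 < \<phi>' t" and cont: "\<And>t. isCont \<phi>' t"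
    and disp: "\<And>t. \<bar>\<phi> t - t\<bar> \<le> M"
    and lim: "(\<phi>' \<longlongrightarrow> 1) at_top" "(\<phi>' \<longlongrightarrow> 1) at_bot"
  shows "line_diffeo \<phi> \<phi>' 1"
proof
  have M: "M \<ge> 0" using disp[of 0] by simp
  show "filterlim \<phi> at_top at_top"
  proof (rule filterlim_at_top_mono)
    show "filterlim (\<lambda>t. t - M) at_top at_top" by real_asymp
    show "\<forall>\<^sub>F t in at_top. t - M \<le> \<phi> t" using disp by (intro always_eventually) (auto simp: abs_le_iff algebra_simps)
  qed
  show "filterlim \<phi> at_bot at_bot"
  proof (rule filterlim_at_bot_mono)
    show "filterlim (\<lambda>t. t + M) at_bot at_bot" by real_asymp
    show "\<forall>\<^sub>F t in at_bot. \<phi> t \<le> t + M" using disp by (intro always_eventually) (auto simp: abs_le_iff algebra_simps)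
  qed
  let ?h = "\<lambda>t. M * (2 * \<bar>t\<bar> + M) * (1 + M)\<^sup>2 / (1 + t\<^sup>2)"
  have bound: "norm ((1 + t\<^sup>2) / (1 + (\<phi> t)\<^sup>2) - 1) \<le> ?h t" for t
  proof -
    have "(1 + t\<^sup>2) / (1 + (\<phi> t)\<^sup>2) - 1 = (t - \<phi> t) * (t + \<phi> t) * (1 / (1 + (\<phi> t)\<^sup>2))"
      using one_plus_sq_pos[of "\<phi> t"] by (simp add: field_simps power2_eq_square)
    then have "norm ((1 + t\<^sup>2) / (1 + (\<phi> t)\<^sup>2) - 1) = \<bar>t - \<phi> t\<bar> * \<bar>t + \<phi> t\<bar> * (1 / (1 + (\<phi> t)\<^sup>2))"
      using one_plus_sq_pos[of "\<phi> t"] by (simp add: abs_mult)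
    also have "\<dots> \<le> M * (2 * \<bar>t\<bar> + M) * ((1 + M)\<^sup>2 / (1 + t\<^sup>2))"
    proof (intro mult_mono)
      show "\<bar>t - \<phi> t\<bar> \<le> M" "\<bar>t + \<phi> t\<bar> \<le> 2 * \<bar>t\<bar> + M" using disp[of t] by auto
      show "1 / (1 + (\<phi> t)\<^sup>2) \<le> (1 + M)\<^sup>2 / (1 + t\<^sup>2)"
        using one_plus_sq_ratio_le[of t "\<phi> t" M] disp[of t] one_plus_sq_pos[of t] one_plus_sq_pos[of "\<phi> t"]
        by (simp add: field_simps abs_minus_commute)
    qed (use M in auto)
    finally show ?thesis by simp
  qed
  have h: "(?h \<longlongrightarrow> 0) at_top" "(?h \<longlongrightarrow> 0) at_bot"
    by real_asymp+
  have "((\<lambda>t. (1 + t\<^sup>2) / (1 + (\<phi> t)\<^sup>2) - 1) \<longlongrightarrow> 0) at_top" "((\<lambda>t. (1 + t\<^sup>2) / (1 + (\<phi> t)\<^sup>2) - 1) \<longlongrightarrow> 0) at_bot"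
    by (rule Lim_null_comparison[OF always_eventually h(1)]; use bound in blast)
      (rule Lim_null_comparison[OF always_eventually h(2)]; use bound in blast)
  then have r: "((\<lambda>t. (1 + t\<^sup>2) / (1 + (\<phi> t)\<^sup>2)) \<longlongrightarrow> 1) at_top" "((\<lambda>t. (1 + t\<^sup>2) / (1 + (\<phi> t)\<^sup>2)) \<longlongrightarrow> 1) at_bot"
    by (simp_all add: LIM_zero_iff)
  show "((\<lambda>t. \<phi>' t * ((1 + t\<^sup>2) / (1 + (\<phi> t)\<^sup>2))) \<longlongrightarrow> 1) at_top"
    "((\<lambda>t. \<phi>' t * ((1 + t\<^sup>2) / (1 + (\<phi> t)\<^sup>2))) \<longlongrightarrow> 1) at_bot"
    using tendsto_mult[OF lim(1) r(1)] tendsto_mult[OF lim(2) r(2)] by simp_all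
qed (use deriv pos cont in auto)

lemma line_diffeo_shift: "line_diffeo (\<lambda>t. t + c) (\<lambda>_. 1) 1"
  by (rule bounded_displacement_line_diffeo[of _ _ "\<bar>c\<bar>"]) (auto intro!: derivative_eq_intros)

lemma line_diffeo_scale:
  assumes "c > 0"
  shows "line_diffeo (\<lambda>t. c * t) (\<lambda>_. c) (1 / c)"
proof
  show "((\<lambda>t. c * ((1 + t\<^sup>2) / (1 + (c * t)\<^sup>2))) \<longlongrightarrow> 1 / c) at_top"
    "((\<lambda>t. c * ((1 + t\<^sup>2) / (1 + (c * t)\<^sup>2))) \<longlongrightarrow> 1 / c) at_bot"
    "filterlim (\<lambda>t. c * t) at_top at_top" "filterlim (\<lambda>t. c * t) at_bot at_bot"
    using assms by (real_asymp simp: power2_eq_square field_simps)+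
qed (use assms in \<open>auto intro!: derivative_eq_intros\<close>)

text \<open>In each cell the derivative is squeezed between bounds that depend on the coefficient
  alone and tend to 1 with it. Any rate of decay will do, in particular the logarithmic one of
  \<open>slow\<close>.\<close>

lemma line_diffeo_P:
  assumes "((\<lambda>t::real. a \<lfloor>t/4\<rfloor>) \<longlongrightarrow> 0) at_top" "((\<lambda>t::real. a \<lfloor>t/4\<rfloor>) \<longlongrightarrow> 0) at_bot"
  shows "line_diffeo (P a) (P' a) 1"
proof (rule bounded_displacement_line_diffeo[OF DERIV_P P'_pos isCont_P' P_displacement])
  have "(P' a \<longlongrightarrow> 1) F" if "((\<lambda>t::real. a \<lfloor>t/4\<rfloor>) \<longlongrightarrow> 0) F" for F
  proof (rule tendsto_sandwich)
    have "((\<lambda>t. 1 / (1 + \<bar>a \<lfloor>t/4\<rfloor>\<bar>) ^ 3) \<longlongrightarrow> 1 / (1 + \<bar>0\<bar>) ^ 3) F"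
      "((\<lambda>t. (1 + \<bar>a \<lfloor>t/4\<rfloor>\<bar>) ^ 3) \<longlongrightarrow> (1 + \<bar>0\<bar>) ^ 3) F"
      by (intro tendsto_intros that; simp)+
    then show "((\<lambda>t. 1 / (1 + \<bar>a \<lfloor>t/4\<rfloor>\<bar>) ^ 3) \<longlongrightarrow> 1) F" "((\<lambda>t. (1 + \<bar>a \<lfloor>t/4\<rfloor>\<bar>) ^ 3) \<longlongrightarrow> 1) F"
      by simp_all
  qed (simp_all add: P'_def \<kappa>'_ge \<kappa>'_le)
  then show "(P' a \<longlongrightarrow> 1) at_top" "(P' a \<longlongrightarrow> 1) at_bot" using assms by auto
qed

lemma line_diffeo_\<kappa>: "line_diffeo (\<kappa> c) (\<kappa>' c) 1"
proof (rule bounded_displacement_line_diffeo[OF DERIV_\<kappa> \<kappa>'_pos isCont_\<kappa>'])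
  show "\<bar>\<kappa> c t - t\<bar> \<le> 1" for t
    using \<kappa>_unit[of t c] by (cases "0 < t \<and> t < 1") (auto simp: \<kappa>_fix not_less)
  have "\<forall>\<^sub>F t in at_top. \<kappa>' c t = 1" "\<forall>\<^sub>F t in at_bot. \<kappa>' c t = 1"
    by (rule eventually_mono[OF eventually_ge_at_top[of 1]], simp add: \<kappa>'_outside)
      (rule eventually_mono[OF eventually_le_at_bot[of 0]], simp add: \<kappa>'_outside)
  then show "(\<kappa>' c \<longlongrightarrow> 1) at_top" "(\<kappa>' c \<longlongrightarrow> 1) at_bot"
    by (simp_all add: tendsto_eventually)
qed

subsection \<open>Smooth elements\<close>

text \<open>The step from flow to cell is repeated from line to interval: the displacement of
  \<open>\<kappa> c\<close> again decays rapidly with all derivatives.\<close>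

lemma interval_map_\<kappa>_in_Diff_infinity: "interval_map (\<kappa> c) \<in> Diff_plus_carrier \<infinity>"
proof -
  interpret line_diffeo "\<kappa> c" "\<kappa>' c" 1 by (rule line_diffeo_\<kappa>)
  let ?g = "\<lambda>w. \<sigma> (w + (\<kappa> c w - w)) - \<sigma> w"
  have "Ck_on k (interval_map (\<kappa> c)) {0..1}" for k
  proof -
    have "Ck_on k (hat ?g) {0..1}"
      using Dk_imp_Ck_on[OF rd_hat[OF rd_\<sigma>_perturbation[OF rd_\<kappa>]]] .
    then have "Ck_on k (\<lambda>x. x + hat ?g x) {0..1}" by (rule Ck_on_add[OF Ck_on_id])
    moreover have "x + hat ?g x = interval_map (\<kappa> c) x" if "x \<in> {0..1}" for x
      using that by (auto simp: hat_def interval_map_def \<sigma>_\<tau>)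
    ultimately show ?thesis
      using Ck_on_cong[of "{0..1}" "\<lambda>x. x + hat ?g x" "interval_map (\<kappa> c)" k] by simp
  qed
  then show ?thesis by (intro interval_map.in_Diff_plus_carrier) auto
qed

lemma Ck_on_sin_cos: "Ck_on k (\<lambda>x. sin (pi * x)) S \<and> Ck_on k (\<lambda>x. cos (pi * x)) S"
proof (induction k)
  case 0
  show ?case by (auto intro!: continuous_intros)
next
  case (Suc k)
  have "((\<lambda>x. sin (pi * x)) has_real_derivative pi * cos (pi * x)) (at x within S)"
    "((\<lambda>x. cos (pi * x)) has_real_derivative - pi * sin (pi * x)) (at x within S)" for x
    by (auto intro!: derivative_eq_intros)
  moreover have "Ck_on k (\<lambda>x. pi * cos (pi * x)) S" "Ck_on k (\<lambda>x. - pi * sin (pi * x)) S"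
    using Ck_on_mult[OF Ck_on_const] Suc by blast+
  ultimately show ?case
    unfolding Ck_on.simps
    by (intro conjI exI[of _ "\<lambda>x. pi * cos (pi * x)"] exI[of _ "\<lambda>x. - pi * sin (pi * x)"] ballI)
qed

text \<open>A translation is projective. Multiplying both weights by the squared sine turns the
  derivative into the inverse of the trigonometric polynomial \<open>?q\<close>, which is regular at
  the endpoints too.\<close>

lemma interval_map_shift_in_Diff_infinity: "interval_map (\<lambda>t. t + c) \<in> Diff_plus_carrier \<infinity>"
proof -
  interpret line_diffeo "\<lambda>t. t + c" "\<lambda>_. 1" 1 by (rule line_diffeo_shift)
  let ?s = "\<lambda>x. sin (pi * x)" and ?c = "\<lambda>x. cos (pi * x)"
  let ?q = "\<lambda>x. ?s x * ?s x + (c * ?s x + (-1) * ?c x) * (c * ?s x + (-1) * ?c x)"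
  \<comment> \<open>A sum of two squares: a zero would force the sine and then the cosine to
    vanish.\<close>
  have q: "?q x \<noteq> 0" for x
    using sin_cos_squared_add[of "pi * x"] by (auto simp: sum_squares_eq_zero_iff power2_eq_square)
  have D: "inverse (?q x) = D x" if x: "x \<in> {0..1}" for x
  proof -
    consider "0 < x" "x < 1" | "x = 0" | "x = 1" using x by fastforce
    then show ?thesis
    proof cases
      case 1
      have s: "?s x > 0" using 1 by (intro sin_gt_zero) (auto simp: field_simps)
      have "\<tau> x = - ?c x / ?s x"
        by (simp add: \<tau>_def tan_def right_diff_distrib sin_diff cos_diff)
      then have e: "\<tau> x + c = (c * ?s x + (-1) * ?c x) / ?s x" using s by (simp add: field_simps)
      have "1 + (\<tau> x + c)\<^sup>2 = ?q x / (?s x)\<^sup>2"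
        unfolding e using s by (simp add: field_simps power2_eq_square)
      then show ?thesis
        using 1 s one_plus_sq_pos[of "\<tau> x + c"] by (simp add: D_def one_plus_\<tau>_sq[OF 1] inverse_eq_divide)
    qed (simp_all add: D_def)
  qed
  have "Ck_on k ?q {0..1}" for k
    using Ck_on_sin_cos by (intro Ck_on_add Ck_on_mult Ck_on_const) blast+
  then have "Ck_on k (\<lambda>x. inverse (?q x)) {0..1}" for k
    using q by (intro Ck_on_inverse)
  then have "Ck_on k D {0..1}" for k
    using Ck_on_cong[of "{0..1}" "\<lambda>x. inverse (?q x)" D k] D by blast
  then have "Ck_on (Suc k) (interval_map (\<lambda>t. t + c)) {0..1}" for k
    unfolding Ck_on.simps using interval_map.deriv by blast
  then have "Ck_on k (interval_map (\<lambda>t. t + c)) {0..1}" for k using Ck_on_Suc_imp by blast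
  then show ?thesis by (intro interval_map.in_Diff_plus_carrier) auto
qed

subsection \<open>Group structure\<close>

lemma mult_interval_map:
  assumes "interval_map \<phi> \<in> Diff_plus_carrier r" "interval_map \<psi> \<in> Diff_plus_carrier r"
  shows "interval_map \<phi> \<otimes>\<^bsub>Diff_plus r\<^esub> interval_map \<psi> = interval_map (\<lambda>t. \<phi> (\<psi> t))"
  using mult_Diff_plus[OF assms] by (simp add: compose_interval_map)

lemma inv_Diff_plus:
  assumes "f \<in> Diff_plus_carrier r"
  shows "inv\<^bsub>Diff_plus r\<^esub> f = restrict (inv_into {0..1} f) {0..1}"
proof -
  have "f \<in> Bij {0..1}" using assms by (auto simp: Diff_plus_carrier_def)
  then show ?thesis
    unfolding Diff_plus_def
    using group.m_inv_consistent[OF group_BijGroup subgroup_Diff_plus assms] inv_BijGroup by metis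
qed

text \<open>A right inverse on the line is enough, since the elements of the group are
  injective.\<close>

lemma inv_interval_map:
  assumes \<phi>: "interval_map \<phi> \<in> Diff_plus_carrier r" and \<psi>: "\<And>t. \<phi> (\<psi> t) = t"
  shows "inv\<^bsub>Diff_plus r\<^esub> interval_map \<phi> = interval_map \<psi>"
proof -
  let ?I = "{0..1::real}"
  have inj: "inj_on (interval_map \<phi>) ?I"
    using \<phi> by (auto simp: Diff_plus_carrier_def Bij_def bij_betw_def)
  have "inv\<^bsub>Diff_plus r\<^esub> interval_map \<phi> = restrict (inv_into ?I (interval_map \<phi>)) ?I"
    using \<phi> by (rule inv_Diff_plus)
  also have "\<dots> = interval_map \<psi>"
  proof
    fix x
    have "inv_into ?I (interval_map \<phi>) x = interval_map \<psi> x" if x: "x \<in> ?I"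
    proof (rule inv_into_f_eq[OF inj])
      consider "0 < x" "x < 1" | "x = 0" | "x = 1" using x by fastforce
      then have "interval_map \<psi> x \<in> ?I \<and> interval_map \<phi> (interval_map \<psi> x) = x"
      proof cases
        case 1
        then show ?thesis
          using interval_map_range[OF 1, of \<psi>] by (simp add: interval_map_interior[OF 1] interval_map_\<sigma> \<psi> \<sigma>_\<tau>)
      qed (auto simp: interval_map_boundary)
      then show "interval_map \<psi> x \<in> ?I" "interval_map \<phi> (interval_map \<psi> x) = x" by auto
    qed
    then show "restrict (inv_into ?I (interval_map \<phi>)) ?I x = interval_map \<psi> x" by (auto simp: interval_map_def)
  qed
  finally show ?thesis .
qed

section \<open>Distortion in class \<open>C\<^sup>1\<close>\<close>

subsection \<open>A translation supported on a half-line\<close>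

text \<open>The cubic Hermite step, with slope 0 at both ends. Class \<open>C^1\<close> suffices, as
  it enters only a generator of the \<open>C^1\<close> group.\<close>

definition step :: "real \<Rightarrow> real" where
  "step u = (if u \<le> 0 then 0 else if 1 \<le> u then 1 else 3 * u\<^sup>2 - 2 * u ^ 3)"

definition step' :: "real \<Rightarrow> real" where
  "step' u = 6 * (max 0 (min 1 u) * (1 - max 0 (min 1 u)))"

lemma step_bounds: "0 \<le> step u" "step u \<le> 1" "step u \<le> 3 * u\<^sup>2"
proof -
  have mid: "3 * u\<^sup>2 - 2 * u ^ 3 = u\<^sup>2 * (3 - 2 * u)" "1 - (3 * u\<^sup>2 - 2 * u ^ 3) = (1 - u)\<^sup>2 * (1 + 2 * u)"
    by (simp_all add: power2_eq_square power3_eq_cube algebra_simps)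
  show "0 \<le> step u" unfolding step_def mid(1) by auto
  show "step u \<le> 1"
  proof (cases "0 < u \<and> u < 1")
    case True
    then have "0 \<le> 1 - (3 * u\<^sup>2 - 2 * u ^ 3)" unfolding mid(2) by auto
    then show ?thesis using True by (simp add: step_def)
  qed (auto simp: step_def)
  show "step u \<le> 3 * u\<^sup>2"
  proof (cases "1 \<le> u")
    case True
    then have "1 \<le> u\<^sup>2" by (rule one_le_power)
    moreover have "step u = 1" using True by (simp add: step_def)
    ultimately show ?thesis by linarith
  qed (auto simp: step_def)
qed

lemma step_symmetric: "step u - 1 = - step (1 - u)"
  by (simp add: step_def power2_eq_square power3_eq_cube algebra_simps)

lemma DERIV_step: "(step has_real_derivative step' u) (at u)"
proof -
  consider "u < 0" | "u = 0" | "0 < u" "u < 1" | "u = 1" | "1 < u" by linarith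
  then show ?thesis
  proof cases
    case 1
    have "((\<lambda>_. 0) has_real_derivative 0) (at u)" by simp
    then have "(step has_real_derivative 0) (at u)"
      by (rule has_field_derivative_transform_within_open[of _ _ _ "{..<0}"])
         (use 1 in \<open>auto simp: step_def\<close>)
    then show ?thesis using 1 by (simp add: step'_def)
  next
    case 2
    have "\<bar>step u\<bar> \<le> 3 * (u - 0)\<^sup>2" for u using step_bounds[of u] by simp
    from DERIV_zero_of_quadratic[OF this] show ?thesis using 2 by (simp add: step'_def)
  next
    case 3
    have "((\<lambda>u. 3 * u\<^sup>2 - 2 * u ^ 3) has_real_derivative 6 * u - 6 * u\<^sup>2) (at u)"
      by (auto intro!: derivative_eq_intros)
    then have "(step has_real_derivative 6 * u - 6 * u\<^sup>2) (at u)"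
      by (rule has_field_derivative_transform_within_open[of _ _ _ "{0<..<1}"])
         (use 3 in \<open>auto simp: step_def\<close>)
    then show ?thesis using 3 by (simp add: step'_def power2_eq_square algebra_simps)
  next
    case 4
    have "\<bar>step u - 1\<bar> \<le> 3 * (u - 1)\<^sup>2" for u
      using step_bounds[of "1 - u"] by (simp add: step_symmetric power2_commute)
    from DERIV_zero_of_quadratic[OF this]
    have "((\<lambda>u. step u - 1 + 1) has_real_derivative 0 + 0) (at 1)"
      by (intro DERIV_add DERIV_const)
    then show ?thesis using 4 by (simp add: step'_def)
  next
    case 5
    have "((\<lambda>_. 1) has_real_derivative 0) (at u)" by simp
    then have "(step has_real_derivative 0) (at u)"
      by (rule has_field_derivative_transform_within_open[of _ _ _ "{1<..}"])
         (use 5 in \<open>auto simp: step_def\<close>)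
    then show ?thesis using 5 by (simp add: step'_def)
  qed
qed

text \<open>The transition takes place on \<open>[-3, -2]\<close>, between the support
  \<open>[-4, -3]\<close> of cell \<open>-1\<close> and the support \<open>[0, 1]\<close> of cell
  \<open>0\<close>.\<close>

definition W :: "real \<Rightarrow> real" where "W t = t + step (t + 3)"

lemma line_diffeo_W: "line_diffeo W (\<lambda>t. 1 + step' (t + 3)) 1"
proof (rule bounded_displacement_line_diffeo)
  show "(W has_real_derivative 1 + step' (t + 3)) (at t)" for t
  proof -
    have "((\<lambda>t. t + 3) has_real_derivative 1) (at t)" by (auto intro!: derivative_eq_intros)
    from DERIV_chain2[OF DERIV_step this] show ?thesis
      unfolding W_def[abs_def] by (intro DERIV_add DERIV_ident) simp
  qed
  have "0 \<le> step' u" for u by (simp add: step'_def)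
  then show "0 < 1 + step' (t + 3)" for t by (smt (verit))
  show "isCont (\<lambda>t. 1 + step' (t + 3)) t" for t
    unfolding step'_def by (intro continuous_intros)
  show "\<bar>W t - t\<bar> \<le> 1" for t using step_bounds[of "t + 3"] by (simp add: W_def)
  have "\<forall>\<^sub>F t in at_top. 1 + step' (t + 3) = 1" "\<forall>\<^sub>F t in at_bot. 1 + step' (t + 3) = 1"
    by (rule eventually_mono[OF eventually_ge_at_top[of 0]], simp add: step'_def)
      (rule eventually_mono[OF eventually_le_at_bot[of "-3"]], simp add: step'_def)
  then show "((\<lambda>t. 1 + step' (t + 3)) \<longlongrightarrow> 1) at_top" "((\<lambda>t. 1 + step' (t + 3)) \<longlongrightarrow> 1) at_bot"
    by (simp_all add: tendsto_eventually)
qed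

lemma W_strict_mono: "s < t \<Longrightarrow> W s < W t"
  using DERIV_pos_imp_increasing[of s t W] line_diffeo.deriv[OF line_diffeo_W]
    line_diffeo.pos[OF line_diffeo_W] by metis

lemma W_left: "t \<le> -3 \<Longrightarrow> W t = t" and W_right: "-2 \<le> t \<Longrightarrow> W t = t + 1"
  by (simp_all add: W_def step_def)

lemma bij_W: "bij W"
proof (rule bijI)
  show "inj W" using W_strict_mono by (metis injI less_irrefl linorder_neqE)
  show "surj W"
    unfolding surj_def
  proof
    fix s
    have "W (s - 1) \<le> s" "s \<le> W s" using step_bounds by (simp_all add: W_def)
    moreover have "continuous_on {s - 1..s} W"
      using line_diffeo.deriv[OF line_diffeo_W] DERIV_isCont continuous_at_imp_continuous_on by blast
    ultimately show "\<exists>t. s = W t" using IVT'[of W "s - 1" s s] by auto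
  qed
qed

definition W_inv :: "real \<Rightarrow> real" where "W_inv = inv_into UNIV W"

lemma inv_W: "W (W_inv t) = t" "W_inv (W t) = t"
  using bij_W by (simp_all add: W_inv_def bij_is_surj surj_f_inv_f bij_is_inj)

lemma inv_W_strict_mono: "s < t \<Longrightarrow> W_inv s < W_inv t"
  using W_strict_mono inv_W(1) by (metis less_asym linorder_neqE)

lemma inv_W_left: "t \<le> -3 \<Longrightarrow> W_inv t = t" and inv_W_right: "-1 \<le> t \<Longrightarrow> W_inv t = t - 1"
  using inv_W(2)[of t] inv_W(2)[of "t - 1"] by (simp_all add: W_left W_right)

text \<open>A translation by \<open>1\<close> on the cells \<open>0, \<dots>, N - 1\<close> that does not move the supports
  \<open>[4 i, 4 i + 1]\<close> in the other cells.\<close>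

definition cutoff :: "nat \<Rightarrow> real \<Rightarrow> real" where
  "cutoff N t = W (W_inv (t - 4 * real N) + 4 * real N)"

text \<open>\<open>cutoff N\<close> is the commutator of \<open>W\<close> with the translation by
  \<open>4 N\<close>, hence a short word; exchanging the two maps in the commutator inverts
  it.\<close>

definition cutoff_inv :: "nat \<Rightarrow> real \<Rightarrow> real" where
  "cutoff_inv N t = W (W_inv t - 4 * real N) + 4 * real N"

lemma cutoff_cutoff_inv: "cutoff N (cutoff_inv N t) = t"
  by (simp add: cutoff_def cutoff_inv_def inv_W)

lemma cutoff_mono: "s \<le> t \<Longrightarrow> cutoff N s \<le> cutoff N t"
  using inv_W_strict_mono W_strict_mono unfolding cutoff_def
  by (metis add_less_cancel_right diff_strict_right_mono less_eq_real_def)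

lemma cutoff_left: "t \<le> -3 \<Longrightarrow> cutoff N t = t"
  by (simp add: cutoff_def inv_W_left W_left)

lemma cutoff_middle: "-2 \<le> t \<Longrightarrow> t \<le> 4 * real N - 3 \<Longrightarrow> cutoff N t = t + 1"
  by (simp add: cutoff_def inv_W_left W_right)

lemma cutoff_right: "4 * real N - 1 \<le> t \<Longrightarrow> cutoff N t = t"
  by (simp add: cutoff_def inv_W_right W_right)

subsection \<open>Cutting lattice diffeomorphisms by commutators\<close>

lemma P_fix_inside:
  fixes t :: real
  assumes "\<And>i. 0 \<le> i \<Longrightarrow> i < int N \<Longrightarrow> b i = 0" "-3 \<le> t" "t \<le> 4 * real N"
  shows "P b t = t"
\<comment> \<open>The right end already belongs to cell \<open>N\<close>, where \<open>b\<close> is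
  unrestricted; it is fixed as the left end of the support there.\<close>
proof (cases "t = 4 * real N")
  case True
  then show ?thesis using cell_neighbourhood(1)[of "int N" t b] by (simp add: \<kappa>_fix)
next
  case False
  show ?thesis
  proof (rule cell_cases[of t])
    fix i :: int assume t: "4 * of_int i \<le> t" "t < 4 * of_int i + 4"
    then have "real_of_int i < real_of_int (int N)" "real_of_int (-2) < real_of_int i"
      using assms False by auto
    then have i: "i < int N" "-2 < i" by (simp_all only: of_int_less_iff)
    show ?thesis
    proof (cases "i = -1")
      case True
      then show ?thesis using P_cell_range(4)[OF t, of b] assms(2) by simp
    next
      case False
      then show ?thesis using P_cell_range(5)[OF t, of b] assms(1)[of i] i by simp
    qed
  qed
qed

lemma P_fix_outside:
  fixes t :: real
  assumes "\<And>i. \<not> (0 \<le> i \<and> i < int N) \<Longrightarrow> a i = 0" "t \<le> 0 \<or> 4 * real N - 3 \<le> t"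
  shows "P a t = t"
proof (cases "t = 0")
  case True
  then show ?thesis using cell_neighbourhood(1)[of 0 t a] by (simp add: \<kappa>_fix)
next
  case False
  show ?thesis
  proof (rule cell_cases[of t])
    fix i :: int assume t: "4 * of_int i \<le> t" "t < 4 * of_int i + 4"
    show ?thesis
    proof (cases "0 \<le> i \<and> i < int N")
      case True
      then have "real_of_int i \<le> real_of_int (int N - 1)" "real_of_int i \<ge> 0" by linarith+
      then have "4 * of_int i + 1 \<le> t" using assms(2) t False by auto
      then show ?thesis using P_cell_range(4)[OF t, of a] by simp
    next
      case False
      then show ?thesis using P_cell_range(5)[OF t, of a] assms(1) by simp
    qed
  qed
qed

lemma P_mono: "s \<le> t \<Longrightarrow> P a s \<le> P a t"
  using P_strict_mono by (metis less_eq_real_def)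

text \<open>\<open>cutoff N\<close> moves points only inside \<open>[-3, 4 N - 1]\<close>, an
  interval which it preserves and on which \<open>P b\<close> is the identity.\<close>

lemma cutoff_P_outside:
  assumes N: "N > 0" and b: "\<And>i. 0 \<le> i \<Longrightarrow> i < int N \<Longrightarrow> b i = 0"
  shows "cutoff N (P b t) = P b (cutoff N t)"
proof -
  note P_fix = P_fix_inside[of N b, OF b]
  consider "t \<le> -3" | "-3 \<le> t" "t \<le> 4 * real N - 1" | "4 * real N - 1 \<le> t" by linarith
  then show ?thesis
  proof cases
    case 1
    then have "P b t \<le> -3" using P_mono[of t "-3" b] P_fix[of "-3"] by simp
    then show ?thesis using 1 by (simp add: cutoff_left)
  next
    case 2
    then have "-3 \<le> cutoff N t" "cutoff N t \<le> 4 * real N - 1"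
      using cutoff_mono[of "-3" t N] cutoff_mono[of t "4 * real N - 1" N] by (simp_all add: cutoff_left cutoff_right)
    then show ?thesis using 2 P_fix[of t] P_fix[of "cutoff N t"] by simp
  next
    case 3
    moreover have "-3 \<le> 4 * real N - 1" using N by simp
    ultimately have "4 * real N - 1 \<le> P b t"
      using P_mono[of "4 * real N - 1" t b] P_fix[of "4 * real N - 1"] by simp
    then show ?thesis using 3 by (simp add: cutoff_right)
  qed
qed

text \<open>On \<open>[0, 4 N - 3]\<close>, which contains the support of \<open>P a\<close>,
  \<open>cutoff N\<close> is the unit translation. For other points monotonicity keeps
  \<open>cutoff N t - 1\<close> off the support, and both sides equal
  \<open>cutoff N t\<close>.\<close>

lemma cutoff_P_inside:
  assumes N: "N > 0" and a: "\<And>i. \<not> (0 \<le> i \<and> i < int N) \<Longrightarrow> a i = 0"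
  shows "cutoff N (P a t) = P a (cutoff N t - 1) + 1"
proof -
  note P_fix = P_fix_outside[of N a, OF a]
  have N1: "real N \<ge> 1" using N by simp
  consider "t \<le> 0" | "0 \<le> t" "t \<le> 4 * real N - 3" | "4 * real N - 3 \<le> t" by linarith
  then show ?thesis
  proof cases
    case 1
    then have "cutoff N t \<le> 1" using cutoff_mono[of t 0 N] cutoff_middle[of 0 N] N1 by simp
    then show ?thesis using 1 P_fix[of t] P_fix[of "cutoff N t - 1"] by simp
  next
    case 2
    then have "0 \<le> P a t" "P a t \<le> 4 * real N - 3"
      using P_mono[of 0 t a] P_mono[of t "4 * real N - 3" a] P_fix[of 0] P_fix[of "4 * real N - 3"] by auto
    then show ?thesis using 2 by (simp add: cutoff_middle)
  next
    case 3
    then have "4 * real N - 2 \<le> cutoff N t"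
      using cutoff_mono[of "4 * real N - 3" t N] cutoff_middle[of "4 * real N - 3" N] N1 by simp
    then show ?thesis using 3 P_fix[of t] P_fix[of "cutoff N t - 1"] by simp
  qed
qed

definition block :: "nat \<Rightarrow> int \<Rightarrow> real" where
  "block N i = (if 0 \<le> i \<and> i < int N then 1 else 0)"

text \<open>\<open>h\<close> is split into its part \<open>a\<close> on the block and the rest
  \<open>b\<close>. In the commutator with \<open>cutoff N\<close> the \<open>b\<close> part
  commutes and cancels, while the inverse of the \<open>a\<close> part is conjugated by the unit
  translation, as in \<open>Q\<close>.\<close>

lemma commutator_cut:
  assumes N: "N > 0" and h: "\<And>i. 0 \<le> i \<Longrightarrow> i < int N \<Longrightarrow> h i = c"
  shows "P h (cutoff N (P (\<lambda>i. - h i) (cutoff_inv N t))) = Q (\<lambda>i. c * block N i) t"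
proof -
  define a where "a = (\<lambda>i. c * block N i)"
  define b where "b = (\<lambda>i. h i - a i)"
  let ?s = "cutoff_inv N t"
  have a0: "- a i = 0" if "\<not> (0 \<le> i \<and> i < int N)" for i using that by (auto simp: a_def block_def)
  have h_eq: "P h x = P a (P b x)" "P (\<lambda>i. - h i) x = P (\<lambda>i. - b i) (P (\<lambda>i. - a i) x)" for x
    by (simp_all add: P_P b_def)
  have "cutoff N (P (\<lambda>i. - h i) ?s) = P (\<lambda>i. - b i) (cutoff N (P (\<lambda>i. - a i) ?s))"
    unfolding h_eq using N h by (intro cutoff_P_outside) (auto simp: b_def a_def block_def)
  also have "cutoff N (P (\<lambda>i. - a i) ?s) = P (\<lambda>i. - a i) (t - 1) + 1"
    using cutoff_P_inside[of N "\<lambda>i. - a i" ?s, OF N a0] by (simp add: cutoff_cutoff_inv)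
  finally show ?thesis by (simp add: h_eq P_minus Q_def flip: a_def)
qed

subsection \<open>The distorted diffeomorphism\<close>

definition f0 :: "real \<Rightarrow> real" where "f0 t = Q (block 1) (t + 4)"

lemma f0_eq: "f0 t = \<kappa> 1 (\<kappa> (-1) (t + 3) + 1)"
proof -
  have P: "P (\<lambda>i. c * block 1 i) t = \<kappa> c t" for c t
  proof (rule cell_cases[of t])
    fix i :: int assume t: "4 * of_int i \<le> t" "t < 4 * of_int i + 4"
    show ?thesis
    proof (cases "i = 0")
      case True
      then show ?thesis using t cell_neighbourhood(1)[of i t] by (simp add: block_def)
    next
      case False
      then have "i \<le> -1 \<or> 1 \<le> i" by linarith
      then have "real_of_int i \<le> real_of_int (-1) \<or> real_of_int 1 \<le> real_of_int i"
        by (simp only: of_int_le_iff)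
      then have "t \<le> 0 \<or> 1 \<le> t" using t by auto
      then show ?thesis
        using False P_cell_range(5)[OF t, of "\<lambda>i. c * block 1 i"] by (simp add: \<kappa>_fix block_def)
    qed
  qed
  show ?thesis using P[of 1] P[of "-1"] by (simp add: f0_def Q_def add.commute)
qed

text \<open>Conjugation by the translation by 4 moves \<open>block N\<close> to the cells
  \<open>1, ..., N\<close>, and the new factor \<open>block 1\<close> fills cell
  \<open>0\<close>.\<close>

lemma f0_pow: "(f0 ^^ N) t = Q (block N) (t + 4 * real N)"
proof (induction N)
  case 0
  have "block 0 = (\<lambda>_. 0)" by (auto simp: block_def)
  then show ?case by (simp add: Q_zero)
next
  case (Suc N)
  have "(f0 ^^ Suc N) t = Q (block 1) (Q (block N) (t + 4 * real N) + 4 * of_int 1)"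
    by (simp add: Suc f0_def)
  also have "\<dots> = Q (block 1) (Q (\<lambda>i. block N (i - 1)) (t + 4 * real N + 4 * of_int 1))"
    using Q_shift[of "\<lambda>i. block N (i - 1)" "t + 4 * real N" 1] by simp
  also have "\<dots> = Q (block (Suc N)) (t + 4 * real (Suc N))"
    unfolding Q_Q by (rule arg_cong2[of _ _ _ _ Q]) (auto simp: block_def)
  finally show ?case .
qed

lemma interval_map_mult_closed:
  assumes "interval_map \<phi> \<in> Diff_plus_carrier r" "interval_map \<psi> \<in> Diff_plus_carrier r"
  shows "interval_map (\<lambda>t. \<phi> (\<psi> t)) \<in> Diff_plus_carrier r"
  using monoid.m_closed[OF group.is_monoid[OF group_Diff_plus[of r]]] assms mult_interval_map[OF assms]
  by fastforce

lemma f0_in_Diff_infinity: "interval_map f0 \<in> Diff_plus_carrier \<infinity>"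
proof -
  have "f0 = (\<lambda>t. \<kappa> 1 (\<kappa> (-1) (t + 3) + 1))" using f0_eq by blast
  then show ?thesis
    using interval_map_mult_closed[OF interval_map_\<kappa>_in_Diff_infinity[of 1]
        interval_map_mult_closed[OF interval_map_shift_in_Diff_infinity[of 1]
          interval_map_mult_closed[OF interval_map_\<kappa>_in_Diff_infinity[of "-1"]
            interval_map_shift_in_Diff_infinity[of 3]]]]
    by simp
qed

lemma interval_map_pow:
  assumes "interval_map \<phi> \<in> Diff_plus_carrier r"
  shows "interval_map \<phi> [^]\<^bsub>Diff_plus r\<^esub> n = interval_map (\<phi> ^^ n) \<and> interval_map (\<phi> ^^ n) \<in> Diff_plus_carrier r"
proof (induction n)
  case 0
  have "\<one>\<^bsub>Diff_plus r\<^esub> \<in> carrier (Diff_plus r)"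
    using group_Diff_plus group.is_monoid monoid.one_closed by blast
  moreover have "interval_map (\<phi> ^^ 0) = \<one>\<^bsub>Diff_plus r\<^esub>"
    using interval_map_id by (simp add: one_Diff_plus id_def)
  moreover have "interval_map \<phi> [^]\<^bsub>Diff_plus r\<^esub> (0::nat) = \<one>\<^bsub>Diff_plus r\<^esub>" by simp
  ultimately show ?case by (metis carrier_Diff_plus)
next
  case (Suc n)
  have "interval_map (\<phi> ^^ n) \<otimes>\<^bsub>Diff_plus r\<^esub> interval_map \<phi> = interval_map (\<phi> ^^ Suc n)"
    using mult_interval_map Suc assms by (simp add: funpow_Suc_right o_def del: funpow.simps)
  moreover have "interval_map (\<phi> ^^ Suc n) \<in> Diff_plus_carrier r"
    using interval_map_mult_closed[OF assms, of "\<phi> ^^ n"] Suc by (simp add: o_def)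
  moreover have "interval_map \<phi> [^]\<^bsub>Diff_plus r\<^esub> Suc n
      = interval_map (\<phi> ^^ n) \<otimes>\<^bsub>Diff_plus r\<^esub> interval_map \<phi>"
    using Suc by simp
  ultimately show ?case by metis
qed

text \<open>Tending to 0 makes \<open>P slow\<close> of class \<open>C^1\<close>; constancy on
  dyadic blocks provides long runs of equal coefficients, and inverse integers let a power restore
  the coefficient 1.\<close>

definition slow :: "int \<Rightarrow> real" where
  "slow i = (if 1 \<le> i then 1 / (1 + of_int \<lfloor>log 2 (of_int i)\<rfloor>) else 0)"

lemma slow_dyadic:
  assumes "2 ^ j \<le> i" "i < 2 ^ Suc j"
  shows "slow i = 1 / (1 + real j)"
proof -
  have i: "1 \<le> i" using assms(1) one_le_power[of "2::int" j] by linarith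
  have "(2::real) ^ j \<le> of_int i" "of_int i < (2::real) ^ Suc j"
    using assms by (metis of_int_le_iff of_int_numeral of_int_power,
      metis of_int_less_iff of_int_numeral of_int_power)
  then have "real j \<le> log 2 (of_int i)" "log 2 (of_int i) < real (Suc j)"
    using i by (auto simp: le_log_iff log_less_iff powr_realpow simp del: of_nat_Suc power_Suc)
  then have "\<lfloor>log 2 (of_int i)\<rfloor> = int j" by (intro floor_unique) auto
  then show ?thesis using i by (simp add: slow_def)
qed

lemma slow_tendsto: "((\<lambda>t::real. slow \<lfloor>t/4\<rfloor>) \<longlongrightarrow> 0) at_top" "((\<lambda>t::real. slow \<lfloor>t/4\<rfloor>) \<longlongrightarrow> 0) at_bot"
proof -
  show "((\<lambda>t::real. slow \<lfloor>t/4\<rfloor>) \<longlongrightarrow> 0) at_bot"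
  proof (rule tendsto_eventually, rule eventually_mono[OF eventually_le_at_bot[of 0]])
    fix t :: real assume "t \<le> 0"
    then have "\<lfloor>t/4\<rfloor> \<le> 0" by (simp add: floor_le_iff)
    then show "slow \<lfloor>t/4\<rfloor> = 0" by (simp add: slow_def)
  qed
  show "((\<lambda>t::real. slow \<lfloor>t/4\<rfloor>) \<longlongrightarrow> 0) at_top"
  proof (rule Lim_null_comparison)
    show "((\<lambda>t. 1 / log 2 (t/4 - 1)) \<longlongrightarrow> 0) at_top" by real_asymp
    show "\<forall>\<^sub>F t in at_top. norm (slow \<lfloor>t/4\<rfloor>) \<le> 1 / log 2 (t/4 - 1)"
    \<comment> \<open>From 12 on, \<open>t/4 - 1\<close> is at least 2, so the logarithm in the
      denominator is positive.\<close>
    proof (rule eventually_mono[OF eventually_ge_at_top[of 12]])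
      fix t :: real assume t: "t \<ge> 12"
      let ?i = "\<lfloor>t/4\<rfloor>"
      have i: "t/4 - 1 \<le> of_int ?i" "1 \<le> ?i" using t by (linarith, simp add: le_floor_iff)
      have "0 < log 2 (t/4 - 1)" using t by simp
      moreover have "log 2 (t/4 - 1) \<le> log 2 (of_int ?i)" using i t by (subst log_le_cancel_iff) auto
      moreover have "log 2 (of_int ?i) \<le> 1 + of_int \<lfloor>log 2 (of_int ?i)\<rfloor>" by linarith
      ultimately have "1 / (1 + of_int \<lfloor>log 2 (of_int ?i)\<rfloor>) \<le> 1 / log 2 (t/4 - 1)"
        "0 \<le> 1 / (1 + real_of_int \<lfloor>log 2 (of_int ?i)\<rfloor>)"
        by (auto intro!: divide_left_mono)
      then show "norm (slow ?i) \<le> 1 / log 2 (t/4 - 1)" using i by (simp add: slow_def)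
    qed
  qed
qed

section \<open>The generators, and word lengths of maps of the line\<close>

definition gens :: "(real \<Rightarrow> real) set" where
  "gens = interval_map ` {\<lambda>t. t + 1, \<lambda>t. 2 * t, W, P slow, f0}"

lemma gens_carrier: "gens \<subseteq> Diff_plus_carrier 1"
proof -
  have "interval_map (\<lambda>t. t + 1) \<in> Diff_plus_carrier 1" "interval_map (\<lambda>t. 2 * t) \<in> Diff_plus_carrier 1"
    "interval_map W \<in> Diff_plus_carrier 1" "interval_map (P slow) \<in> Diff_plus_carrier 1"
    using line_diffeo.interval_map_in_Diff_1 line_diffeo_shift[of 1] line_diffeo_scale[of 2]
      line_diffeo_W line_diffeo_P[OF slow_tendsto] by auto
  moreover have "interval_map f0 \<in> Diff_plus_carrier 1"
    using f0_in_Diff_infinity Diff_plus_carrier_antimono[of 1 \<infinity>] by auto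
  ultimately show ?thesis by (auto simp: gens_def)
qed

definition rep :: "(real \<Rightarrow> real) \<Rightarrow> nat \<Rightarrow> bool" where
  "rep \<phi> n \<longleftrightarrow> is_word (Diff_plus 1) gens (interval_map \<phi>) n"

context
begin

interpretation G: group "Diff_plus 1" by (rule group_Diff_plus)

lemma rep_carrier: "rep \<phi> n \<Longrightarrow> interval_map \<phi> \<in> Diff_plus_carrier 1"
  unfolding rep_def using G.is_word_closed gens_carrier by auto

lemma rep_gen: "interval_map \<phi> \<in> gens \<Longrightarrow> rep \<phi> 1"
  unfolding rep_def using G.is_word_generator gens_carrier by auto

lemma rep_comp:
  assumes "rep \<phi> m" "rep \<psi> n"
  shows "rep (\<lambda>t. \<phi> (\<psi> t)) (m + n)"
  using G.is_word_mult[of gens "interval_map \<phi>" m "interval_map \<psi>" n] gens_carrier assms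
    mult_interval_map[OF rep_carrier[OF assms(1)] rep_carrier[OF assms(2)]]
  by (simp add: rep_def)

lemma rep_inv:
  assumes "rep \<phi> n" "\<And>t. \<phi> (\<psi> t) = t"
  shows "rep \<psi> n"
  using G.is_word_inv[of gens "interval_map \<phi>" n] gens_carrier assms
    inv_interval_map[OF rep_carrier[OF assms(1)] assms(2)]
  by (simp add: rep_def)

lemma rep_pow:
  assumes "rep \<phi> n"
  shows "rep (\<phi> ^^ k) (k * n)"
  using G.is_word_pow[of gens "interval_map \<phi>" n k] gens_carrier assms
    interval_map_pow[OF rep_carrier[OF assms(1)], of k]
  by (simp add: rep_def)

lemma rep_scale: "rep (\<lambda>t. 2 ^ j * t) j"
proof -
  have "((\<lambda>t::real. 2 * t) ^^ j) = (\<lambda>t. 2 ^ j * t)"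
    by (induction j) (auto simp: fun_eq_iff)
  moreover have "rep (\<lambda>t. 2 * t) 1" by (rule rep_gen) (simp add: gens_def)
  ultimately show ?thesis using rep_pow[of "\<lambda>t. 2 * t" 1 j] by simp
qed

text \<open>Translations are exponentially distorted, being conjugate to their powers by dilations.\<close>

lemma rep_shift: "rep (\<lambda>t. t + 2 ^ j) (2 * j + 1)"
proof -
  have "rep (\<lambda>t. t / 2 ^ j) j" by (rule rep_inv[OF rep_scale]) simp
  moreover have "rep (\<lambda>t. t + 1) 1" by (rule rep_gen) (simp add: gens_def)
  ultimately have "rep (\<lambda>t. 2 ^ j * (t / 2 ^ j + 1)) (j + (1 + j))"
    using rep_comp[OF rep_scale rep_comp[of "\<lambda>t. t + 1" 1 "\<lambda>t. t / 2 ^ j" j]] by simp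
  then show ?thesis by (simp add: distrib_left mult_2 add.commute add.left_commute)
qed

text \<open>With \<open>N = 2^j\<close>, translations by \<open>4 N\<close> cost
  \<open>2 j + 5\<close> letters, \<open>cutoff N\<close> costs \<open>4 j + 12\<close> and the
  translated \<open>P slow\<close> costs \<open>4 j + 11\<close>. Their commutator has
  \<open>16 j + 46\<close> letters and is raised to the power \<open>j + 1\<close>; a last
  translation gives the power of \<open>f0\<close>.\<close>

lemma rep_f0_pow: "rep (f0 ^^ (2 ^ j)) ((j + 1) * (16 * j + 46) + (2 * j + 5))"
proof -
  define N :: nat where "N = 2 ^ j"
  have N: "N > 0" by (simp add: N_def)
  have eqs: "(2::real) ^ (j + 2) = 4 * real N" "2 * (j + 2) + 1 = 2 * j + 5"
    by (simp_all add: N_def power_add)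
  have up: "rep (\<lambda>t. t + 4 * real N) (2 * j + 5)" using rep_shift[of "j + 2"] unfolding eqs .
  have down: "rep (\<lambda>t. t - 4 * real N) (2 * j + 5)" by (rule rep_inv[OF up]) simp
  have W: "rep W 1" by (rule rep_gen) (simp add: gens_def)
  have V: "rep (W_inv) 1" by (rule rep_inv[OF W]) (rule inv_W)
  have H: "rep (P slow) 1" by (rule rep_gen) (simp add: gens_def)
  have "rep (\<lambda>t. W (W_inv (t - 4 * real N) + 4 * real N)) (1 + ((2 * j + 5) + (1 + (2 * j + 5))))"
    by (rule rep_comp[OF W rep_comp[OF up rep_comp[OF V down]]])
  then have cutoff: "rep (cutoff N) (4 * j + 12)" by (simp add: cutoff_def[abs_def] add.commute)
  have cutoff_inv: "rep (cutoff_inv N) (4 * j + 12)" by (rule rep_inv[OF cutoff cutoff_cutoff_inv])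
  \<comment> \<open>Translating by \<open>N\<close> cells brings the dyadic block starting at
    \<open>2^j\<close> to the cells \<open>0, ..., N - 1\<close>, where \<open>cutoff N\<close>
    acts.\<close>
  define h where "h = (\<lambda>i. slow (i + int N))"
  have "rep (\<lambda>t. P slow (t + 4 * real N) - 4 * real N) ((2 * j + 5) + (1 + (2 * j + 5)))"
    by (rule rep_comp[OF down rep_comp[OF H up]])
  moreover have "P slow (t + 4 * real N) - 4 * real N = P h t" for t
    using P_shift[of slow t "int N"] by (simp add: h_def)
  ultimately have Ph: "rep (P h) (4 * j + 11)" by (simp add: add.commute)
  have Ph': "rep (P (\<lambda>i. - h i)) (4 * j + 11)" by (rule rep_inv[OF Ph P_minus(1)])
  have "h i = 1 / (1 + real j)" if "0 \<le> i" "i < int N" for i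
    unfolding h_def using that by (intro slow_dyadic) (auto simp: N_def)
  then have "Q (\<lambda>i. 1 / (1 + real j) * block N i)
      = (\<lambda>t. P h (cutoff N (P (\<lambda>i. - h i) (cutoff_inv N t))))"
    using commutator_cut[OF N, of h "1 / (1 + real j)"] by auto
  moreover have "rep (\<lambda>t. P h (cutoff N (P (\<lambda>i. - h i) (cutoff_inv N t))))
      ((4 * j + 11) + ((4 * j + 12) + ((4 * j + 11) + (4 * j + 12))))"
    by (rule rep_comp[OF Ph rep_comp[OF cutoff rep_comp[OF Ph' cutoff_inv]]])
  ultimately have "rep (Q (\<lambda>i. 1 / (1 + real j) * block N i)) (16 * j + 46)" by simp
  from rep_pow[OF this, of "j + 1"]
  have "rep (Q (\<lambda>i. 1 / (1 + real j) * block N i) ^^ (j + 1)) ((j + 1) * (16 * j + 46))" .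
  moreover have "Q (\<lambda>i. 1 / (1 + real j) * block N i) ^^ (j + 1) = Q (block N)"
    using Q_pow[of "j + 1" "\<lambda>i. 1 / (1 + real j) * block N i"] by (auto simp: fun_eq_iff add.commute)
  ultimately have "rep (Q (block N)) ((j + 1) * (16 * j + 46))" by simp
  from rep_comp[OF this up] have "rep (\<lambda>t. Q (block N) (t + 4 * real N)) ((j + 1) * (16 * j + 46) + (2 * j + 5))" .
  moreover have "f0 ^^ N = (\<lambda>t. Q (block N) (t + 4 * real N))" using f0_pow by blast
  ultimately show ?thesis by (simp only: N_def)
qed

lemma distorted_f0: "distorted (Diff_plus 1) (interval_map f0)"
proof (rule G.distortedI)
  show "finite gens" "gens \<subseteq> carrier (Diff_plus 1)" "interval_map f0 \<in> gens"
    using gens_carrier by (auto simp: gens_def)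
  fix e :: real assume e: "e > 0"
  let ?l = "\<lambda>j::nat. (j + 1) * (16 * j + 46) + (2 * j + 5)"
  have "(\<lambda>j. ((real j + 1) * (16 * real j + 46) + (2 * real j + 5)) / 2 ^ j) \<longlonglongrightarrow> 0"
    by real_asymp
  then have "\<forall>\<^sub>F j in sequentially. ((real j + 1) * (16 * real j + 46) + (2 * real j + 5)) / 2 ^ j < e"
    using e by (rule order_tendstoD(2))
  then obtain j :: nat where "((real j + 1) * (16 * real j + 46) + (2 * real j + 5)) / 2 ^ j < e"
    by (auto simp: eventually_sequentially)
  then have "(real j + 1) * (16 * real j + 46) + (2 * real j + 5) < e * 2 ^ j"
    by (simp only: pos_divide_less_eq zero_less_power zero_less_numeral)
  moreover have "real (?l j) = (real j + 1) * (16 * real j + 46) + (2 * real j + 5)"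
    by (simp add: algebra_simps)
  ultimately have "real (?l j) \<le> e * real (2 ^ j)" by (simp only: of_nat_power of_nat_numeral less_imp_le)
  moreover have "is_word (Diff_plus 1) gens (interval_map f0 [^]\<^bsub>Diff_plus 1\<^esub> (2 ^ j :: nat)) (?l j)"
    using rep_f0_pow[of j] interval_map_pow[of f0 1 "2 ^ j"] gens_carrier
    by (auto simp: rep_def gens_def)
  ultimately show "\<exists>N l. N > 0 \<and> is_word (Diff_plus 1) gens (interval_map f0 [^]\<^bsub>Diff_plus 1\<^esub> (N::nat)) l
      \<and> real l \<le> e * real N"
    by (intro exI[of _ "2 ^ j"] exI[of _ "?l j"]) auto
qed

end

section \<open>Variation of the logarithm of the derivative\<close>

text \<open>Gaps are allowed, so that a lower bound for the variation can pick out the intervals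
  that contribute.\<close>

definition intervals :: "nat \<Rightarrow> (nat \<Rightarrow> real) \<Rightarrow> (nat \<Rightarrow> real) \<Rightarrow> bool" where
  "intervals n a b \<longleftrightarrow> (\<forall>i<n. 0 \<le> a i \<and> a i \<le> b i \<and> b i \<le> 1) \<and> (\<forall>i. Suc i < n \<longrightarrow> b i \<le> a (Suc i))"

text \<open>A bound on the total variation of \<open>ln g'\<close>, kept as a predicate because in
  class \<open>C^1\<close> this variation may be infinite.\<close>

definition log_var :: "(real \<Rightarrow> real) \<Rightarrow> real \<Rightarrow> bool" where
  "log_var g M \<longleftrightarrow> (\<exists>g'. interval_diffeo g g' \<and> continuous_on {0..1} g' \<and>
     (\<forall>n a b. intervals n a b \<longrightarrow> (\<Sum>i<n. \<bar>ln (g' (b i)) - ln (g' (a i))\<bar>) \<le> M))"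

lemma log_varE:
  assumes "log_var g M"
  obtains g' where "interval_diffeo g g'" "continuous_on {0..1} g'"
    "\<And>n a b. intervals n a b \<Longrightarrow> (\<Sum>i<n. \<bar>ln (g' (b i)) - ln (g' (a i))\<bar>) \<le> M"
  using assms unfolding log_var_def by blast

lemma intervals_sum_le_1:
  assumes "intervals n a b"
  shows "(\<Sum>i<n. b i - a i) \<le> 1"
proof -
  have *: "(\<Sum>i<Suc m. b i - a i) \<le> b m" if "Suc m \<le> n" for m
    using that
  proof (induction m)
    case 0
    then show ?case using assms by (auto simp: intervals_def)
  next
    case (Suc m)
    then have "(\<Sum>i<Suc m. b i - a i) \<le> b m" "b m \<le> a (Suc m)" using assms by (auto simp: intervals_def)
    then show ?case by simp
  qed
  show ?thesis
  proof (cases n)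
    case (Suc m)
    then have "b m \<le> 1" using assms by (auto simp: intervals_def)
    then show ?thesis using *[of m] Suc by simp
  qed simp
qed

lemma intervals_image:
  assumes "intervals n a b" "\<And>x y. x \<in> {0..1} \<Longrightarrow> y \<in> {0..1} \<Longrightarrow> x \<le> y \<Longrightarrow> h x \<le> h y"
    "\<And>x. x \<in> {0..1} \<Longrightarrow> h x \<in> {0..1}"
  shows "intervals n (\<lambda>i. h (a i)) (\<lambda>i. h (b i))"
proof -
  have ab: "a i \<in> {0..1} \<and> b i \<in> {0..1} \<and> a i \<le> b i" if "i < n" for i
    using assms(1) that by (force simp: intervals_def)
  then show ?thesis
    using assms by (auto simp: intervals_def)
qed

section \<open>The variation under composition and inversion, and its finiteness in class
  \<open>C^2\<close>\<close>

lemma (in interval_diffeo) range: "x \<in> {0..1} \<Longrightarrow> F x \<in> {0..1}"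
  using bij by (auto simp: bij_betw_def)

lemma (in interval_diffeo) le_mono: "x \<in> {0..1} \<Longrightarrow> y \<in> {0..1} \<Longrightarrow> x \<le> y \<Longrightarrow> F x \<le> F y"
  using strict_mono_on_leD[OF mono] by blast

lemma (in interval_diffeo) E_le_mono: "x \<in> {0..1} \<Longrightarrow> y \<in> {0..1} \<Longrightarrow> x \<le> y \<Longrightarrow> E x \<le> E y"
  using E_mem E_right mono strict_mono_onD by (metis linorder_not_le)

lemma log_var_one: "log_var (restrict (\<lambda>x. x) {0..1}) 0"
proof -
  have "(restrict (\<lambda>x. x) {0..1} has_real_derivative 1) (at x within {0..1})" if "x \<in> {0..1}" for x :: real
    by (rule has_field_derivative_transform_within[OF DERIV_ident zero_less_one that]) auto
  then have "interval_diffeo (restrict (\<lambda>x. x) {0..1}) (\<lambda>_. 1)" by unfold_locales auto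
  then show ?thesis unfolding log_var_def by (intro exI[of _ "\<lambda>_. 1"]) auto
qed

text \<open>The logarithm of the derivative is a cocycle: that of the composition is the one of
  \<open>g\<close> evaluated at \<open>h\<close>, plus the one of \<open>h\<close>. Reparametrising
  by the increasing map \<open>h\<close> does not raise the variation.\<close>

lemma log_var_compose:
  assumes "log_var g M" "log_var h N"
  shows "log_var (compose {0..1} g h) (M + N)"
proof -
  obtain g' where g: "interval_diffeo g g'" "continuous_on {0..1} g'"
    "\<And>n a b. intervals n a b \<Longrightarrow> (\<Sum>i<n. \<bar>ln (g' (b i)) - ln (g' (a i))\<bar>) \<le> M"
    by (rule log_varE[OF assms(1)], rule that)
  obtain h' where h: "interval_diffeo h h'" "continuous_on {0..1} h'"
    "\<And>n a b. intervals n a b \<Longrightarrow> (\<Sum>i<n. \<bar>ln (h' (b i)) - ln (h' (a i))\<bar>) \<le> N"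
    by (rule log_varE[OF assms(2)], rule that)
  interpret g: interval_diffeo g g' by (fact g)
  interpret h: interval_diffeo h h' by (fact h)
  let ?d = "\<lambda>x. g' (h x) * h' x"
  have "interval_diffeo (compose {0..1} g h) ?d"
  proof
    fix x :: real assume x: "x \<in> {0..1}"
    have "(g has_real_derivative g' (h x)) (at (h x) within h ` {0..1})"
      by (rule DERIV_subset[OF g.deriv[OF h.range[OF x]]]) (use h.range in auto)
    then have "((\<lambda>x. g (h x)) has_real_derivative ?d x) (at x within {0..1})"
      using DERIV_image_chain[of g "g' (h x)" h x "{0..1}" "h' x"] h.deriv[OF x] by (simp add: o_def)
    then show "(compose {0..1} g h has_real_derivative ?d x) (at x within {0..1})"
      by (rule has_field_derivative_transform_within[OF _ zero_less_one x]) (auto simp: compose_def)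
    show "0 < ?d x" using g.pos h.pos h.range x by simp
  qed (simp_all add: compose_def h.F0 h.F1 g.F0 g.F1)
  moreover have "continuous_on {0..1} ?d"
    using h.range by (intro continuous_on_mult h continuous_on_compose2[OF g(2) h.cont]) auto
  moreover have "(\<Sum>i<n. \<bar>ln (?d (b i)) - ln (?d (a i))\<bar>) \<le> M + N" if ab: "intervals n a b" for n a b
  proof -
    have "ln (?d x) = ln (g' (h x)) + ln (h' x)" if "x \<in> {0..1}" for x
      using g.pos[OF h.range[OF that]] h.pos[OF that] by (simp add: ln_mult)
    then have "\<bar>ln (?d (b i)) - ln (?d (a i))\<bar>
        \<le> \<bar>ln (g' (h (b i))) - ln (g' (h (a i)))\<bar> + \<bar>ln (h' (b i)) - ln (h' (a i))\<bar>" if "i < n" for i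
      using ab that by (force simp: intervals_def)
    then have "(\<Sum>i<n. \<bar>ln (?d (b i)) - ln (?d (a i))\<bar>)
        \<le> (\<Sum>i<n. \<bar>ln (g' (h (b i))) - ln (g' (h (a i)))\<bar> + \<bar>ln (h' (b i)) - ln (h' (a i))\<bar>)"
      by (intro sum_mono) auto
    also have "\<dots> = (\<Sum>i<n. \<bar>ln (g' (h (b i))) - ln (g' (h (a i)))\<bar>)
        + (\<Sum>i<n. \<bar>ln (h' (b i)) - ln (h' (a i))\<bar>)"
      by (rule sum.distrib)
    also have "\<dots> \<le> M + N"
      using g(3)[OF intervals_image[OF ab h.le_mono h.range]] h(3)[OF ab] by (rule add_mono)
    finally show ?thesis .
  qed
  ultimately show ?thesis unfolding log_var_def by (intro exI[of _ ?d]) blast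
qed

text \<open>The logarithm of the derivative of the inverse is that of \<open>g\<close> with opposite
  sign, reparametrised by an increasing map.\<close>

lemma log_var_inverse:
  assumes "log_var g M"
  shows "log_var (restrict (inv_into {0..1} g) {0..1}) M"
proof -
  obtain g' where g: "interval_diffeo g g'" "continuous_on {0..1} g'"
    "\<And>n a b. intervals n a b \<Longrightarrow> (\<Sum>i<n. \<bar>ln (g' (b i)) - ln (g' (a i))\<bar>) \<le> M"
    by (rule log_varE[OF assms], rule that)
  interpret g: interval_diffeo g g' by (fact g)
  let ?d = "\<lambda>y. inverse (g' (g.E y))"
  have pos: "0 < ?d y" if "y \<in> {0..1}" for y using g.pos g.E_mem that by simp
  have "interval_diffeo (restrict g.E {0..1}) ?d"
  proof
    fix y :: real assume y: "y \<in> {0..1}"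
    show "(restrict g.E {0..1} has_real_derivative ?d y) (at y within {0..1})"
      by (rule has_field_derivative_transform_within[OF g.E_deriv[OF g(2) y] zero_less_one y]) auto
    show "0 < ?d y" using pos y .
  qed (use g.E_left[of 0] g.E_left[of 1] in \<open>simp_all add: g.F0 g.F1\<close>)
  moreover have "continuous_on {0..1} ?d"
  proof (rule continuous_on_inverse)
    show "continuous_on {0..1} (\<lambda>y. g' (g.E y))"
      using g.E_mem by (intro continuous_on_compose2[OF g(2) g.E_cont]) auto
    show "\<forall>y\<in>{0..1}. g' (g.E y) \<noteq> 0" using g.pos g.E_mem by (metis less_irrefl)
  qed
  moreover have "(\<Sum>i<n. \<bar>ln (?d (b i)) - ln (?d (a i))\<bar>) \<le> M" if ab: "intervals n a b" for n a b
  proof -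
    have "ln (?d y) = - ln (g' (g.E y))" if "y \<in> {0..1}" for y
      using g.pos[OF g.E_mem[OF that]] by (simp add: ln_inverse)
    then have "\<bar>ln (?d (b i)) - ln (?d (a i))\<bar> = \<bar>ln (g' (g.E (b i))) - ln (g' (g.E (a i)))\<bar>" if "i < n" for i
      using ab that by (force simp: intervals_def)
    then have "(\<Sum>i<n. \<bar>ln (?d (b i)) - ln (?d (a i))\<bar>)
        = (\<Sum>i<n. \<bar>ln (g' (g.E (b i))) - ln (g' (g.E (a i)))\<bar>)" by simp
    also have "\<dots> \<le> M" by (rule g(3)[OF intervals_image[OF ab g.E_le_mono g.E_mem]])
    finally show ?thesis .
  qed
  ultimately show ?thesis unfolding log_var_def by (intro exI[of _ ?d]) blast
qed

text \<open>The derivative has no zero, by differentiating the inverse composed with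
  \<open>f\<close>; it is not negative, by monotonicity. An increasing surjection fixes the
  endpoints.\<close>

lemma Diff_plus_interval_diffeo:
  assumes f: "f \<in> Diff_plus_carrier r" and r: "1 \<le> r"
  obtains f' where "interval_diffeo f f'" "continuous_on {0..1} f'"
proof -
  let ?I = "{0..1::real}" and ?e = "inv_into {0..1} f"
  have Ck: "Ck_on (Suc 0) f ?I" "Ck_on (Suc 0) ?e ?I" and mono: "strict_mono_on ?I f"
    and bij: "bij_betw f ?I ?I" and ext: "f \<in> extensional ?I"
    using f r by (auto simp: Diff_plus_carrier_def Bij_def one_enat_def simp del: Ck_on.simps)
  obtain f' e' where f': "\<And>x. x \<in> ?I \<Longrightarrow> (f has_real_derivative f' x) (at x within ?I)" "continuous_on ?I f'"
    and e': "\<And>x. x \<in> ?I \<Longrightarrow> (?e has_real_derivative e' x) (at x within ?I)"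
    using Ck unfolding Ck_on.simps by blast
  have range: "f x \<in> ?I" if "x \<in> ?I" for x using bij that by (auto simp: bij_betw_def)
  have nonzero: "f' x \<noteq> 0" if x: "x \<in> ?I" for x
  proof -
    have "(?e has_real_derivative e' (f x)) (at (f x) within f ` ?I)"
      by (rule DERIV_subset[OF e'[OF range[OF x]]]) (use range in auto)
    then have "((\<lambda>x. ?e (f x)) has_real_derivative e' (f x) * f' x) (at x within ?I)"
      using DERIV_image_chain[of ?e "e' (f x)" f x ?I "f' x"] f'(1)[OF x] by (simp add: o_def)
    then have "((\<lambda>x. x) has_real_derivative e' (f x) * f' x) (at x within ?I)"
      by (rule has_field_derivative_transform_within[OF _ zero_less_one x])
         (use bij_betw_inv_into_left[OF bij] in auto)
    then have "e' (f x) * f' x = 1" using unit_derivative_unique[OF x] DERIV_ident by blast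
    then show ?thesis by auto
  qed
  have nonneg: "0 \<le> f' x" if x: "x \<in> ?I" for x
  proof (rule ccontr)
    assume "\<not> 0 \<le> f' x"
    then have neg: "f' x < 0" by simp
    show False
    \<comment> \<open>At the right endpoint only differences to the left exist; elsewhere those to
      the right are used.\<close>
    proof (cases "x < 1")
      case True
      obtain d where d: "d > 0" "\<And>h. 0 < h \<Longrightarrow> x + h \<in> ?I \<Longrightarrow> h < d \<Longrightarrow> f (x + h) < f x"
        using has_real_derivative_neg_dec_right[OF f'(1)[OF x] neg] by blast
      let ?h = "min (d / 2) (1 - x)"
      have h: "0 < ?h" "x + ?h \<in> ?I" "?h < d" using d(1) True x by auto
      then have "f x < f (x + ?h)" using strict_mono_onD[OF mono x] by simp
      then show False using d(2)[OF h] by simp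
    next
      case False
      obtain d where d: "d > 0" "\<And>h. 0 < h \<Longrightarrow> x - h \<in> ?I \<Longrightarrow> h < d \<Longrightarrow> f x < f (x - h)"
        using has_real_derivative_neg_dec_left[OF f'(1)[OF x] neg] by blast
      let ?h = "min (d / 2) 1"
      have h: "0 < ?h" "x - ?h \<in> ?I" "?h < d" using d(1) False x by auto
      then have "f (x - ?h) < f x" using strict_mono_onD[OF mono h(2) x] by simp
      then show False using d(2)[OF h] by simp
    qed
  qed
  have ends: "f 0 = 0" "f 1 = 1"
  proof -
    have "0 \<in> f ` ?I" "1 \<in> f ` ?I" using bij by (simp_all add: bij_betw_def)
    then obtain x y where xy: "x \<in> ?I" "f x = 0" "y \<in> ?I" "f y = 1" by (metis imageE)
    have "f 0 \<le> f x" "f y \<le> f 1" using strict_mono_on_leD[OF mono, of 0 x] strict_mono_on_leD[OF mono, of y 1] xy by auto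
    then show "f 0 = 0" "f 1 = 1" using xy range[of 0] range[of 1] by auto
  qed
  have "0 < f' x" if "x \<in> ?I" for x using nonneg nonzero that by (simp add: order_less_le)
  then have "interval_diffeo f f'" using ext ends f' by unfold_locales
  then show thesis using that f'(2) by blast
qed

text \<open>The derivative of \<open>ln f'\<close> is \<open>f'' / f'\<close>, bounded by
  compactness. So \<open>ln f'\<close> is Lipschitz, and disjoint subintervals of
  \<open>[0,1]\<close> have total length at most 1.\<close>

lemma log_var_finite:
  assumes f: "f \<in> Diff_plus_carrier 2"
  shows "\<exists>M. log_var f M"
proof -
  have "enat 1 \<le> enat 2" by simp
  then have "1 \<le> (2::enat)" by (simp add: one_enat_def numeral_eq_enat)
  then obtain f' where f': "interval_diffeo f f'" "continuous_on {0..1} f'"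
    using Diff_plus_interval_diffeo[OF f] by blast
  interpret f: interval_diffeo f f' by (fact f')
  have "Ck_on (Suc (Suc 0)) f {0..1}"
    using f by (auto simp: Diff_plus_carrier_def numeral_eq_enat numeral_2_eq_2 simp del: Ck_on.simps)
  then have "Ck_on (Suc 0) f' {0..1}" using f.deriv by (rule Ck_on_derivative)
  then obtain f'' where f'': "\<And>x. x \<in> {0..1} \<Longrightarrow> (f' has_real_derivative f'' x) (at x within {0..1})"
    "continuous_on {0..1} f''" unfolding Ck_on.simps by blast
  have nz: "\<forall>x\<in>{0..1}. f' x \<noteq> 0" using f.pos by fastforce
  have "continuous_on {0..1} (\<lambda>x. f'' x / f' x)"
    using f''(2) f'(2) nz by (rule continuous_on_divide)
  then have "bounded ((\<lambda>x. f'' x / f' x) ` {0..1})"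
    using compact_continuous_image compact_Icc compact_imp_bounded by blast
  then obtain L where L: "\<And>x. x \<in> {0..1} \<Longrightarrow> \<bar>f'' x / f' x\<bar> \<le> L"
    unfolding bounded_iff real_norm_def by (meson imageI)
  have L0: "L \<ge> 0" using order_trans[OF abs_ge_zero L[of 0]] by simp
  have lip: "\<bar>ln (f' y) - ln (f' x)\<bar> \<le> L * \<bar>y - x\<bar>" if "x \<in> {0..1}" "y \<in> {0..1}" for x y
  proof -
    have "norm (ln (f' y) - ln (f' x)) \<le> L * norm (y - x)"
    proof (rule field_differentiable_bound[of "{0..1}" "\<lambda>x. ln (f' x)" "\<lambda>x. f'' x / f' x"])
      fix x :: real assume x: "x \<in> {0..1}"
      show "((\<lambda>x. ln (f' x)) has_real_derivative f'' x / f' x) (at x within {0..1})"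
        using DERIV_chain2[OF DERIV_ln[OF f.pos[OF x]] f''(1)[OF x]] by (simp add: field_simps)
      show "norm (f'' x / f' x) \<le> L" using L[OF x] by simp
    qed (use that in auto)
    then show ?thesis by simp
  qed
  have "(\<Sum>i<n. \<bar>ln (f' (b i)) - ln (f' (a i))\<bar>) \<le> L" if ab: "intervals n a b" for n a b
  proof -
    have "\<bar>ln (f' (b i)) - ln (f' (a i))\<bar> \<le> L * (b i - a i)" if "i < n" for i
      using lip[of "a i" "b i"] ab that by (force simp: intervals_def)
    then have "(\<Sum>i<n. \<bar>ln (f' (b i)) - ln (f' (a i))\<bar>) \<le> (\<Sum>i<n. L * (b i - a i))"
      by (intro sum_mono) auto
    also have "\<dots> = L * (\<Sum>i<n. b i - a i)" by (simp add: sum_distrib_left)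
    also have "\<dots> \<le> L * 1" using intervals_sum_le_1[OF ab] L0 by (rule mult_left_mono)
    finally show ?thesis by simp
  qed
  then show ?thesis unfolding log_var_def using f' by blast
qed

section \<open>Linear growth of the variation\<close>

text \<open>Far out, the chart weights hardly change within a cell: the relative change
  \<open>x\<close> is at most \<open>3 / \<bar>y\<bar>\<close>, and the lower bound 6 keeps it below
  1/2, where \<open>\<bar>ln (1 + x)\<bar> \<le> 2 * \<bar>x\<bar>\<close>.\<close>

lemma ln_one_plus_sq_shift:
  fixes y b :: real
  assumes y: "6 \<le> \<bar>y\<bar>" and b: "\<bar>b\<bar> \<le> 1"
  shows "\<bar>ln (1 + (y + b)\<^sup>2) - ln (1 + y\<^sup>2)\<bar> \<le> 6 / \<bar>y\<bar>"
proof -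
  define x where "x = (2 * y * b + b\<^sup>2) / (1 + y\<^sup>2)"
  have p: "0 < 1 + y\<^sup>2" "0 < 1 + (y + b)\<^sup>2" by (rule one_plus_sq_pos)+
  have "1 + (y + b)\<^sup>2 = (1 + y\<^sup>2) * (1 + x)"
    unfolding x_def using p(1) by (simp add: field_simps power2_eq_square)
  moreover from this have x0: "0 < 1 + x" using p by (simp add: zero_less_mult_iff)
  ultimately have eq: "ln (1 + (y + b)\<^sup>2) - ln (1 + y\<^sup>2) = ln (1 + x)" using p by (simp add: ln_mult)
  have "\<bar>2 * y * b + b\<^sup>2\<bar> \<le> 2 * \<bar>y\<bar> * \<bar>b\<bar> + \<bar>b\<bar> * \<bar>b\<bar>"
    using abs_triangle_ineq[of "2 * y * b" "b\<^sup>2"] by (simp add: abs_mult power2_eq_square)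
  also have "\<dots> \<le> 2 * \<bar>y\<bar> * 1 + 1 * 1" using b by (intro add_mono mult_mono) auto
  also have "\<dots> \<le> 3 * \<bar>y\<bar>" using y by simp
  finally have "\<bar>x\<bar> \<le> 3 * \<bar>y\<bar> / (1 + y\<^sup>2)"
    unfolding x_def using p by (simp add: abs_div_pos[symmetric] divide_right_mono)
  also have "\<dots> \<le> 3 * \<bar>y\<bar> / \<bar>y\<bar>\<^sup>2" using y one_plus_sq_pos[of y] by (intro divide_left_mono) auto
  also have "\<dots> = 3 / \<bar>y\<bar>"
  proof -
    have "3 * z / z\<^sup>2 = 3 / z" if "z > 0" for z :: real using that by (simp add: power2_eq_square)
    moreover have "0 < \<bar>y\<bar>" using y by simp
    ultimately show ?thesis by blast
  qed
  finally have x: "\<bar>x\<bar> \<le> 3 / \<bar>y\<bar>" .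
  also have "3 / \<bar>y\<bar> \<le> 1 / 2" using y by (simp add: field_simps)
  finally have half: "\<bar>x\<bar> \<le> 1 / 2" .
  have "\<bar>ln (1 + x) - x\<bar> \<le> 2 * x\<^sup>2" using half by (rule abs_ln_one_plus_x_minus_x_bound)
  moreover have "2 * x\<^sup>2 \<le> \<bar>x\<bar>"
    using mult_right_mono[OF half, of "\<bar>x\<bar>"] by (simp add: power2_eq_square flip: abs_mult)
  ultimately have "\<bar>ln (1 + x)\<bar> \<le> 2 * \<bar>x\<bar>" by linarith
  then show ?thesis using x eq by simp
qed

text \<open>On this window \<open>t + 4 N - 1\<close> lies in the fixed part of cell
  \<open>i - 1\<close>, so the inverse copy in \<open>Q\<close> is not seen. Starting left of
  \<open>4 i\<close> makes it an open neighbourhood of that point, where a derivative is taken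
  next.\<close>

lemma f0_pow_cell:
  assumes "i < N" "4 * real i - 1 < t + 4 * real N" "t + 4 * real N < 4 * real i + 1"
  shows "(f0 ^^ N) t = 4 * real i + \<kappa> 1 (t + 4 * real N - 4 * real i)"
proof -
  let ?s = "t + 4 * real N"
  let ?b = "\<lambda>j. - block N j"
  have "4 * of_int (int i - 1) \<le> ?s - 1" "?s - 1 < 4 * of_int (int i - 1) + 4"
    "4 * of_int (int i - 1) + 1 \<le> ?s - 1" using assms by auto
  then have "P ?b (?s - 1) = ?s - 1" by (rule P_cell_range(4))
  then have "(f0 ^^ N) t = P (block N) ?s" by (simp add: f0_pow Q_def)
  also have "\<dots> = 4 * real i + \<kappa> 1 (?s - 4 * real i)"
    using cell_neighbourhood(1)[of "int i" ?s "block N"] assms by (simp add: block_def)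
  finally show ?thesis .
qed

lemma ln_derivative_f0_pow:
  assumes g: "interval_diffeo (interval_map (f0 ^^ N)) g'"
    and i: "i < N" and u: "0 \<le> u" "u < 1"
  shows "ln (g' (\<sigma> (4 * real i + u - 4 * real N))) =
    ln (\<kappa>' 1 u) + ln (1 + (4 * real i - 4 * real N + u)\<^sup>2) - ln (1 + (4 * real i + \<kappa> 1 u)\<^sup>2)"
proof -
  interpret g: interval_diffeo "interval_map (f0 ^^ N)" g' by (fact g)
  let ?t = "4 * real i + u - 4 * real N"
  let ?k = "\<lambda>t. 4 * real i + \<kappa> 1 (t + (4 * real N - 4 * real i))"
  have v: "(f0 ^^ N) ?t = 4 * real i + \<kappa> 1 u" using f0_pow_cell[OF i, of ?t] u by simp
  have "((\<lambda>t. t + (4 * real N - 4 * real i)) has_real_derivative 1) (at ?t)"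
    by (auto intro!: derivative_eq_intros)
  from DERIV_add[OF DERIV_const DERIV_chain2[OF DERIV_\<kappa> this]]
  have "(?k has_real_derivative \<kappa>' 1 u) (at ?t)" by simp
  then have "((f0 ^^ N) has_real_derivative \<kappa>' 1 u) (at ?t)"
    by (rule has_field_derivative_transform_within_open
          [of _ _ _ "{4 * real i - 1 - 4 * real N<..<4 * real i + 1 - 4 * real N}"])
       (use u f0_pow_cell[OF i] in \<open>auto simp: algebra_simps\<close>)
  then have "(interval_map (f0 ^^ N) has_real_derivative
      \<kappa>' 1 u * ((1 + ?t\<^sup>2) / (1 + ((f0 ^^ N) ?t)\<^sup>2))) (at (\<sigma> ?t))"
    using DERIV_interval_map[OF \<sigma>_range, of "f0 ^^ N" "\<kappa>' 1 u" ?t] by simp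
  then have "g' (\<sigma> ?t) = \<kappa>' 1 u * ((1 + ?t\<^sup>2) / (1 + ((f0 ^^ N) ?t)\<^sup>2))"
    using g.deriv_at[OF \<sigma>_range] DERIV_unique by blast
  then show ?thesis
    unfolding v using \<kappa>'_pos[of 1 u] one_plus_sq_pos[of ?t] one_plus_sq_pos[of "4 * real i + \<kappa> 1 u"]
    by (simp add: ln_mult ln_div add_diff_eq diff_add_eq)
qed

text \<open>\<open>\<kappa> 1\<close> fixes 0 and pushes the midpoint to the right, so the mean
  value theorem on \<open>[0, 1/2]\<close> gives a slope above 1.\<close>

lemma expanding_point: "\<exists>u. 0 < u \<and> u < 1 \<and> 1 < \<kappa>' 1 u"
proof -
  have "sinh (\<tau> (1/2)) = 0" by (simp add: \<tau>_def)
  then have "flow 1 (\<tau> (1/2)) = arsinh 1" by (simp add: flow_def)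
  moreover have "(0::real) < arsinh 1" using arsinh_real_strict_mono[of 0 1] by simp
  ultimately have "1/2 < \<kappa> 1 (1/2)" by (simp add: \<kappa>_def \<sigma>_def)
  moreover obtain u where u: "0 < u" "u < 1/2" "\<kappa> 1 (1/2) - \<kappa> 1 0 = (1/2 - 0) * \<kappa>' 1 u"
    using MVT2[of 0 "1/2" "\<kappa> 1" "\<kappa>' 1"] DERIV_\<kappa> by (metis half_gt_zero zero_less_one)
  ultimately have "1 < \<kappa>' 1 u" by (simp add: \<kappa>_fix)
  then show ?thesis using u by (intro exI[of _ u]) auto
qed

text \<open>In each cell the points with offsets 0 and \<open>u\<close> have line derivatives 1 and
  \<open>exp \<delta>\<close>. The weights at source and image disturb this difference of logarithms
  by at most \<open>\<delta> / 4\<close> each, so every cell far from both ends contributes at least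
  \<open>\<delta> / 2\<close>.\<close>

lemma log_var_f0_pow:
  obtains c :: real and n0 :: nat where "c > 0"
    "\<And>n M. n \<ge> n0 \<Longrightarrow> log_var (interval_map (f0 ^^ n)) M \<Longrightarrow> c * real n \<le> M"
proof -
  obtain u where u: "0 < u" "u < 1" "1 < \<kappa>' 1 u" using expanding_point by blast
  define \<delta> where "\<delta> = ln (\<kappa>' 1 u)"
  have \<delta>: "\<delta> > 0" using u by (simp add: \<delta>_def)
  \<comment> \<open>The bound 6 serves \<open>ln_one_plus_sq_shift\<close>, and
    \<open>24 / \<delta>\<close> brings its error \<open>6 / \<bar>y\<bar>\<close> down to
    \<open>\<delta> / 4\<close>.\<close>
  obtain i0 :: nat where i0: "real i0 > max 6 (24 / \<delta>)" using reals_Archimedean2 by blast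
  have small: "\<bar>ln (1 + (y + b)\<^sup>2) - ln (1 + y\<^sup>2)\<bar> \<le> \<delta> / 4" if "real i0 \<le> \<bar>y\<bar>" "\<bar>b\<bar> \<le> 1" for y b
  proof -
    have "\<bar>ln (1 + (y + b)\<^sup>2) - ln (1 + y\<^sup>2)\<bar> \<le> 6 / \<bar>y\<bar>"
      using that i0 by (intro ln_one_plus_sq_shift) auto
    also have "\<dots> \<le> \<delta> / 4"
    proof -
      have "24 / \<delta> \<le> \<bar>y\<bar>" "0 < \<bar>y\<bar>" using that i0 by auto
      then show ?thesis using \<delta> by (simp add: field_simps)
    qed
    finally show ?thesis .
  qed
  have "\<delta> / 4 * real n \<le> M" if n: "n \<ge> 4 * i0" and M: "log_var (interval_map (f0 ^^ n)) M" for n M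
  proof -
    obtain g' where g': "interval_diffeo (interval_map (f0 ^^ n)) g'"
      "\<And>m a b. intervals m a b \<Longrightarrow> (\<Sum>i<m. \<bar>ln (g' (b i)) - ln (g' (a i))\<bar>) \<le> M"
      by (rule log_varE[OF M], rule that)
    \<comment> \<open>The first \<open>i0\<close> cells have images near 0 and the last
      \<open>i0\<close> have sources near 0; both are dropped, and \<open>n \<ge> 4 * i0\<close>
      leaves at least half of the cells.\<close>
    let ?m = "n - 2 * i0"
    let ?a = "\<lambda>j. \<sigma> (4 * real (i0 + j) + 0 - 4 * real n)" and ?b = "\<lambda>j. \<sigma> (4 * real (i0 + j) + u - 4 * real n)"
    have "\<sigma> s \<le> \<sigma> t" if "s \<le> t" for s t using that by (metis \<sigma>_strict_mono less_eq_real_def)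
    then have "intervals ?m ?a ?b"
      using u \<sigma>_range by (auto simp: intervals_def less_imp_le)
    then have "(\<Sum>j<?m. \<bar>ln (g' (?b j)) - ln (g' (?a j))\<bar>) \<le> M" by (rule g'(2))
    moreover have "\<delta> / 2 \<le> \<bar>ln (g' (?b j)) - ln (g' (?a j))\<bar>" if j: "j < ?m" for j
    proof -
      let ?i = "i0 + j"
      have i: "?i < n" using j by simp
      let ?y = "4 * real ?i - 4 * real n" and ?z = "4 * real ?i"
      have "ln (g' (?a j)) = ln (1 + ?y\<^sup>2) - ln (1 + ?z\<^sup>2)"
        using ln_derivative_f0_pow[OF g'(1) i, of 0] by (simp add: \<kappa>'_outside \<kappa>_fix)
      moreover have "ln (g' (?b j)) = \<delta> + ln (1 + (?y + u)\<^sup>2) - ln (1 + (?z + \<kappa> 1 u)\<^sup>2)"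
        using ln_derivative_f0_pow[OF g'(1) i, of u] u by (simp add: \<delta>_def)
      moreover have "\<bar>ln (1 + (?y + u)\<^sup>2) - ln (1 + ?y\<^sup>2)\<bar> \<le> \<delta> / 4"
      proof (rule small)
        have "real ?i + real i0 \<le> real n" using j by linarith
        then show "real i0 \<le> \<bar>?y\<bar>" by simp
      qed (use u in auto)
      moreover have "\<bar>ln (1 + (?z + \<kappa> 1 u)\<^sup>2) - ln (1 + ?z\<^sup>2)\<bar> \<le> \<delta> / 4"
        using \<kappa>_unit[of u 1] u by (intro small) auto
      ultimately show ?thesis by linarith
    qed
    then have "(\<Sum>j<?m. \<delta> / 2) \<le> (\<Sum>j<?m. \<bar>ln (g' (?b j)) - ln (g' (?a j))\<bar>)" by (intro sum_mono) auto
    moreover have "\<delta> / 4 * real n \<le> (\<Sum>j<?m. \<delta> / 2)"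
    proof -
      have "real n / 2 \<le> real ?m" using n by linarith
      then have "\<delta> / 2 * (real n / 2) \<le> \<delta> / 2 * real ?m" using \<delta> by (intro mult_left_mono) auto
      then show ?thesis by (simp add: mult.commute)
    qed
    ultimately show ?thesis by linarith
  qed
  then show thesis using that[of "\<delta> / 4" "4 * i0"] \<delta> by simp
qed

section \<open>Undistortion in class \<open>C^2\<close>, and both properties combined\<close>

lemma not_distorted_f0: "\<not> distorted (Diff_plus 2) (interval_map f0)"
proof -
  interpret G: group "Diff_plus 2" by (rule group_Diff_plus)
  obtain c :: real and n0 :: nat where c: "c > 0"
    "\<And>n M. n \<ge> n0 \<Longrightarrow> log_var (interval_map (f0 ^^ n)) M \<Longrightarrow> c * real n \<le> M"
    using log_var_f0_pow by blast
  have f0: "interval_map f0 \<in> Diff_plus_carrier 2"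
    using f0_in_Diff_infinity Diff_plus_carrier_antimono[of 2 \<infinity>] by auto
  show ?thesis
  proof (rule G.not_distortedI[of log_var])
    show "log_var \<one>\<^bsub>Diff_plus 2\<^esub> 0" unfolding one_Diff_plus by (rule log_var_one)
    show "log_var g M'" if "log_var g M" "M \<le> M'" for g M M'
      using that unfolding log_var_def by (meson order_trans)
    show "log_var (g \<otimes>\<^bsub>Diff_plus 2\<^esub> h) (M + M')"
      if "g \<in> carrier (Diff_plus 2)" "h \<in> carrier (Diff_plus 2)" "log_var g M" "log_var h M'" for g h M M'
      using that log_var_compose mult_Diff_plus by simp
    show "log_var (inv\<^bsub>Diff_plus 2\<^esub> g) M" if "g \<in> carrier (Diff_plus 2)" "log_var g M" for g M
      using that log_var_inverse inv_Diff_plus by simp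
    show "\<exists>M. log_var g M" if "g \<in> carrier (Diff_plus 2)" for g using that log_var_finite by simp
    show "c * real n \<le> M" if "n \<ge> n0" "log_var (interval_map f0 [^]\<^bsub>Diff_plus 2\<^esub> n) M" for n M
      using that c(2) interval_map_pow[OF f0] by simp
  qed (fact c(1))
qed

theorem mainTheorem1:
  shows "\<exists>f \<in> carrier (Diff_plus \<infinity>). distorted (Diff_plus 1) f \<and> undistorted (Diff_plus 2) f"
proof (rule bexI[of _ "interval_map f0"])
  show "interval_map f0 \<in> carrier (Diff_plus \<infinity>)" using f0_in_Diff_infinity by simp
  then have "interval_map f0 \<in> carrier (Diff_plus 2)"
    using Diff_plus_carrier_antimono[of 2 \<infinity>] by auto
  then show "distorted (Diff_plus 1) (interval_map f0) \<and> undistorted (Diff_plus 2) (interval_map f0)"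
    using distorted_f0 not_distorted_f0 by (simp add: undistorted_def)
qed

end
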